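(* Let $L>0$ and, for $\lambda>0$, let $u=u^{(\lambda)}$ be the mild solution of $\partial_t u_t(x)=\frac12\partial_{xx}u_t(x)+\lambda\sigma(u_t(x))\dot W(t,x)$, $0<x<L$, $t>0$, with $u_t(0)=u_t(L)=0$ for $t>0$ and initial condition $u_0$. Let $\mathcal{E}_t(\lambda):=\sqrt{\mathrm{E}\|u_t\|^2_{L^2(0,L)}}$ be the energy of the solution. Let $0<\epsilon<L/2$ and let $\lambda_0,\lambda_1>0$ be such that (i) for all $\lambda\in(0,\lambda_0)$ and $x\in(0,L)$, $-\infty<\limsup_{t\to\infty}\frac1t\log\mathrm{E}|u_t(x)|^2<0$; (ii) for all $\lambda>\lambda_1$ and $x\in[\epsilon,L-\epsilon]$, $0<\liminf_{t\to\infty}\frac1t\log\mathrm{E}|u_t(x)|^2<\infty$. Then $$-\infty<\limsup_{t\to\infty}\frac1t\log\mathcal{E}_t(\lambda)<0\quad\text{for all }\lambda\in(0,\lambda_0),$$ and $$0<\liminf_{t\to\infty}\frac1t\log\mathcal{E}_t(\lambda)<\infty\quad\text{for all }\lambda>\lambda_1.$$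
   Context: $\dot W$ is space-time white noise on $(0,\infty)\times(0,L)$. The function $\sigma:\mathbf{R}\to\mathbf{R}$ is globally Lipschitz and satisfies $l_\sigma|x|\le|\sigma(x)|\le L_\sigma|x|$ for all $x\in\mathbf{R}$, where $l_\sigma,L_\sigma$ are positive constants. The initial condition $u_0:[0,L]\to[0,\infty)$ is a (deterministic) non-negative bounded function with positive support inside $[0,L]$, i.e. $\{u_0>0\}$ has positive Lebesgue measure. Following Walsh, a mild solution is a predictable random field satisfying $$u_t(x)=\int_0^L u_0(y)p_D(t,x,y)\,dy+\lambda\int_0^L\int_0^t p_D(t-s,x,y)\sigma(u_s(y))\,W(ds,dy),$$ where $p_D$ is the heat kernel of $\frac12\partial_{xx}$ on $(0,L)$ with Dirichlet boundary condition and the stochastic integral is in the sense of Walsh. It is known that there is a unique (up to modification) mild solution with $\sup_{0\le t\le T,\,x}\mathrm{E}|u_t(x)|^2<\infty$ for all $T<\infty$. Constants $\lambda_0$ (independent of $\epsilon$) and $\lambda_1$ (depending on $\epsilon$) with properties (i) and (ii) exist. *)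

theory Defs
  imports "HOL-Probability.Probability"
begin

text \<open>
  The kernel of the semigroup generated by one half of the Dirichlet Laplacian on \<open>(0, L)\<close>, expanded
  in the orthonormal eigenfunctions \<open>sqrt (2 / L) * sin (n * pi * x / L)\<close>, \<open>n \<ge> 1\<close>, whose eigenvalues
  are \<open>(n * pi / L)\<^sup>2 / 2\<close>. It is only meaningful for \<open>t > 0\<close>, where the series converges absolutely.
\<close>

definition dirichlet_heat_kernel :: "real \<Rightarrow> real \<Rightarrow> real \<Rightarrow> real \<Rightarrow> real" where
  "dirichlet_heat_kernel L t x y =
     (\<Sum>k. let n = real (Suc k) in
        2 / L * sin (n * pi * x / L) * sin (n * pi * y / L) * exp (- (n * pi / L)\<^sup>2 / 2 * t))"

text \<open>The case \<open>v = 0\<close> is separate because a degenerate normal law has no density.\<close>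

definition centered_normal :: "'w measure \<Rightarrow> ('w \<Rightarrow> real) \<Rightarrow> real \<Rightarrow> bool" where
  "centered_normal M X v \<longleftrightarrow>
     X \<in> borel_measurable M \<and>
     (if v = 0 then AE \<omega> in M. X \<omega> = 0
      else distributed M lborel X (normal_density 0 (sqrt v)))"

definition noise_sets :: "real set \<Rightarrow> real \<Rightarrow> (real \<times> real) set set" where
  "noise_sets I L = {A \<in> sets borel. A \<subseteq> I \<times> {0<..<L} \<and> emeasure lborel A < \<infinity>}"

text \<open>
  White noise is a centered Gaussian process indexed by the Borel sets of finite area, in the sense
  that all finite linear combinations are normal, with covariance
  \<open>E (W A * W B) = measure lborel (A \<inter> B)\<close>.
\<close>

definition white_noise :: "'w measure \<Rightarrow> real \<Rightarrow> ((real \<times> real) set \<Rightarrow> 'w \<Rightarrow> real) \<Rightarrow> bool" where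
  "white_noise M L W \<longleftrightarrow>
     (\<forall>\<A> c. finite \<A> \<and> \<A> \<subseteq> noise_sets {0<..} L \<longrightarrow>
        centered_normal M (\<lambda>\<omega>. \<Sum>A\<in>\<A>. c A * W A \<omega>)
          (\<Sum>A\<in>\<A>. \<Sum>B\<in>\<A>. c A * c B * measure lborel (A \<inter> B)))"

text \<open>
  Any filtration to which the noise is adapted and whose \<open>\<sigma>\<close>-algebra at time \<open>t\<close> is independent of the
  noise after time \<open>t\<close>. The filtration generated by the noise is an instance, with or without
  augmentation by null sets. Only times \<open>t \<ge> 0\<close> matter; the locale \<open>filtration\<close> also mentions
  negative ones, where \<open>F t = F 0\<close> can be taken.
\<close>

definition noise_filtration ::
    "'w measure \<Rightarrow> real \<Rightarrow> ((real \<times> real) set \<Rightarrow> 'w \<Rightarrow> real) \<Rightarrow> (real \<Rightarrow> 'w measure) \<Rightarrow> bool" where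
  "noise_filtration M L W F \<longleftrightarrow>
     filtration (space M) F \<and>
     (\<forall>t. subalgebra M (F t)) \<and>
     (\<forall>t\<ge>0. \<forall>A\<in>noise_sets {0<..t} L. W A \<in> borel_measurable (F t)) \<and>
     (\<forall>t\<ge>0. prob_space.indep_set M (sets (F t))
        (sigma_sets (space M) {W A -` B \<inter> space M | A B. A \<in> noise_sets {t<..} L \<and> B \<in> sets borel}))"

text \<open>The boundary points \<open>0\<close> and \<open>L\<close> are included so that boundary values are part of the field.\<close>

definition predictable_algebra ::
    "'w measure \<Rightarrow> (real \<Rightarrow> 'w measure) \<Rightarrow> real \<Rightarrow> (real \<times> real \<times> 'w) measure" where
  "predictable_algebra M F L =
     sigma ({0<..} \<times> {0..L} \<times> space M)
       {{a<..b} \<times> A \<times> G | a b A G.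
          0 \<le> a \<and> a \<le> b \<and> A \<in> sets borel \<and> A \<subseteq> {0..L} \<and> G \<in> sets (F a)}"

definition predictable ::
    "'w measure \<Rightarrow> (real \<Rightarrow> 'w measure) \<Rightarrow> real \<Rightarrow> (real \<Rightarrow> real \<Rightarrow> 'w \<Rightarrow> real) \<Rightarrow> bool" where
  "predictable M F L \<Phi> \<longleftrightarrow>
     (\<lambda>(s, y, \<omega>). \<Phi> s y \<omega>) \<in> borel_measurable (predictable_algebra M F L)"

text \<open>
  An entry \<open>(a, b, A, X)\<close> of the list stands for the elementary field
  \<open>X \<omega> * indicator {a<..b} s * indicator A y\<close>, the list for the sum of its entries.
\<close>

type_synonym 'w simple_field = "(real \<times> real \<times> real set \<times> ('w \<Rightarrow> real)) list"

definition simple_field :: "'w measure \<Rightarrow> (real \<Rightarrow> 'w measure) \<Rightarrow> real \<Rightarrow> 'w simple_field \<Rightarrow> bool" where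
  "simple_field M F L S \<longleftrightarrow>
     (\<forall>(a, b, A, X)\<in>set S.
        0 \<le> a \<and> a \<le> b \<and> A \<in> sets borel \<and> A \<subseteq> {0<..<L} \<and>
        X \<in> borel_measurable (F a) \<and> bounded (X ` space M))"

definition simple_value :: "'w simple_field \<Rightarrow> real \<Rightarrow> real \<Rightarrow> 'w \<Rightarrow> real" where
  "simple_value S s y \<omega> =
     (\<Sum>(a, b, A, X)\<leftarrow>S. X \<omega> * indicator {a<..b} s * indicator A y)"

definition simple_integral ::
    "((real \<times> real) set \<Rightarrow> 'w \<Rightarrow> real) \<Rightarrow> 'w simple_field \<Rightarrow> 'w \<Rightarrow> real" where
  "simple_integral W S \<omega> = (\<Sum>(a, b, A, X)\<leftarrow>S. X \<omega> * W ({a<..b} \<times> A) \<omega>)"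

text \<open>
  \<open>J\<close> is a version of the Walsh integral of the predictable field \<open>\<Phi>\<close> over \<open>(0, \<infinity>) \<times> (0, L)\<close>: the
  \<open>L\<^sup>2\<close>-limit of the integrals of simple fields that approximate \<open>\<Phi>\<close> in
  \<open>L\<^sup>2 (dt dx P(d\<omega>))\<close>.
\<close>

definition has_walsh_integral ::
    "'w measure \<Rightarrow> (real \<Rightarrow> 'w measure) \<Rightarrow> ((real \<times> real) set \<Rightarrow> 'w \<Rightarrow> real) \<Rightarrow> real \<Rightarrow>
     (real \<Rightarrow> real \<Rightarrow> 'w \<Rightarrow> real) \<Rightarrow> ('w \<Rightarrow> real) \<Rightarrow> bool" where
  "has_walsh_integral M F W L \<Phi> J \<longleftrightarrow>
     predictable M F L \<Phi> \<and> J \<in> borel_measurable M \<and>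
     (\<exists>S :: nat \<Rightarrow> 'w simple_field.
        (\<forall>n. simple_field M F L (S n)) \<and>
        (\<lambda>n. \<integral>\<^sup>+\<omega>. (\<integral>\<^sup>+z\<in>{0<..}\<times>{0<..<L}.
               ennreal ((\<Phi> (fst z) (snd z) \<omega> - simple_value (S n) (fst z) (snd z) \<omega>)\<^sup>2) \<partial>lborel) \<partial>M)
          \<longlonglongrightarrow> 0 \<and>
        (\<lambda>n. \<integral>\<^sup>+\<omega>. ennreal ((J \<omega> - simple_integral W (S n) \<omega>)\<^sup>2) \<partial>M) \<longlonglongrightarrow> 0)"

text \<open>
  The Dirichlet boundary condition is the mild equation at \<open>x = 0\<close> and \<open>x = L\<close>, where the
  kernel vanishes. The initial function is only assumed Lebesgue measurable, hence \<open>lebesgue\<close>.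
\<close>

definition mild_solution ::
    "'w measure \<Rightarrow> (real \<Rightarrow> 'w measure) \<Rightarrow> ((real \<times> real) set \<Rightarrow> 'w \<Rightarrow> real) \<Rightarrow> real \<Rightarrow>
     (real \<Rightarrow> real) \<Rightarrow> (real \<Rightarrow> real) \<Rightarrow> real \<Rightarrow> (real \<Rightarrow> real \<Rightarrow> 'w \<Rightarrow> real) \<Rightarrow> bool" where
  "mild_solution M F W L \<sigma> u0 lam u \<longleftrightarrow>
     predictable M F L u \<and>
     (\<forall>x\<in>{0..L}. AE \<omega> in M. u 0 x \<omega> = u0 x) \<and>
     (\<forall>t>0. \<forall>x\<in>{0..L}. \<exists>J.
        has_walsh_integral M F W L
          (\<lambda>s y \<omega>. if 0 < s \<and> s < t
                   then dirichlet_heat_kernel L (t - s) x y * \<sigma> (u s y \<omega>) else 0) J \<and>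
        (AE \<omega> in M. u t x \<omega> =
           (LINT y:{0..L}|lebesgue. u0 y * dirichlet_heat_kernel L t x y) + lam * J \<omega>))"

definition bounded_second_moments ::
    "'w measure \<Rightarrow> real \<Rightarrow> (real \<Rightarrow> real \<Rightarrow> 'w \<Rightarrow> real) \<Rightarrow> bool" where
  "bounded_second_moments M L u \<longleftrightarrow>
     (\<forall>T>0. (SUP t\<in>{0..T}. SUP x\<in>{0..L}. \<integral>\<^sup>+\<omega>. ennreal ((u t x \<omega>)\<^sup>2) \<partial>M) < \<infinity>)"

definition l2_norm :: "real \<Rightarrow> (real \<Rightarrow> real) \<Rightarrow> real" where
  "l2_norm L f = sqrt (LINT x:{0<..<L}|lborel. (f x)\<^sup>2)"

definition energy :: "'w measure \<Rightarrow> real \<Rightarrow> (real \<Rightarrow> real \<Rightarrow> 'w \<Rightarrow> real) \<Rightarrow> real \<Rightarrow> real" where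
  "energy M L u t = sqrt (prob_space.expectation M (\<lambda>\<omega>. (l2_norm L (\<lambda>x. u t x \<omega>))\<^sup>2))"

text \<open>
  Growth rates are taken in the extended reals, so finiteness is a genuine assertion. The logarithm
  itself is real: by the mild equation the second moments inside \<open>(0, L)\<close> and the energy are positive
  for \<open>t > 0\<close>, so the convention \<open>ln 0 = 0\<close> plays no role.
\<close>

definition upper_rate :: "(real \<Rightarrow> real) \<Rightarrow> ereal" where
  "upper_rate f = Limsup at_top (\<lambda>t. ereal (1 / t * ln (f t)))"

definition lower_rate :: "(real \<Rightarrow> real) \<Rightarrow> ereal" where
  "lower_rate f = Liminf at_top (\<lambda>t. ereal (1 / t * ln (f t)))"

end

theory Submission
  imports Defs "HOL-Real_Asymp.Real_Asymp"
begin

text \<open>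
  Write \<open>p\<close> for the Dirichlet heat kernel, \<open>V t x\<close> for the second moment of \<open>u t x\<close> and \<open>m t x\<close>
  for the deterministic part of the mild equation. The Walsh isometry and the vanishing mean of Walsh
  integrals turn the mild equation into a deterministic renewal equation
  \<open>V t x = (m t x)\<^sup>2 + lam\<^sup>2 * (integral over s < t and y of p (t - s) x y ^ 2 * Q (s, y))\<close>, where
  \<open>Q (s, y) = E (\<sigma> (u s y) ^ 2)\<close> is at most \<open>L\<^sub>\<sigma>\<^sup>2 * V s y\<close>; this is \<open>second_moment_identity\<close>. The squared
  energy is the integral of \<open>V t\<close> over space. The hypotheses are pointwise in \<open>x\<close>, with no uniformity,
  so the point is to pass from single points to the whole interval.

  Decay. It spreads from the midpoint to all points. Split the time integral at distance \<open>\<delta>\<close> from \<open>t\<close>.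
  For times \<open>s \<le> t - \<delta>\<close> the kernel at any \<open>x\<close> is at most a constant times the kernel at the midpoint
  after a further fixed time \<open>T0\<close> (\<open>heat_kernel_comparison\<close>), because both have the size of the ground
  state mode. Hence the deterministic part and the distant past contribute at most a constant times
  \<open>V (t + T0) (L / 2)\<close>, which decays by assumption (\<open>far_past_bound\<close>): the renewal equation at the
  later time contains the same past. The recent past contributes a small multiple of the supremum
  of \<open>V\<close>, because the square of the kernel has small mass near time zero, uniformly in \<open>x\<close> (\<open>heat_kernel_laplace_small\<close>). With exponential weights this
  small feedback is absorbed, and \<open>V\<close> decays exponentially, uniformly in \<open>x\<close> (\<open>uniform_decay\<close>).

  Growth. If the energy did not grow exponentially, then along some sequence of times it would grow
  at rate tending to zero; Fatou's lemma along that sequence contradicts the positive pointwise rates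
  on \<open>[\<epsilon>, L - \<epsilon>]\<close> (\<open>energy_growth\<close>).

  The remaining two bounds hold for every \<open>lam > 0\<close>. The weight \<open>exp (- \<beta> * t)\<close> with \<open>\<beta>\<close> large makes the
  whole noise term a small feedback, so the energy grows at most exponentially
  (\<open>exponential_growth_bound\<close>). The deterministic part alone is bounded below by a multiple of the
  ground state mode, so the energy decays at most exponentially (\<open>energy_lower\<close>).
\<close>

section \<open>The Dirichlet heat kernel compared with its ground state mode\<close>

definition kernel_mode :: "real \<Rightarrow> real \<Rightarrow> real \<Rightarrow> real \<Rightarrow> nat \<Rightarrow> real" where
  "kernel_mode L t x y n =
     2 / L * sin (real n * pi * x / L) * sin (real n * pi * y / L) * exp (- (real n * pi / L)\<^sup>2 / 2 * t)"

text \<open>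
  Smallest eigenvalue of one half of the Dirichlet Laplacian; \<open>ground_state\<close> is the corresponding
  eigenfunction, normalised to have maximum \<open>1\<close> rather than unit norm in \<open>L\<^sup>2\<close>.
\<close>

definition decay_rate :: "real \<Rightarrow> real" where
  "decay_rate L = (pi / L)\<^sup>2 / 2"

definition ground_state :: "real \<Rightarrow> real \<Rightarrow> real" where
  "ground_state L x = sin (pi * x / L)"

lemma dirichlet_heat_kernel_eq_suminf:
  "dirichlet_heat_kernel L t x y = (\<Sum>k. kernel_mode L t x y (Suc k))"
  by (simp add: dirichlet_heat_kernel_def kernel_mode_def Let_def)

lemma decay_rate_pos: "L > 0 \<Longrightarrow> decay_rate L > 0"
  by (simp add: decay_rate_def)

lemma ground_state_nonneg: "L > 0 \<Longrightarrow> x \<in> {0..L} \<Longrightarrow> 0 \<le> ground_state L x"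
  unfolding ground_state_def by (intro sin_ge_zero) (auto simp: field_simps)

lemma ground_state_pos: "L > 0 \<Longrightarrow> x \<in> {0<..<L} \<Longrightarrow> 0 < ground_state L x"
  unfolding ground_state_def by (intro sin_gt_zero) (auto simp: field_simps)

lemma ground_state_le_1: "ground_state L x \<le> 1"
  by (simp add: ground_state_def)

lemma ground_state_mid: "L > 0 \<Longrightarrow> ground_state L (L / 2) = 1"
  by (simp add: ground_state_def)

lemma continuous_on_ground_state: "continuous_on A (ground_state L)"
proof -
  have "continuous_on A (\<lambda>x. sin (pi * x * inverse L))"
    by (intro continuous_intros)
  then show ?thesis by (simp add: ground_state_def[abs_def] divide_inverse)
qed

lemma ground_state_measurable [measurable]: "ground_state L \<in> borel_measurable borel"
  by (intro borel_measurable_continuous_onI continuous_on_ground_state)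

lemma abs_sin_mult_le: "\<bar>sin (real n * \<theta>)\<bar> \<le> real n * \<bar>sin \<theta>\<bar>"
proof (induction n)
  case (Suc n)
  have "\<bar>sin (real (Suc n) * \<theta>)\<bar> = \<bar>sin (real n * \<theta>) * cos \<theta> + cos (real n * \<theta>) * sin \<theta>\<bar>"
    using sin_add[of "real n * \<theta>" \<theta>] by (simp add: algebra_simps)
  also have "\<dots> \<le> \<bar>sin (real n * \<theta>)\<bar> * \<bar>cos \<theta>\<bar> + \<bar>cos (real n * \<theta>)\<bar> * \<bar>sin \<theta>\<bar>"
    by (metis abs_mult abs_triangle_ineq)
  also have "\<dots> \<le> \<bar>sin (real n * \<theta>)\<bar> * 1 + 1 * \<bar>sin \<theta>\<bar>"
    by (intro add_mono mult_mono) auto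
  finally show ?case using Suc by (simp add: algebra_simps)
qed simp

text \<open>
  The eigenvalue of mode \<open>n\<close> is \<open>n\<^sup>2\<close> times the first one, so factoring out the ground state leaves a
  decay with exponent proportional to \<open>n\<^sup>2 - 1\<close>.
\<close>

lemma exp_mode_split:
  "exp (- (real n * pi / L)\<^sup>2 / 2 * t) =
   exp (- decay_rate L * t) * exp (- ((real n)\<^sup>2 - 1) * decay_rate L * t)"
  unfolding decay_rate_def exp_add[symmetric]
  by (rule arg_cong[where f=exp]) (simp add: power_mult_distrib power_divide algebra_simps add_divide_distrib diff_divide_distrib)

text \<open>
  From \<open>\<bar>sin (n * \<theta>)\<bar> \<le> n * \<bar>sin \<theta>\<bar>\<close> every mode is controlled by the product of ground states in both
  space variables, at the price of a factor \<open>n\<^sup>2\<close> that the exponential absorbs. In particular the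
  bound keeps the vanishing at the boundary.
\<close>

lemma kernel_mode_le:
  assumes L: "L > 0" and x: "x \<in> {0..L}" and y: "y \<in> {0..L}"
  shows "\<bar>kernel_mode L t x y n\<bar> \<le> 2 / L * ground_state L x * ground_state L y *
           exp (- decay_rate L * t) * ((real n)\<^sup>2 * exp (- ((real n)\<^sup>2 - 1) * decay_rate L * t))"
proof -
  have *: "\<bar>sin (real n * pi * z / L)\<bar> \<le> real n * ground_state L z" if "z \<in> {0..L}" for z
    using abs_sin_mult_le[of n "pi * z / L"] ground_state_nonneg[OF L that]
    by (simp add: ground_state_def mult.assoc)
  have "\<bar>sin (real n * pi * x / L)\<bar> * \<bar>sin (real n * pi * y / L)\<bar>
        \<le> (real n * ground_state L x) * (real n * ground_state L y)"
    using * x y ground_state_nonneg[OF L] by (intro mult_mono) auto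
  then have "2 / L * (\<bar>sin (real n * pi * x / L)\<bar> * \<bar>sin (real n * pi * y / L)\<bar>) *
       exp (- (real n * pi / L)\<^sup>2 / 2 * t)
     \<le> 2 / L * ((real n * ground_state L x) * (real n * ground_state L y)) *
       exp (- (real n * pi / L)\<^sup>2 / 2 * t)"
    using L by (intro mult_right_mono mult_left_mono) auto
  also have "\<dots> = 2 / L * ground_state L x * ground_state L y *
           exp (- decay_rate L * t) * ((real n)\<^sup>2 * exp (- ((real n)\<^sup>2 - 1) * decay_rate L * t))"
    unfolding exp_mode_split by (simp add: power2_eq_square)
  finally show ?thesis
    using L by (simp add: kernel_mode_def abs_mult mult.assoc)
qed

lemma summable_mode_bound:
  assumes "L > 0" "\<delta> > 0"
  shows "summable (\<lambda>n. (real (Suc n))\<^sup>2 * exp (- ((real (Suc n))\<^sup>2 - 1) * decay_rate L * \<delta>))"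
proof -
  define c where "c = decay_rate L * \<delta>"
  have "c > 0" using assms decay_rate_pos by (simp add: c_def)
  then have "(\<lambda>n. (real (Suc n))\<^sup>2 * exp (- ((real (Suc n))\<^sup>2 - 1) * c)) \<in> O(\<lambda>n. 1 / real n ^ 2)"
    by real_asymp
  moreover have "summable (\<lambda>n. norm (1 / real n ^ 2))"
    using inverse_power_summable[of 2] by (simp add: divide_inverse)
  ultimately have "summable (\<lambda>n. (real (Suc n))\<^sup>2 * exp (- ((real (Suc n))\<^sup>2 - 1) * c))"
    by (rule summable_comparison_test_bigo[rotated])
  then show ?thesis by (simp add: c_def mult.assoc)
qed

lemma summable_kernel_mode:
  assumes "L > 0" "t > 0" "x \<in> {0..L}" "y \<in> {0..L}"
  shows "summable (\<lambda>k. kernel_mode L t x y (Suc k))"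
proof (rule summable_comparison_test')
  show "summable (\<lambda>n. 2 / L * ground_state L x * ground_state L y * exp (- decay_rate L * t) *
     ((real (Suc n))\<^sup>2 * exp (- ((real (Suc n))\<^sup>2 - 1) * decay_rate L * t)))"
    by (intro summable_mult summable_mode_bound assms)
  show "norm (kernel_mode L t x y (Suc n)) \<le> 2 / L * ground_state L x * ground_state L y *
     exp (- decay_rate L * t) *
     ((real (Suc n))\<^sup>2 * exp (- ((real (Suc n))\<^sup>2 - 1) * decay_rate L * t))" for n
    unfolding real_norm_def by (rule kernel_mode_le[OF assms(1,3,4)])
qed

text \<open>
  All modes beyond the first decay at least four times as fast in time. Relative to the ground state
  mode their sum is therefore of order \<open>exp (- 3 * decay_rate L * t)\<close>, uniformly in space and for times
  bounded away from zero.
\<close>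

lemma heat_kernel_near_ground_mode:
  assumes L: "L > 0" and \<delta>: "\<delta> > 0"
  shows "\<exists>R\<ge>0. \<forall>t\<ge>\<delta>. \<forall>x\<in>{0..L}. \<forall>y\<in>{0..L}.
     \<bar>dirichlet_heat_kernel L t x y - 2 / L * ground_state L x * ground_state L y * exp (- decay_rate L * t)\<bar>
     \<le> R * exp (- 3 * decay_rate L * t) * (ground_state L x * ground_state L y * exp (- decay_rate L * t))"
proof -
  let ?\<mu> = "decay_rate L"
  define b where "b n = (real (Suc n))\<^sup>2 * exp (- ((real (Suc n))\<^sup>2 - 1) * ?\<mu> * \<delta>)" for n
  have "summable b"
    using summable_mode_bound[OF L \<delta>] unfolding b_def[abs_def] .
  then have b: "summable (\<lambda>k. b (Suc k))"
    by (rule summable_Suc_iff[of b, THEN iffD2])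
  have b0: "b n \<ge> 0" for n by (simp add: b_def)
  define R where "R = 2 / L * exp (3 * ?\<mu> * \<delta>) * (\<Sum>k. b (Suc k))"
  have R0: "R \<ge> 0" unfolding R_def using L b0 by (intro mult_nonneg_nonneg suminf_nonneg b) auto
  show ?thesis
  proof (intro exI[of _ R] conjI R0 allI impI ballI)
    fix t x y assume t: "\<delta> \<le> t" and x: "x \<in> {0..L}" and y: "y \<in> {0..L}"
    let ?s = "ground_state L x * ground_state L y * exp (- ?\<mu> * t)"
    have s0: "?s \<ge> 0" using ground_state_nonneg[OF L] x y by simp
    have "t > 0" using t \<delta> by simp
    note sm = summable_kernel_mode[OF L this x y]
    have tail: "dirichlet_heat_kernel L t x y - 2 / L * ground_state L x * ground_state L y * exp (- ?\<mu> * t)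
          = (\<Sum>k. kernel_mode L t x y (Suc (Suc k)))"
      using suminf_split_head[OF sm]
      by (simp add: dirichlet_heat_kernel_eq_suminf kernel_mode_def ground_state_def decay_rate_def)
    have le: "norm (kernel_mode L t x y (Suc (Suc k)))
       \<le> 2 / L * ?s * (exp (- 3 * ?\<mu> * (t - \<delta>)) * b (Suc k))" for k
    proof -
      let ?n = "real (Suc (Suc k))"
      have n2: "?n\<^sup>2 - 1 \<ge> 3" by (simp add: power2_eq_square algebra_simps)
      have "3 * (?\<mu> * (t - \<delta>)) \<le> (?n\<^sup>2 - 1) * (?\<mu> * (t - \<delta>))"
        using n2 t decay_rate_pos[OF L] by (intro mult_right_mono) auto
      then have "exp (- (?n\<^sup>2 - 1) * ?\<mu> * t) \<le> exp (- 3 * ?\<mu> * (t - \<delta>)) * exp (- (?n\<^sup>2 - 1) * ?\<mu> * \<delta>)"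
        unfolding exp_add[symmetric] by (simp only: exp_le_cancel_iff) (simp add: algebra_simps)
      then have "?n\<^sup>2 * exp (- (?n\<^sup>2 - 1) * ?\<mu> * t) \<le> exp (- 3 * ?\<mu> * (t - \<delta>)) * b (Suc k)"
        unfolding b_def by (metis mult.left_commute mult_left_mono zero_le_power2)
      then have "2 / L * ?s * (?n\<^sup>2 * exp (- (?n\<^sup>2 - 1) * ?\<mu> * t))
          \<le> 2 / L * ?s * (exp (- 3 * ?\<mu> * (t - \<delta>)) * b (Suc k))"
        using s0 L by (intro mult_left_mono) auto
      with kernel_mode_le[OF L x y, of t "Suc (Suc k)"] show ?thesis
        by (simp only: mult.assoc real_norm_def)
    qed
    have sb: "summable (\<lambda>k. 2 / L * ?s * (exp (- 3 * ?\<mu> * (t - \<delta>)) * b (Suc k)))"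
      by (intro summable_mult b)
    have "\<bar>\<Sum>k. kernel_mode L t x y (Suc (Suc k))\<bar>
        \<le> (\<Sum>k. 2 / L * ?s * (exp (- 3 * ?\<mu> * (t - \<delta>)) * b (Suc k)))"
      using norm_suminf_le[OF le sb] by (simp only: real_norm_def)
    also have "\<dots> = 2 / L * ?s * (exp (- 3 * ?\<mu> * (t - \<delta>)) * (\<Sum>k. b (Suc k)))"
      by (simp only: suminf_mult[OF b] suminf_mult[OF summable_mult[OF b]])
    also have "exp (- 3 * ?\<mu> * (t - \<delta>)) = exp (- 3 * ?\<mu> * t) * exp (3 * ?\<mu> * \<delta>)"
      unfolding exp_add[symmetric] by (simp add: algebra_simps)
    finally show "\<bar>dirichlet_heat_kernel L t x y - 2 / L * ground_state L x * ground_state L y * exp (- ?\<mu> * t)\<bar>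
     \<le> R * exp (- 3 * ?\<mu> * t) * ?s"
      unfolding tail R_def by (simp only: mult_ac)
  qed
qed

lemma heat_kernel_upper:
  assumes L: "L > 0" and \<delta>: "\<delta> > 0"
  shows "\<exists>C>0. \<forall>t\<ge>\<delta>. \<forall>x\<in>{0..L}. \<forall>y\<in>{0..L}. \<bar>dirichlet_heat_kernel L t x y\<bar>
     \<le> C * (ground_state L x * ground_state L y * exp (- decay_rate L * t))"
proof -
  obtain R where R: "R \<ge> 0" "\<And>t x y. t \<ge> \<delta> \<Longrightarrow> x \<in> {0..L} \<Longrightarrow> y \<in> {0..L} \<Longrightarrow>
     \<bar>dirichlet_heat_kernel L t x y - 2 / L * ground_state L x * ground_state L y * exp (- decay_rate L * t)\<bar>
     \<le> R * exp (- 3 * decay_rate L * t) * (ground_state L x * ground_state L y * exp (- decay_rate L * t))"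
    using heat_kernel_near_ground_mode[OF assms] by blast
  show ?thesis
  proof (intro exI[of _ "R + 2 / L"] conjI allI impI ballI)
    show "R + 2 / L > 0" using R L by (simp add: add_nonneg_pos)
    fix t x y assume t: "\<delta> \<le> t" and x: "x \<in> {0..L}" and y: "y \<in> {0..L}"
    define S where "S = ground_state L x * ground_state L y * exp (- decay_rate L * t)"
    have s0: "S \<ge> 0" using ground_state_nonneg[OF L] x y by (simp add: S_def)
    have "exp (- 3 * decay_rate L * t) \<le> 1" using t \<delta> decay_rate_pos[OF L] by simp
    then have "R * exp (- 3 * decay_rate L * t) * S \<le> R * 1 * S"
      using s0 R(1) by (intro mult_right_mono mult_left_mono) auto
    moreover have "\<bar>2 / L * S\<bar> = 2 / L * S" using s0 L by (intro abs_of_nonneg) simp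
    ultimately show "\<bar>dirichlet_heat_kernel L t x y\<bar> \<le> (R + 2 / L) * (ground_state L x * ground_state L y * exp (- decay_rate L * t))"
      using R(2)[OF t x y] unfolding mult.assoc[symmetric] S_def by argo
  qed
qed

text \<open>
  Once the relative error of the first mode is at most one half, the kernel is at least half of that
  mode. In particular the kernel is positive in the interior at large times.
\<close>

lemma heat_kernel_lower:
  assumes L: "L > 0"
  shows "\<exists>T0>0. \<forall>t\<ge>T0. \<forall>x\<in>{0..L}. \<forall>y\<in>{0..L}.
     1 / L * (ground_state L x * ground_state L y * exp (- decay_rate L * t)) \<le> dirichlet_heat_kernel L t x y"
proof -
  obtain R where R: "R \<ge> 0" "\<And>t x y. t \<ge> 1 \<Longrightarrow> x \<in> {0..L} \<Longrightarrow> y \<in> {0..L} \<Longrightarrow>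
     \<bar>dirichlet_heat_kernel L t x y - 2 / L * ground_state L x * ground_state L y * exp (- decay_rate L * t)\<bar>
     \<le> R * exp (- 3 * decay_rate L * t) * (ground_state L x * ground_state L y * exp (- decay_rate L * t))"
    using heat_kernel_near_ground_mode[OF L zero_less_one] by blast
  have "((\<lambda>t. R * exp (- 3 * decay_rate L * t)) \<longlongrightarrow> 0) at_top"
    using decay_rate_pos[OF L] by real_asymp
  then have "\<forall>\<^sub>F t in at_top. R * exp (- 3 * decay_rate L * t) < 1 / L"
    using L by (intro order_tendstoD) auto
  then obtain T where T: "\<And>t. t \<ge> T \<Longrightarrow> R * exp (- 3 * decay_rate L * t) < 1 / L"
    by (auto simp: eventually_at_top_linorder)
  show ?thesis
  proof (intro exI[of _ "max T 1"] conjI allI impI ballI)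
    fix t x y assume t: "max T 1 \<le> t" and x: "x \<in> {0..L}" and y: "y \<in> {0..L}"
    let ?s = "ground_state L x * ground_state L y * exp (- decay_rate L * t)"
    have s0: "?s \<ge> 0" using ground_state_nonneg[OF L] x y by simp
    have "R * exp (- 3 * decay_rate L * t) * ?s \<le> 1 / L * ?s"
      using s0 T[of t] t by (intro mult_right_mono) auto
    with R(2)[of t x y] t x y show "1 / L * ?s \<le> dirichlet_heat_kernel L t x y"
      by (simp add: abs_le_iff algebra_simps)
  qed auto
qed

text \<open>
  A Harnack inequality for the explicit kernel. The waiting time \<open>T0\<close> does not depend on \<open>\<delta>\<close>: the upper
  bound by the ground state mode holds for all times \<open>t \<ge> \<delta>\<close>, while the lower bound is only available
  at large times and is used at \<open>t + T0\<close>.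
\<close>

lemma heat_kernel_comparison:
  assumes L: "L > 0"
  shows "\<exists>T0>0. \<forall>\<delta>>0. \<exists>K>0. \<forall>t\<ge>\<delta>. \<forall>x\<in>{0..L}. \<forall>y\<in>{0..L}.
     \<bar>dirichlet_heat_kernel L t x y\<bar> \<le> K * dirichlet_heat_kernel L (t + T0) (L / 2) y"
proof -
  obtain T0 where T0: "T0 > 0" "\<And>t x y. t \<ge> T0 \<Longrightarrow> x \<in> {0..L} \<Longrightarrow> y \<in> {0..L} \<Longrightarrow>
     1 / L * (ground_state L x * ground_state L y * exp (- decay_rate L * t)) \<le> dirichlet_heat_kernel L t x y"
    using heat_kernel_lower[OF L] by blast
  show ?thesis
  proof (rule exI[of _ T0], intro conjI allI impI T0(1))
    fix \<delta> :: real assume \<delta>: "\<delta> > 0"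
    obtain C where C: "C > 0" "\<And>t x y. t \<ge> \<delta> \<Longrightarrow> x \<in> {0..L} \<Longrightarrow> y \<in> {0..L} \<Longrightarrow> \<bar>dirichlet_heat_kernel L t x y\<bar>
       \<le> C * (ground_state L x * ground_state L y * exp (- decay_rate L * t))"
      using heat_kernel_upper[OF L \<delta>] by blast
    define K where "K = C * exp (decay_rate L * T0) * L"
    show "\<exists>K>0. \<forall>t\<ge>\<delta>. \<forall>x\<in>{0..L}. \<forall>y\<in>{0..L}.
     \<bar>dirichlet_heat_kernel L t x y\<bar> \<le> K * dirichlet_heat_kernel L (t + T0) (L / 2) y"
    proof (intro exI[of _ K] conjI allI impI ballI)
      show "K > 0" using C L by (simp add: K_def)
      fix t x y assume t: "\<delta> \<le> t" and x: "x \<in> {0..L}" and y: "y \<in> {0..L}"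
      have "\<bar>dirichlet_heat_kernel L t x y\<bar> \<le> C * (ground_state L x * ground_state L y * exp (- decay_rate L * t))"
        by (rule C) fact+
      also have "\<dots> \<le> C * (1 * ground_state L y * exp (- decay_rate L * t))"
        using C ground_state_le_1 ground_state_nonneg[OF L y] by (intro mult_left_mono mult_right_mono) auto
      also have "\<dots> = K * (1 / L * (ground_state L (L / 2) * ground_state L y * exp (- decay_rate L * (t + T0))))"
      proof -
        have "exp (- decay_rate L * (t + T0)) * exp (decay_rate L * T0) = exp (- decay_rate L * t)"
          unfolding exp_add[symmetric] by (simp add: algebra_simps)
        then show ?thesis using L by (simp add: K_def ground_state_mid mult_ac)
      qed
      also have "\<dots> \<le> K * dirichlet_heat_kernel L (t + T0) (L / 2) y"
        using T0(2)[of "t + T0" "L / 2" y] t \<delta> y L \<open>K > 0\<close> by (intro mult_left_mono) auto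
      finally show "\<bar>dirichlet_heat_kernel L t x y\<bar> \<le> K * dirichlet_heat_kernel L (t + T0) (L / 2) y" .
    qed
  qed
qed

lemma dirichlet_heat_kernel_measurable [measurable]:
  assumes [measurable]: "f \<in> borel_measurable N" "g \<in> borel_measurable N" "h \<in> borel_measurable N"
  shows "(\<lambda>w. dirichlet_heat_kernel L (f w) (g w) (h w)) \<in> borel_measurable N"
proof -
  have sin [measurable]: "sin \<in> borel_measurable (borel :: real measure)"
    by (intro borel_measurable_continuous_onI continuous_intros)
  show ?thesis
    unfolding dirichlet_heat_kernel_eq_suminf kernel_mode_def
    by (intro borel_measurable_suminf) measurable
qed

section \<open>The kernel has small mass in square mean near time zero\<close>

lemma integral_cos_frequency:
  fixes j :: int
  assumes L: "L > 0"
  shows "has_bochner_integral lborel (\<lambda>y. cos (of_int j * pi * y / L) * indicator {0..L} y) (if j = 0 then L else 0)"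
proof (cases "j = 0")
  case True
  have "has_bochner_integral lborel (\<lambda>y. 1 * indicator {0..L} y) (L - 0 :: real)"
    by (rule has_bochner_integral_FTC_Icc_real) (use L in \<open>auto intro!: derivative_eq_intros\<close>)
  then show ?thesis using True by simp
next
  case False
  let ?c = "of_int j * pi / L"
  have c: "?c \<noteq> 0" using False L by simp
  have "has_bochner_integral lborel (\<lambda>y. cos (?c * y) * indicator {0..L} y) (sin (?c * L) / ?c - sin (?c * 0) / ?c)"
  proof (rule has_bochner_integral_FTC_Icc_real)
    show "DERIV (\<lambda>y. sin (?c * y) / ?c) y :> cos (?c * y)" for y
      using c by (auto intro!: derivative_eq_intros)
  qed (use L in auto)
  moreover have "sin (?c * L) = 0"
  proof -
    have "?c * L = of_int j * pi" using L by simp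
    then show ?thesis using sin_zero_iff_int2 by blast
  qed
  ultimately show ?thesis using False by simp
qed

lemma sine_orthogonality:
  fixes m n :: nat
  assumes L: "L > 0" and m: "m \<ge> 1" and n: "n \<ge> 1"
  shows "has_bochner_integral lborel
     (\<lambda>y. (sin (real m * pi * y / L) * sin (real n * pi * y / L)) * indicator {0..L} y)
     (if m = n then L / 2 else 0)"
proof -
  have "has_bochner_integral lborel
      (\<lambda>y. 1 / 2 * (cos (of_int (int m - int n) * pi * y / L) * indicator {0..L} y
                 - cos (of_int (int m + int n) * pi * y / L) * indicator {0..L} y))
      (1 / 2 * ((if int m - int n = 0 then L else 0) - (if int m + int n = 0 then L else 0)))"
    by (intro has_bochner_integral_mult_right has_bochner_integral_diff integral_cos_frequency L)
  moreover have "1 / 2 * (cos (of_int (int m - int n) * pi * y / L) * indicator {0..L} y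
                 - cos (of_int (int m + int n) * pi * y / L) * indicator {0..L} y) =
      (sin (real m * pi * y / L) * sin (real n * pi * y / L)) * (indicator {0..L} y :: real)" for y
    unfolding sin_times_sin
    by (simp add: algebra_simps diff_divide_distrib add_divide_distrib)
  ultimately show ?thesis using m by (simp split: if_splits)
qed

lemma integral_sine_polynomial_square:
  assumes L: "L > 0"
  shows "(\<integral>\<^sup>+y\<in>{0..L}. ennreal ((\<Sum>k<N. b k * sin (real (Suc k) * pi * y / L))\<^sup>2) \<partial>lborel) =
    ennreal (L / 2 * (\<Sum>k<N. (b k)\<^sup>2))"
proof -
  let ?s = "\<lambda>k y. sin (real (Suc k) * pi * y / L)"
  have "has_bochner_integral lborel
     (\<lambda>y. \<Sum>k<N. \<Sum>l<N. (b k * b l) * ((?s k y * ?s l y) * indicator {0..L} y))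
     (\<Sum>k<N. \<Sum>l<N. (b k * b l) * (if Suc k = Suc l then L / 2 else 0))"
    by (intro has_bochner_integral_sum has_bochner_integral_mult_right sine_orthogonality L) auto
  moreover have "(\<Sum>k<N. \<Sum>l<N. (b k * b l) * ((?s k y * ?s l y) * indicator {0..L} y)) =
      (\<Sum>k<N. b k * ?s k y)\<^sup>2 * indicator {0..L} y" for y
    unfolding power2_eq_square sum_product
    unfolding sum_distrib_right
    by (intro sum.cong refl) (simp only: mult_ac)
  moreover have "(\<Sum>k<N. \<Sum>l<N. (b k * b l) * (if Suc k = Suc l then L / 2 else 0)) = L / 2 * (\<Sum>k<N. (b k)\<^sup>2)"
    by (simp add: sum.delta power2_eq_square sum_distrib_left mult_ac if_distrib[of "\<lambda>x. _ * x"] cong: if_cong)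
  ultimately have hb: "has_bochner_integral lborel (\<lambda>y. (\<Sum>k<N. b k * ?s k y)\<^sup>2 * indicator {0..L} y) (L / 2 * (\<Sum>k<N. (b k)\<^sup>2))"
    by (simp only:)
  have "(\<integral>\<^sup>+y\<in>{0..L}. ennreal ((\<Sum>k<N. b k * ?s k y)\<^sup>2) \<partial>lborel) =
      (\<integral>\<^sup>+y. ennreal ((\<Sum>k<N. b k * ?s k y)\<^sup>2 * indicator {0..L} y) \<partial>lborel)"
    by (intro nn_integral_cong) (simp add: indicator_def)
  also have "\<dots> = ennreal (\<integral>y. (\<Sum>k<N. b k * ?s k y)\<^sup>2 * indicator {0..L} y \<partial>lborel)"
    using integrable.intros[OF hb] by (intro nn_integral_eq_integral) auto
  finally show ?thesis
    unfolding has_bochner_integral_integral_eq[OF hb] .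
qed

lemma nn_integral_exp_decay:
  assumes c: "c > 0"
  shows "(\<integral>\<^sup>+t\<in>{0..}. ennreal (exp (- c * t)) \<partial>lborel) = ennreal (1 / c)"
proof -
  have "(\<integral>\<^sup>+t. ennreal (exp (- c * t)) * indicator {0..} t \<partial>lborel) = ennreal (0 - (- exp (- c * 0) / c))"
  proof (rule nn_integral_FTC_atLeast)
    show "((\<lambda>t. - exp (- c * t) / c) \<longlongrightarrow> 0) at_top" using c by real_asymp
  qed (use c in \<open>auto intro!: derivative_eq_intros\<close>)
  then show ?thesis by simp
qed

text \<open>
  The series is the trace of the resolvent at \<open>\<beta>\<close> of the Dirichlet Laplacian. Its terms vanish as
  \<open>\<beta>\<close> tends to infinity and are dominated by the summable inverse eigenvalues, so Tannery's theorem
  applies.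
\<close>

lemma resolvent_trace_tendsto_0:
  assumes L: "L > 0"
  shows "((\<lambda>\<beta>. \<Sum>k. 1 / (\<beta> + (real (Suc k) * pi / L)\<^sup>2)) \<longlongrightarrow> 0) at_top"
    and "\<beta> \<ge> 0 \<Longrightarrow> summable (\<lambda>k. 1 / (\<beta> + (real (Suc k) * pi / L)\<^sup>2))"
proof -
  define m where "m k = 1 / (real (Suc k) * pi / L)\<^sup>2" for k
  have m: "summable m"
  proof -
    have "summable (\<lambda>k. (L / pi)\<^sup>2 * inverse (real (Suc k) ^ 2))"
      by (intro summable_mult summable_Suc_iff[THEN iffD2, OF inverse_power_summable]) simp
    moreover have "m = (\<lambda>k. (L / pi)\<^sup>2 * inverse (real (Suc k) ^ 2))"
      by (rule ext) (simp add: m_def power_divide power_mult_distrib divide_inverse power_inverse del: of_nat_Suc)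
    ultimately show ?thesis by simp
  qed
  have le: "norm (1 / (\<beta> + (real (Suc k) * pi / L)\<^sup>2)) \<le> m k" if "\<beta> \<ge> 0" for \<beta> k
  proof -
    have "norm (1 / (\<beta> + r)) \<le> 1 / r" if "r > 0" for r
      using that \<open>\<beta> \<ge> 0\<close> by (simp add: frac_le)
    moreover have "(real (Suc k) * pi / L)\<^sup>2 > 0" using L by simp
    ultimately show ?thesis unfolding m_def by blast
  qed
  show "summable (\<lambda>k. 1 / (\<beta> + (real (Suc k) * pi / L)\<^sup>2))" if "\<beta> \<ge> 0"
    by (rule summable_comparison_test'[OF m le]) (use that in auto)
  have "((\<lambda>\<beta>. \<Sum>k. 1 / (\<beta> + (real (Suc k) * pi / L)\<^sup>2)) \<longlongrightarrow> (\<Sum>k::nat. 0 :: real)) at_top"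
  proof (rule tannerys_theorem[THEN conjunct2, THEN conjunct2, OF _ _ m])
    show "((\<lambda>\<beta>. 1 / (\<beta> + (real (Suc k) * pi / L)\<^sup>2)) \<longlongrightarrow> 0) at_top" for k
      by real_asymp
    have "\<forall>\<^sub>F \<beta> in at_top. (\<beta>::real) \<ge> 0" by (rule eventually_ge_at_top)
    then have "\<forall>\<^sub>F p in sequentially \<times>\<^sub>F at_top. snd p \<ge> (0 :: real)"
      by (intro eventually_prod_filter[THEN iffD2] exI[of _ "\<lambda>_. True"] exI[of _ "\<lambda>b. b \<ge> 0"]) auto
    then show "\<forall>\<^sub>F (k, \<beta>) in sequentially \<times>\<^sub>F at_top. norm (1 / (\<beta> + (real (Suc k) * pi / L)\<^sup>2)) \<le> m k"
      by (rule eventually_mono) (use le in auto)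
  qed auto
  then show "((\<lambda>\<beta>. \<Sum>k. 1 / (\<beta> + (real (Suc k) * pi / L)\<^sup>2)) \<longlongrightarrow> 0) at_top" by simp
qed

text \<open>
  Formally this is Parseval's identity in \<open>y\<close> followed by the Laplace transform in time, mode by mode.
  Parseval is applied to the partial sums, which are sine polynomials, and Fatou's lemma passes to
  the limit, which leaves an inequality.
\<close>

lemma heat_kernel_laplace_bound:
  assumes L: "L > 0" and x: "x \<in> {0..L}" and \<beta>: "\<beta> \<ge> 0"
  shows "(\<integral>\<^sup>+z\<in>{0<..}\<times>{0<..<L}. ennreal (exp (- \<beta> * fst z) * (dirichlet_heat_kernel L (fst z) x (snd z))\<^sup>2) \<partial>lborel)
     \<le> ennreal (2 / L * (\<Sum>k. 1 / (\<beta> + (real (Suc k) * pi / L)\<^sup>2)))"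
proof -
  let ?D = "{0<..}\<times>{0<..<L} :: (real \<times> real) set"
  let ?r = "\<lambda>k. (real (Suc k) * pi / L)\<^sup>2"
  define S where "S N \<tau> y = (\<Sum>k<N. kernel_mode L \<tau> x y (Suc k))" for N \<tau> y
  have D [measurable]: "?D \<in> sets borel" by (intro borel_open open_Times) auto
  define f where "f N z = ennreal (exp (- \<beta> * fst z) * (S N (fst z) (snd z))\<^sup>2) * indicator ?D z" for N z
  have f_meas [measurable]: "f N \<in> borel_measurable lborel" for N
  proof -
    have "(\<lambda>z. exp (- \<beta> * fst z) * (S N (fst z) (snd z))\<^sup>2) \<in> borel_measurable borel"
      unfolding S_def kernel_mode_def
      by (intro borel_measurable_continuous_onI continuous_intros) (use L in auto)
    from measurable_compose[OF this measurable_ennreal] show ?thesis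
      unfolding f_def using D by (intro borel_measurable_times_ennreal) auto
  qed
  have lim: "ennreal (exp (- \<beta> * fst z) * (dirichlet_heat_kernel L (fst z) x (snd z))\<^sup>2) * indicator ?D z
      = liminf (\<lambda>N. f N z)" for z
  proof (cases "z \<in> ?D")
    case True
    have "(\<lambda>N. S N (fst z) (snd z)) \<longlonglongrightarrow> dirichlet_heat_kernel L (fst z) x (snd z)"
      unfolding S_def dirichlet_heat_kernel_eq_suminf
      by (intro summable_LIMSEQ summable_kernel_mode) (use True L x in auto)
    then have lim: "(\<lambda>N. ennreal (exp (- \<beta> * fst z) * (S N (fst z) (snd z))\<^sup>2)) \<longlonglongrightarrow>
       ennreal (exp (- \<beta> * fst z) * (dirichlet_heat_kernel L (fst z) x (snd z))\<^sup>2)"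
      by (intro tendsto_ennrealI tendsto_intros)
    show ?thesis
      using True lim_imp_Liminf[OF trivial_limit_sequentially lim] by (simp add: f_def)
  next
    case False
    then show ?thesis by (simp add: f_def Liminf_const)
  qed
  \<comment> \<open>Parseval for the sine polynomial in \<open>y\<close>; the squares of the sines in \<open>x\<close> are at most \<open>1\<close>.\<close>
  have inner: "(\<integral>\<^sup>+y. f N (\<tau>, y) \<partial>lborel) \<le>
      (\<Sum>k<N. ennreal (2 / L * exp (- (\<beta> + ?r k) * \<tau>))) * indicator {0..} \<tau>" for N \<tau>
  proof (cases "\<tau> > 0")
    case True
    define b where "b k = 2 / L * sin (real (Suc k) * pi * x / L) * exp (- ?r k / 2 * \<tau>)" for k
    have S: "S N \<tau> y = (\<Sum>k<N. b k * sin (real (Suc k) * pi * y / L))" for y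
      unfolding S_def kernel_mode_def b_def by (intro sum.cong) (auto simp: mult_ac)
    have m [measurable]: "(\<lambda>y. S N \<tau> y) \<in> borel_measurable borel"
      unfolding S_def kernel_mode_def
      by (intro borel_measurable_continuous_onI continuous_intros) (use L in auto)
    have "(\<integral>\<^sup>+y. f N (\<tau>, y) \<partial>lborel) \<le> (\<integral>\<^sup>+y. ennreal (exp (- \<beta> * \<tau>)) * (ennreal ((S N \<tau> y)\<^sup>2) * indicator {0..L} y) \<partial>lborel)"
      by (intro nn_integral_mono) (auto simp: f_def indicator_def ennreal_mult)
    also have "\<dots> = ennreal (exp (- \<beta> * \<tau>)) * (\<integral>\<^sup>+y\<in>{0..L}. ennreal ((S N \<tau> y)\<^sup>2) \<partial>lborel)"
      by (rule nn_integral_cmult) measurable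
    also have "\<dots> = ennreal (exp (- \<beta> * \<tau>) * (L / 2 * (\<Sum>k<N. (b k)\<^sup>2)))"
      unfolding S integral_sine_polynomial_square[OF L] using L
      by (intro ennreal_mult[symmetric]) (auto intro!: mult_nonneg_nonneg sum_nonneg)
    also have "\<dots> \<le> ennreal (\<Sum>k<N. 2 / L * exp (- (\<beta> + ?r k) * \<tau>))"
    proof (rule ennreal_leI)
      have "exp (- \<beta> * \<tau>) * (L / 2 * (\<Sum>k<N. (b k)\<^sup>2)) = (\<Sum>k<N. exp (- \<beta> * \<tau>) * (L / 2 * (b k)\<^sup>2))"
        by (simp add: sum_distrib_left)
      also have "\<dots> \<le> (\<Sum>k<N. 2 / L * exp (- (\<beta> + ?r k) * \<tau>))"
      proof (rule sum_mono)
        fix k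
        define E where "E = exp (- ?r k / 2 * \<tau>)"
        define a where "a = sin (real (Suc k) * pi * x / L)"
        define c where "c = exp (- \<beta> * \<tau>)"
        have bk: "b k = 2 / L * a * E" by (simp add: b_def a_def E_def)
        have "c * (L / 2 * (b k)\<^sup>2) = a\<^sup>2 * (2 / L * (c * E\<^sup>2))"
          using L unfolding bk by (simp add: power2_eq_square field_simps)
        also have "\<dots> \<le> 1 * (2 / L * (c * E\<^sup>2))"
          using L by (intro mult_right_mono) (auto simp: abs_square_le_1 a_def c_def)
        also have "c * E\<^sup>2 = exp (- (\<beta> + ?r k) * \<tau>)"
          unfolding c_def E_def power2_eq_square exp_add[symmetric]
          by (rule arg_cong[where f=exp]) argo
        finally show "exp (- \<beta> * \<tau>) * (L / 2 * (b k)\<^sup>2) \<le> 2 / L * exp (- (\<beta> + ?r k) * \<tau>)"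
          unfolding c_def mult_1_left .
      qed
      finally show "exp (- \<beta> * \<tau>) * (L / 2 * (\<Sum>k<N. (b k)\<^sup>2)) \<le> (\<Sum>k<N. 2 / L * exp (- (\<beta> + ?r k) * \<tau>))" .
    qed
    also have "\<dots> = (\<Sum>k<N. ennreal (2 / L * exp (- (\<beta> + ?r k) * \<tau>)))"
      using L by (intro sum_ennreal[symmetric]) auto
    finally show ?thesis using True by simp
  qed (simp add: f_def)
  have fint: "(\<integral>\<^sup>+z. f N z \<partial>lborel) \<le> ennreal (2 / L * (\<Sum>k. 1 / (\<beta> + ?r k)))" for N
  proof -
    have pos: "\<beta> + ?r k > 0" for k using \<beta> L by (simp add: add_nonneg_pos)
    have "(\<integral>\<^sup>+z. f N z \<partial>lborel) = (\<integral>\<^sup>+\<tau>. \<integral>\<^sup>+y. f N (\<tau>, y) \<partial>lborel \<partial>lborel)"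
      using lborel.nn_integral_fst[of "f N" lborel] f_meas[of N] by (simp add: lborel_prod)
    also have "\<dots> \<le> (\<integral>\<^sup>+\<tau>. (\<Sum>k<N. ennreal (2 / L) * (ennreal (exp (- (\<beta> + ?r k) * \<tau>)) * indicator {0..} \<tau>)) \<partial>lborel)"
    proof (rule nn_integral_mono)
      fix \<tau> :: real
      have "(\<Sum>k<N. ennreal (2 / L * exp (- (\<beta> + ?r k) * \<tau>))) * indicator {0..} \<tau> =
         (\<Sum>k<N. ennreal (2 / L) * (ennreal (exp (- (\<beta> + ?r k) * \<tau>)) * indicator {0..} \<tau>))"
        unfolding sum_distrib_right using L
        by (intro sum.cong refl) (simp only: ennreal_mult'[of "2 / L"] mult.assoc zero_le_divide_iff zero_le_numeral less_imp_le simp_thms)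
      then show "(\<integral>\<^sup>+y. f N (\<tau>, y) \<partial>lborel) \<le>
         (\<Sum>k<N. ennreal (2 / L) * (ennreal (exp (- (\<beta> + ?r k) * \<tau>)) * indicator {0..} \<tau>))"
        using inner[of N \<tau>] by (simp only:)
    qed
    also have "\<dots> = (\<Sum>k<N. ennreal (2 / L) * (\<integral>\<^sup>+\<tau>\<in>{0..}. ennreal (exp (- (\<beta> + ?r k) * \<tau>)) \<partial>lborel))"
      by (subst nn_integral_sum) (auto simp: nn_integral_cmult simp del: of_nat_Suc)
    also have "\<dots> = (\<Sum>k<N. ennreal (2 / L * (1 / (\<beta> + ?r k))))"
    proof (intro sum.cong refl)
      fix k
      show "ennreal (2 / L) * (\<integral>\<^sup>+\<tau>\<in>{0..}. ennreal (exp (- (\<beta> + ?r k) * \<tau>)) \<partial>lborel) =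
          ennreal (2 / L * (1 / (\<beta> + ?r k)))"
        unfolding nn_integral_exp_decay[OF pos] using L by (intro ennreal_mult'[symmetric]) simp
    qed
    also have "\<dots> = ennreal (\<Sum>k<N. 2 / L * (1 / (\<beta> + ?r k)))"
      using L less_imp_le[OF pos] by (intro sum_ennreal mult_nonneg_nonneg) simp_all
    also have "\<dots> \<le> ennreal (2 / L * (\<Sum>k. 1 / (\<beta> + ?r k)))"
    proof -
      have "(\<Sum>k<N. 1 / (\<beta> + ?r k)) \<le> (\<Sum>k. 1 / (\<beta> + ?r k))"
        by (rule sum_le_suminf[OF resolvent_trace_tendsto_0(2)[OF L \<beta>]])
          (simp_all only: finite_lessThan zero_le_divide_1_iff less_imp_le[OF pos])
      then show ?thesis
        unfolding sum_distrib_left[symmetric] using L by (intro ennreal_leI mult_left_mono) simp_all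
    qed
    finally show ?thesis .
  qed
  have "(\<integral>\<^sup>+z\<in>?D. ennreal (exp (- \<beta> * fst z) * (dirichlet_heat_kernel L (fst z) x (snd z))\<^sup>2) \<partial>lborel)
      = (\<integral>\<^sup>+z. liminf (\<lambda>N. f N z) \<partial>lborel)"
    unfolding lim ..
  also have "\<dots> \<le> liminf (\<lambda>N. \<integral>\<^sup>+z. f N z \<partial>lborel)"
    by (rule nn_integral_liminf) simp
  also have "\<dots> \<le> ennreal (2 / L * (\<Sum>k. 1 / (\<beta> + ?r k)))"
    by (rule Liminf_le) (use fint in auto)
  finally show ?thesis .
qed

text \<open>
  The form in which the kernel bound enters the renewal equation. The exponential weight serves both
  purposes: it is bounded below on a short time window of length comparable to \<open>1 / \<beta>\<close>, and it is the
  natural weight for an exponential growth estimate.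
\<close>

lemma heat_kernel_laplace_small:
  assumes L: "L > 0" and \<eta>: "\<eta> > 0"
  shows "\<exists>\<beta>>0. \<forall>x\<in>{0..L}. (\<integral>\<^sup>+z\<in>{0<..}\<times>{0<..<L}.
      ennreal (exp (- \<beta> * fst z) * (dirichlet_heat_kernel L (fst z) x (snd z))\<^sup>2) \<partial>lborel) \<le> ennreal \<eta>"
proof -
  have "((\<lambda>\<beta>. 2 / L * (\<Sum>k. 1 / (\<beta> + (real (Suc k) * pi / L)\<^sup>2))) \<longlongrightarrow> 2 / L * 0) at_top"
    by (intro tendsto_mult_left resolvent_trace_tendsto_0 L)
  then have "\<forall>\<^sub>F \<beta> in at_top. 2 / L * (\<Sum>k. 1 / (\<beta> + (real (Suc k) * pi / L)\<^sup>2)) < \<eta>"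
    using \<eta> by (intro order_tendstoD) auto
  then have "\<forall>\<^sub>F \<beta> in at_top. \<beta> > 0 \<and> 2 / L * (\<Sum>k. 1 / (\<beta> + (real (Suc k) * pi / L)\<^sup>2)) < \<eta>"
    using eventually_gt_at_top[of 0] by eventually_elim simp
  then obtain \<beta> where \<beta>: "\<beta> > 0" "2 / L * (\<Sum>k. 1 / (\<beta> + (real (Suc k) * pi / L)\<^sup>2)) < \<eta>"
    using eventually_happens'[OF trivial_limit_at_top_linorder] by blast
  show ?thesis
  proof (intro exI[of _ \<beta>] conjI \<beta>(1) ballI)
    fix x assume x: "x \<in> {0..L}"
    have "(\<integral>\<^sup>+z\<in>{0<..}\<times>{0<..<L}. ennreal (exp (- \<beta> * fst z) * (dirichlet_heat_kernel L (fst z) x (snd z))\<^sup>2) \<partial>lborel)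
       \<le> ennreal (2 / L * (\<Sum>k. 1 / (\<beta> + (real (Suc k) * pi / L)\<^sup>2)))"
      by (rule heat_kernel_laplace_bound[OF L x]) (use \<beta> in simp)
    also have "\<dots> \<le> ennreal \<eta>" using \<beta> by (intro ennreal_leI) simp
    finally show "(\<integral>\<^sup>+z\<in>{0<..}\<times>{0<..<L}. ennreal (exp (- \<beta> * fst z) * (dirichlet_heat_kernel L (fst z) x (snd z))\<^sup>2) \<partial>lborel) \<le> ennreal \<eta>" .
  qed
qed

lemma nn_integral_time_reversal:
  assumes f [measurable]: "f \<in> borel_measurable borel"
  shows "(\<integral>\<^sup>+z\<in>{0<..<t}\<times>{0<..<L}. f (t - fst z, snd z) \<partial>lborel) =
     (\<integral>\<^sup>+z\<in>{0<..<t}\<times>{0<..<L}. f z \<partial>(lborel :: (real \<times> real) measure))"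
proof -
  have [measurable]: "{0<..<t}\<times>{0<..<L} \<in> sets (borel :: (real \<times> real) measure)"
    by (intro borel_open open_Times) auto
  define g where "g z = f z * indicator ({0<..<t}\<times>{0<..<L}) z" for z
  have g: "g \<in> borel_measurable borel" unfolding g_def by measurable
  have g': "g \<in> borel_measurable (lborel \<Otimes>\<^sub>M lborel)" using g by (simp add: lborel_prod)
  have g'': "(\<lambda>z. g (t - fst z, snd z)) \<in> borel_measurable (lborel \<Otimes>\<^sub>M lborel)"
    using measurable_compose[OF _ g, of "\<lambda>z. (t - fst z, snd z)" borel] unfolding lborel_prod
    by (simp add: borel_measurable_continuous_onI continuous_intros)
  have "(\<integral>\<^sup>+z\<in>{0<..<t}\<times>{0<..<L}. f (t - fst z, snd z) \<partial>lborel) = (\<integral>\<^sup>+z. g (t - fst z, snd z) \<partial>lborel)"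
    by (intro nn_integral_cong) (auto simp: g_def indicator_def)
  also have "\<dots> = (\<integral>\<^sup>+s. \<integral>\<^sup>+y. g (t - s, y) \<partial>lborel \<partial>lborel)"
    using lborel.nn_integral_fst[OF g''] by (simp add: lborel_prod)
  also have "\<dots> = (\<integral>\<^sup>+s. \<integral>\<^sup>+y. g (s, y) \<partial>lborel \<partial>lborel)"
  proof -
    have "(\<lambda>s. \<integral>\<^sup>+y. g (s, y) \<partial>lborel) \<in> borel_measurable lborel"
      by (rule lborel.borel_measurable_nn_integral_fst[OF g'])
    then show ?thesis
      by (subst (2) nn_integral_real_affine[where c="-1" and t=t]) auto
  qed
  also have "\<dots> = (\<integral>\<^sup>+z. g z \<partial>lborel)"
    using lborel.nn_integral_fst[OF g'] by (simp add: lborel_prod)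
  finally show ?thesis by (simp add: g_def)
qed

section \<open>Elementary integrals against white noise\<close>

lemma (in prob_space) centered_normal_moments:
  assumes X: "centered_normal M X v" and v: "0 \<le> v"
  shows "integrable M (\<lambda>\<omega>. (X \<omega>)\<^sup>2)" "expectation X = 0" "expectation (\<lambda>\<omega>. (X \<omega>)\<^sup>2) = v"
proof -
  have [measurable]: "X \<in> borel_measurable M"
    using X by (simp add: centered_normal_def)
  have *: "integrable M (\<lambda>\<omega>. (X \<omega>)\<^sup>2) \<and> expectation X = 0 \<and> expectation (\<lambda>\<omega>. (X \<omega>)\<^sup>2) = v"
  proof (cases "v = 0")
    case True
    then have ae: "AE \<omega> in M. X \<omega> = 0"
      using X by (simp add: centered_normal_def)
    have "integrable M (\<lambda>\<omega>. (X \<omega>)\<^sup>2) \<longleftrightarrow> integrable M (\<lambda>\<omega>. 0 :: real)"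
      using ae by (intro integrable_cong_AE) auto
    moreover have "expectation X = expectation (\<lambda>\<omega>. 0)"
      using ae by (intro integral_cong_AE) auto
    moreover have "expectation (\<lambda>\<omega>. (X \<omega>)\<^sup>2) = expectation (\<lambda>\<omega>. 0)"
      using ae by (intro integral_cong_AE) auto
    ultimately show ?thesis using True by simp
  next
    case False
    then have s: "sqrt v > 0" and D: "distributed M lborel X (normal_density 0 (sqrt v))"
      using X v by (simp_all add: centered_normal_def)
    have "integrable lborel (\<lambda>x. normal_density 0 (sqrt v) x * (x - 0) ^ 2)"
      by (rule integrable_normal_moment[OF s])
    then have "integrable M (\<lambda>\<omega>. (X \<omega>)\<^sup>2)"
      using distributed_integrable[OF D, of "\<lambda>x. x\<^sup>2"] by simp
    moreover have E: "expectation X = 0"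
      by (rule normal_distributed_expectation[OF s D])
    moreover have "expectation (\<lambda>\<omega>. (X \<omega>)\<^sup>2) = v"
      using normal_distributed_variance[OF s D] E v by simp
    ultimately show ?thesis by simp
  qed
  then show "integrable M (\<lambda>\<omega>. (X \<omega>)\<^sup>2)" "expectation X = 0" "expectation (\<lambda>\<omega>. (X \<omega>)\<^sup>2) = v"
    by auto
qed

lemma integrable_mult_of_squares:
  fixes f g :: "'a \<Rightarrow> real"
  assumes [measurable]: "f \<in> borel_measurable M" "g \<in> borel_measurable M"
    and "integrable M (\<lambda>x. (f x)\<^sup>2)" "integrable M (\<lambda>x. (g x)\<^sup>2)"
  shows "integrable M (\<lambda>x. f x * g x)"
proof (rule Bochner_Integration.integrable_bound)
  show "integrable M (\<lambda>x. (f x)\<^sup>2 + (g x)\<^sup>2)" using assms by simp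
  have "\<bar>a * b\<bar> \<le> a\<^sup>2 + b\<^sup>2" for a b :: real
    using sum_squares_bound[of a b] sum_squares_bound[of "- a" b] by (auto simp: abs_le_iff)
  then show "AE x in M. norm (f x * g x) \<le> norm ((f x)\<^sup>2 + (g x)\<^sup>2)" by auto
qed simp

lemma (in prob_space) integrable_of_square:
  fixes f :: "'a \<Rightarrow> real"
  assumes "f \<in> borel_measurable M" "integrable M (\<lambda>x. (f x)\<^sup>2)"
  shows "integrable M f"
  using integrable_mult_of_squares[OF assms(1) _ assms(2), of "\<lambda>_. 1"] by simp

lemma integrable_square_bounded_mult:
  fixes f g :: "'a \<Rightarrow> real"
  assumes [measurable]: "f \<in> borel_measurable M" "g \<in> borel_measurable M"
    and f: "bounded (f ` space M)" and g: "integrable M (\<lambda>x. (g x)\<^sup>2)"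
  shows "integrable M (\<lambda>x. (f x * g x)\<^sup>2)"
proof -
  obtain B where B: "\<And>x. x \<in> space M \<Longrightarrow> \<bar>f x\<bar> \<le> B"
    using f by (auto simp: bounded_iff)
  show ?thesis
  proof (rule Bochner_Integration.integrable_bound)
    show "integrable M (\<lambda>x. B\<^sup>2 * (g x)\<^sup>2)" using g by simp
    have "(f x * g x)\<^sup>2 \<le> B\<^sup>2 * (g x)\<^sup>2" if "x \<in> space M" for x
      using power_mono[OF B[OF that], of 2] by (auto simp: power_mult_distrib intro!: mult_right_mono)
    then show "AE x in M. norm ((f x * g x)\<^sup>2) \<le> norm (B\<^sup>2 * (g x)\<^sup>2)" by auto
  qed simp
qed

locale walsh_noise = prob_space M for M :: "'w measure" +
  fixes L :: real and W :: "(real \<times> real) set \<Rightarrow> 'w \<Rightarrow> real" and F :: "real \<Rightarrow> 'w measure"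
  assumes white_noise: "white_noise M L W"
    and noise_filtration: "noise_filtration M L W F"
begin

lemma space_F: "space (F t) = space M"
  using noise_filtration by (auto simp: noise_filtration_def subalgebra_def)

lemma sets_F_subset: "sets (F t) \<subseteq> sets M"
  using noise_filtration by (auto simp: noise_filtration_def subalgebra_def)

lemma measurable_F_mono:
  assumes "s \<le> t" "X \<in> borel_measurable (F s)" shows "X \<in> borel_measurable (F t)"
  using assms noise_filtration space_F filtration.sets_F_mono[of "space M" F s t]
  unfolding noise_filtration_def measurable_def by auto

lemma measurable_F_imp_M: "X \<in> borel_measurable (F t) \<Longrightarrow> X \<in> borel_measurable M"
  using sets_F_subset[of t] space_F[of t] unfolding measurable_def by auto

lemma noise_adapted:
  "0 \<le> t \<Longrightarrow> A \<in> noise_sets {0<..t} L \<Longrightarrow> W A \<in> borel_measurable (F t)"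
  using noise_filtration by (auto simp: noise_filtration_def)

lemma noise_combination:
  assumes "finite \<A>" "\<A> \<subseteq> noise_sets {0<..} L"
  shows "centered_normal M (\<lambda>\<omega>. \<Sum>A\<in>\<A>. c A * W A \<omega>)
     (\<Sum>A\<in>\<A>. \<Sum>B\<in>\<A>. c A * c B * measure lborel (A \<inter> B))"
  using white_noise assms by (auto simp: white_noise_def)

lemma noise_normal:
  assumes A: "A \<in> noise_sets {0<..} L"
  shows "centered_normal M (W A) (measure lborel A)"
  using noise_combination[of "{A}" "\<lambda>_. 1"] A by simp

lemma noise_measurable: "A \<in> noise_sets {0<..} L \<Longrightarrow> W A \<in> borel_measurable M"
  using noise_normal by (simp add: centered_normal_def)

lemma
  assumes A: "A \<in> noise_sets {0<..} L"
  shows noise_square_integrable: "integrable M (\<lambda>\<omega>. (W A \<omega>)\<^sup>2)"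
    and noise_expectation: "expectation (W A) = 0"
    and noise_variance: "expectation (\<lambda>\<omega>. (W A \<omega>)\<^sup>2) = measure lborel A"
  by (rule centered_normal_moments[OF noise_normal[OF A]]; simp)+

text \<open>
  By polarisation, from the variance of \<open>W A + W B\<close>. The case \<open>A = B\<close> is separate because the sum in the
  definition of white noise then has only one term.
\<close>

lemma noise_covariance:
  assumes A: "A \<in> noise_sets {0<..} L" and B: "B \<in> noise_sets {0<..} L"
  shows "expectation (\<lambda>\<omega>. W A \<omega> * W B \<omega>) = measure lborel (A \<inter> B)"
proof (cases "A = B")
  case True
  then show ?thesis using noise_variance[OF A] by (simp add: power2_eq_square)
next
  case False
  have [measurable]: "W A \<in> borel_measurable M" "W B \<in> borel_measurable M"
    using noise_measurable A B by auto
  note iA = noise_square_integrable[OF A] and iB = noise_square_integrable[OF B]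
  have iAB: "integrable M (\<lambda>\<omega>. W A \<omega> * W B \<omega>)"
    by (rule integrable_mult_of_squares[OF _ _ iA iB]) auto
  have "centered_normal M (\<lambda>\<omega>. W A \<omega> + W B \<omega>)
      (measure lborel A + measure lborel B + 2 * measure lborel (A \<inter> B))"
    using noise_combination[of "{A, B}" "\<lambda>_. 1"] A B False by (simp add: Int_commute algebra_simps)
  then have "expectation (\<lambda>\<omega>. (W A \<omega> + W B \<omega>)\<^sup>2) =
      measure lborel A + measure lborel B + 2 * measure lborel (A \<inter> B)"
    by (rule centered_normal_moments) simp
  moreover have "expectation (\<lambda>\<omega>. (W A \<omega> + W B \<omega>)\<^sup>2) =
      measure lborel A + measure lborel B + 2 * expectation (\<lambda>\<omega>. W A \<omega> * W B \<omega>)"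
    using iA iB iAB noise_variance[OF A] noise_variance[OF B] by (simp add: power2_sum mult.assoc)
  ultimately show ?thesis by simp
qed

lemma noise_empty: "AE \<omega> in M. W {} \<omega> = 0"
  using noise_normal[of "{}"] by (simp add: noise_sets_def centered_normal_def)

text \<open>
  The combination \<open>W (A \<union> B) - W A - W B\<close> is centered normal with variance zero. If one of the two sets is
  empty, the three sets are not distinct and the claim reduces to \<open>noise_empty\<close>.
\<close>

lemma noise_Un:
  assumes A: "A \<in> noise_sets {0<..} L" and B: "B \<in> noise_sets {0<..} L" and AB: "A \<inter> B = {}"
  shows "AE \<omega> in M. W (A \<union> B) \<omega> = W A \<omega> + W B \<omega>"
proof -
  consider "A = {}" | "B = {}" | "A \<noteq> {}" "B \<noteq> {}" by blast
  then show ?thesis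
  proof cases
    case 3
    have AB_sets: "A \<in> sets lborel" "B \<in> sets lborel"
      and fin: "emeasure lborel A < \<infinity>" "emeasure lborel B < \<infinity>"
      using A B by (auto simp: noise_sets_def)
    have fU: "emeasure lborel (A \<union> B) < \<infinity>"
      using fin emeasure_subadditive[OF AB_sets] by (auto simp: less_top[symmetric] top_unique)
    have U: "A \<union> B \<in> noise_sets {0<..} L"
      using A B fU by (auto simp: noise_sets_def)
    have mU: "measure lborel (A \<union> B) = measure lborel A + measure lborel B"
      using fin AB AB_sets by (intro measure_Union) auto
    have ne: "A \<noteq> B" "A \<union> B \<noteq> A" "A \<union> B \<noteq> B" using 3 AB by auto
    define c where "c S = (if S = A \<union> B then 1 else - 1 :: real)" for S
    have c: "c (A \<union> B) = 1" "c A = - 1" "c B = - 1" using ne by (auto simp: c_def)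
    have i: "(A \<union> B) \<inter> A = A" "(A \<union> B) \<inter> B = B" "A \<inter> (A \<union> B) = A" "B \<inter> (A \<union> B) = B" "B \<inter> A = {}"
      using AB by auto
    have "centered_normal M (\<lambda>\<omega>. W (A \<union> B) \<omega> + (- W A \<omega> - W B \<omega>)) 0"
      using noise_combination[of "{A \<union> B, A, B}" c] A B U ne ne[symmetric] AB
      by (simp add: c i mU)
    then have "AE \<omega> in M. W (A \<union> B) \<omega> + (- W A \<omega> - W B \<omega>) = 0"
      by (simp add: centered_normal_def)
    then show ?thesis by eventually_elim simp
  qed (use noise_empty in auto)
qed

text \<open>
  The \<open>\<sigma>\<close>-algebra generated by the noise after time \<open>t\<close>, as a measure space so that measurability of
  functions of the future noise can be expressed.
\<close>

definition future :: "real \<Rightarrow> 'w measure" where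
  "future t = sigma (space M) {W A -` B \<inter> space M | A B. A \<in> noise_sets {t<..} L \<and> B \<in> sets borel}"

lemma space_future: "space (future t) = space M"
  unfolding future_def by (rule space_measure_of) auto

lemma sets_future: "sets (future t) =
   sigma_sets (space M) {W A -` B \<inter> space M | A B. A \<in> noise_sets {t<..} L \<and> B \<in> sets borel}"
  unfolding future_def by (rule sets_measure_of) auto

lemma noise_measurable_future:
  assumes A: "A \<in> noise_sets {t<..} L"
  shows "W A \<in> borel_measurable (future t)"
  by (rule measurableI) (use A in \<open>auto simp: space_future sets_future\<close>)

lemma
  fixes X Y :: "'w \<Rightarrow> real"
  assumes t: "0 \<le> t" and X: "X \<in> borel_measurable (F t)" "integrable M X"
    and Y: "Y \<in> borel_measurable (future t)" "integrable M Y"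
  shows past_future_expectation: "expectation (\<lambda>\<omega>. X \<omega> * Y \<omega>) = expectation X * expectation Y"
    and past_future_integrable: "integrable M (\<lambda>\<omega>. X \<omega> * Y \<omega>)"
proof -
  have ind: "indep_set (sets (F t)) (sets (future t))"
    using noise_filtration t by (auto simp: noise_filtration_def sets_future)
  have sX: "sigma_sets (space M) {X -` A \<inter> space M |A. A \<in> sets borel} \<subseteq> sets (F t)"
  proof -
    have "{X -` A \<inter> space M |A. A \<in> sets borel} \<subseteq> sets (F t)"
      using measurable_sets[OF X(1)] by (auto simp: space_F)
    from sets.sigma_sets_subset[OF this] show ?thesis by (simp add: space_F)
  qed
  have sY: "sigma_sets (space M) {Y -` A \<inter> space M |A. A \<in> sets borel} \<subseteq> sets (future t)"
  proof -
    have "{Y -` A \<inter> space M |A. A \<in> sets borel} \<subseteq> sets (future t)"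
      using measurable_sets[OF Y(1)] by (auto simp: space_future)
    from sets.sigma_sets_subset[OF this] show ?thesis by (simp add: space_future)
  qed
  have "indep_var borel X borel Y"
    unfolding indep_var_eq
  proof (intro conjI)
    show "indep_set (sigma_sets (space M) {X -` A \<inter> space M |A. A \<in> sets borel})
      (sigma_sets (space M) {Y -` A \<inter> space M |A. A \<in> sets borel})"
      using ind sX sY unfolding indep_sets2_eq by blast
  qed (use X Y in auto)
  then show "expectation (\<lambda>\<omega>. X \<omega> * Y \<omega>) = expectation X * expectation Y"
    "integrable M (\<lambda>\<omega>. X \<omega> * Y \<omega>)"
    using indep_var_lebesgue_integral[OF _ X(2) Y(2)] indep_var_integrable[OF _ X(2) Y(2)] by blast+
qed

lemma rectangle_noise_set:
  assumes "0 \<le> a" "A \<in> sets borel" "A \<subseteq> {0<..<L}"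
  shows "{a<..b} \<times> A \<in> noise_sets {a<..} L" "{a<..b} \<times> A \<in> noise_sets {0<..b} L"
    "{a<..b} \<times> A \<in> noise_sets {0<..} L"
proof -
  have m: "{a<..b} \<times> A \<in> sets borel"
    using assms by (intro borel_Times) auto
  have "emeasure lborel ({a<..b} \<times> A) \<le> emeasure lborel (cbox (a, 0) (b, L))"
    using assms by (intro emeasure_mono) (auto simp: cbox_Pair_eq intro!: borel_Times)
  also have "\<dots> < \<infinity>"
    by (rule emeasure_lborel_cbox_finite)
  finally show "{a<..b} \<times> A \<in> noise_sets {a<..} L" "{a<..b} \<times> A \<in> noise_sets {0<..b} L"
    "{a<..b} \<times> A \<in> noise_sets {0<..} L"
    using m assms by (auto simp: noise_sets_def)
qed

definition elementary :: "real \<times> real \<times> real set \<times> ('w \<Rightarrow> real) \<Rightarrow> bool" where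
  "elementary e = (case e of (a, b, A, X) \<Rightarrow> 0 \<le> a \<and> a \<le> b \<and> A \<in> sets borel \<and> A \<subseteq> {0<..<L} \<and>
        X \<in> borel_measurable (F a) \<and> bounded (X ` space M))"

definition amplitude :: "real \<times> real \<times> real set \<times> ('w \<Rightarrow> real) \<Rightarrow> 'w \<Rightarrow> real" where
  "amplitude e = (case e of (a, b, A, X) \<Rightarrow> X)"

definition rect :: "real \<times> real \<times> real set \<times> ('w \<Rightarrow> real) \<Rightarrow> (real \<times> real) set" where
  "rect e = (case e of (a, b, A, X) \<Rightarrow> {a<..b} \<times> A)"

lemma simple_field_iff: "simple_field M F L S \<longleftrightarrow> (\<forall>e\<in>set S. elementary e)"
  unfolding simple_field_def elementary_def by (rule refl)

lemma simple_integral_eq_sum: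
  "simple_integral W S \<omega> = (\<Sum>i<length S. amplitude (S ! i) \<omega> * W (rect (S ! i)) \<omega>)"
proof -
  have "(\<lambda>(a, b, A, X). X \<omega> * W ({a<..b} \<times> A) \<omega>) = (\<lambda>e. amplitude e \<omega> * W (rect e) \<omega>)"
    by (simp add: fun_eq_iff amplitude_def rect_def)
  then show ?thesis by (simp add: simple_integral_def sum_list_sum_nth atLeast0LessThan)
qed

lemma simple_value_eq_sum:
  "simple_value S s y \<omega> = (\<Sum>i<length S. amplitude (S ! i) \<omega> * indicator (rect (S ! i)) (s, y))"
proof -
  have "(\<lambda>(a, b, A, X). X \<omega> * indicator {a<..b} s * indicator A y) =
      (\<lambda>e. amplitude e \<omega> * (indicator (rect e) (s, y) :: real))"
    by (simp add: fun_eq_iff amplitude_def rect_def indicator_times)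
  then show ?thesis by (simp add: simple_value_def sum_list_sum_nth atLeast0LessThan)
qed

lemma elementary_rect:
  assumes "elementary e"
  shows "rect e \<in> noise_sets {0<..} L"
proof -
  obtain a b A X where e: "e = (a, b, A, X)" by (cases e)
  have "0 \<le> a" "A \<in> sets borel" "A \<subseteq> {0<..<L}"
    using assms by (simp_all add: e elementary_def)
  then show ?thesis
    unfolding e rect_def prod.case by (rule rectangle_noise_set(3))
qed

lemma elementary_amplitude:
  assumes "elementary e"
  shows "amplitude e \<in> borel_measurable M" "bounded (amplitude e ` space M)"
proof -
  obtain a b A X where e: "e = (a, b, A, X)" by (cases e)
  have "X \<in> borel_measurable (F a)" "bounded (X ` space M)"
    using assms by (simp_all add: e elementary_def)
  then show "amplitude e \<in> borel_measurable M" "bounded (amplitude e ` space M)"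
    unfolding e amplitude_def prod.case by (auto dest: measurable_F_imp_M)
qed

lemma elementary_square_integrable:
  assumes "elementary e"
  shows "integrable M (\<lambda>\<omega>. (amplitude e \<omega> * W (rect e) \<omega>)\<^sup>2)"
  using assms by (intro integrable_square_bounded_mult[OF elementary_amplitude(1) _ elementary_amplitude(2)]
      noise_measurable[OF elementary_rect] noise_square_integrable[OF elementary_rect])

lemma elementary_integral_measurable:
  assumes "elementary e"
  shows "(\<lambda>\<omega>. amplitude e \<omega> * W (rect e) \<omega>) \<in> borel_measurable M"
  by (rule borel_measurable_times[OF elementary_amplitude(1)[OF assms] noise_measurable[OF elementary_rect[OF assms]]])

lemma elementary_expectation:
  assumes e: "elementary e"
  shows "expectation (\<lambda>\<omega>. amplitude e \<omega> * W (rect e) \<omega>) = 0"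
proof -
  obtain a b A X where e': "e = (a, b, A, X)" by (cases e)
  have *: "0 \<le> a" "A \<in> sets borel" "A \<subseteq> {0<..<L}" "X \<in> borel_measurable (F a)" "bounded (X ` space M)"
    using e by (auto simp: e' elementary_def)
  note R = rectangle_noise_set[OF *(1-3), of b] and m = measurable_F_imp_M[OF *(4)]
  have "integrable M (\<lambda>\<omega>. (X \<omega> * 1)\<^sup>2)"
    by (rule integrable_square_bounded_mult) (use * m in auto)
  then have iX: "integrable M X"
    by (intro integrable_of_square[OF m]) simp
  have iW: "integrable M (W ({a<..b} \<times> A))"
    by (rule integrable_of_square[OF noise_measurable[OF R(3)] noise_square_integrable[OF R(3)]])
  have "expectation (\<lambda>\<omega>. X \<omega> * W ({a<..b} \<times> A) \<omega>) = expectation X * expectation (W ({a<..b} \<times> A))"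
    by (rule past_future_expectation[OF *(1,4) iX noise_measurable_future[OF R(1)] iW])
  then show ?thesis
    by (simp add: e' amplitude_def rect_def noise_expectation[OF R(3)])
qed

text \<open>
  The part of the earlier rectangle that precedes the starting time \<open>a'\<close> of the later one is disjoint
  from the later rectangle. Its noise belongs to the past of \<open>a'\<close>, so its contribution contains the
  factor \<open>expectation (W R') = 0\<close>. What remains is a product of two future noises multiplied by
  coefficients known at time \<open>a'\<close>, and independence separates the two.
\<close>

lemma elementary_covariance_ordered:
  assumes e: "elementary e" and e': "elementary e'" and le: "fst e \<le> fst e'"
  shows "expectation (\<lambda>\<omega>. (amplitude e \<omega> * W (rect e) \<omega>) * (amplitude e' \<omega> * W (rect e') \<omega>)) =
     expectation (\<lambda>\<omega>. amplitude e \<omega> * amplitude e' \<omega>) * measure lborel (rect e \<inter> rect e')"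
proof -
  obtain a b A X where eq: "e = (a, b, A, X)" by (cases e)
  obtain a' b' A' X' where eq': "e' = (a', b', A', X')" by (cases e')
  have aa: "a \<le> a'" using le by (simp add: eq eq')
  have 1: "0 \<le> a" "A \<in> sets borel" "A \<subseteq> {0<..<L}" "X \<in> borel_measurable (F a')" "bounded (X ` space M)"
    using e measurable_F_mono[OF aa] by (auto simp: eq elementary_def)
  have 2: "0 \<le> a'" "A' \<in> sets borel" "A' \<subseteq> {0<..<L}" "X' \<in> borel_measurable (F a')" "bounded (X' ` space M)"
    using e' by (auto simp: eq' elementary_def)
  define P where "P = {a<..min b a'} \<times> A"
  define Q where "Q = {a'<..b} \<times> A"
  define R where "R = {a<..b} \<times> A"
  define R' where "R' = {a'<..b'} \<times> A'"
  have RPQ: "R = P \<union> Q" "P \<inter> Q = {}" and QR: "Q \<inter> R' = R \<inter> R'"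
    using aa by (auto simp: R_def P_def Q_def R'_def)
  have P: "P \<in> noise_sets {0<..} L" "P \<in> noise_sets {0<..a'} L"
    using rectangle_noise_set[OF 1(1-3), of "min b a'"] by (auto simp: P_def noise_sets_def)
  have Q: "Q \<in> noise_sets {0<..} L" "Q \<in> noise_sets {a'<..} L"
    using rectangle_noise_set[OF 2(1) 1(2,3), of b] by (auto simp: Q_def)
  have R': "R' \<in> noise_sets {0<..} L" "R' \<in> noise_sets {a'<..} L"
    using rectangle_noise_set[OF 2(1-3), of b'] by (auto simp: R'_def)
  have R: "R \<in> noise_sets {0<..} L"
    using rectangle_noise_set[OF 1(1-3), of b] by (auto simp: R_def)
  note [measurable] = noise_measurable[OF P(1)] noise_measurable[OF Q(1)] noise_measurable[OF R'(1)]
    noise_measurable[OF R] measurable_F_imp_M[OF 1(4)] measurable_F_imp_M[OF 2(4)]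
  have bXX: "bounded ((\<lambda>\<omega>. X \<omega> * X' \<omega>) ` space M)"
  proof -
    obtain B B' where BB: "\<And>x. x \<in> space M \<Longrightarrow> \<bar>X x\<bar> \<le> B" "\<And>x. x \<in> space M \<Longrightarrow> \<bar>X' x\<bar> \<le> B'"
      using 1(5) 2(5) by (auto simp: bounded_iff)
    have "\<bar>X x * X' x\<bar> \<le> B * B'" if "x \<in> space M" for x
      using BB[OF that] unfolding abs_mult by (intro mult_mono) linarith+
    then show ?thesis by (auto simp: bounded_iff)
  qed
  have XXF: "(\<lambda>\<omega>. X \<omega> * X' \<omega>) \<in> borel_measurable (F a')"
    using 1(4) 2(4) by simp
  have "integrable M (\<lambda>\<omega>. (X \<omega> * X' \<omega> * 1)\<^sup>2)"
    by (rule integrable_square_bounded_mult[OF _ _ bXX]) auto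
  then have iXX: "integrable M (\<lambda>\<omega>. X \<omega> * X' \<omega>)"
    by (intro integrable_of_square[OF measurable_F_imp_M[OF XXF]]) simp
  have "integrable M (\<lambda>\<omega>. (X \<omega> * X' \<omega> * W P \<omega>)\<^sup>2)"
    by (rule integrable_square_bounded_mult[OF _ _ bXX noise_square_integrable[OF P(1)]]) auto
  then have iXXP: "integrable M (\<lambda>\<omega>. X \<omega> * X' \<omega> * W P \<omega>)"
    by (rule integrable_of_square[rotated]) measurable
  have iR': "integrable M (W R')"
    by (rule integrable_of_square[OF _ noise_square_integrable[OF R'(1)]]) auto
  have iQR: "integrable M (\<lambda>\<omega>. W Q \<omega> * W R' \<omega>)"
    by (rule integrable_mult_of_squares[OF _ _ noise_square_integrable[OF Q(1)] noise_square_integrable[OF R'(1)]]) auto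
  have mP: "(\<lambda>\<omega>. X \<omega> * X' \<omega> * W P \<omega>) \<in> borel_measurable (F a')"
    using XXF noise_adapted[OF 2(1) P(2)] by simp
  have mR': "W R' \<in> borel_measurable (future a')"
    by (rule noise_measurable_future[OF R'(2)])
  have mQR: "(\<lambda>\<omega>. W Q \<omega> * W R' \<omega>) \<in> borel_measurable (future a')"
    using noise_measurable_future[OF Q(2)] mR' by simp
  have "expectation (\<lambda>\<omega>. (X \<omega> * W R \<omega>) * (X' \<omega> * W R' \<omega>)) =
      expectation (\<lambda>\<omega>. (X \<omega> * X' \<omega> * W P \<omega>) * W R' \<omega> + (X \<omega> * X' \<omega>) * (W Q \<omega> * W R' \<omega>))"
  proof (rule integral_cong_AE)
    show "AE \<omega> in M. (X \<omega> * W R \<omega>) * (X' \<omega> * W R' \<omega>) =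
       (X \<omega> * X' \<omega> * W P \<omega>) * W R' \<omega> + (X \<omega> * X' \<omega>) * (W Q \<omega> * W R' \<omega>)"
      using noise_Un[OF P(1) Q(1) RPQ(2)] unfolding RPQ(1)
      by eventually_elim (simp add: algebra_simps)
  qed auto
  also have "\<dots> = expectation (\<lambda>\<omega>. X \<omega> * X' \<omega> * W P \<omega>) * expectation (W R')
      + expectation (\<lambda>\<omega>. X \<omega> * X' \<omega>) * expectation (\<lambda>\<omega>. W Q \<omega> * W R' \<omega>)"
    using past_future_expectation[OF 2(1) mP iXXP mR' iR'] past_future_integrable[OF 2(1) mP iXXP mR' iR']
      past_future_expectation[OF 2(1) XXF iXX mQR iQR] past_future_integrable[OF 2(1) XXF iXX mQR iQR]
    by simp
  also have "\<dots> = expectation (\<lambda>\<omega>. X \<omega> * X' \<omega>) * measure lborel (R \<inter> R')"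
    by (simp add: noise_expectation[OF R'(1)] noise_covariance[OF Q(1) R'(1)] QR)
  finally show ?thesis
    by (simp add: eq eq' amplitude_def rect_def R_def R'_def)
qed

lemma elementary_covariance:
  assumes e: "elementary e" and e': "elementary e'"
  shows "expectation (\<lambda>\<omega>. (amplitude e \<omega> * W (rect e) \<omega>) * (amplitude e' \<omega> * W (rect e') \<omega>)) =
     expectation (\<lambda>\<omega>. amplitude e \<omega> * amplitude e' \<omega>) * measure lborel (rect e \<inter> rect e')"
  using elementary_covariance_ordered[OF e e'] elementary_covariance_ordered[OF e' e]
  by (cases "fst e \<le> fst e'") (simp_all add: mult.commute Int_commute)

end

section \<open>The Walsh isometry\<close>

text \<open>
  Continuity of the \<open>L\<^sup>2\<close> norm, in a form that yields square integrability of the limit as well. The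
  difference of the norms is controlled by integrating the elementary bound
  \<open>\<bar>b\<^sup>2 - a\<^sup>2\<bar> \<le> \<eta> * a\<^sup>2 + (1 + 1 / \<eta>) * (a - b)\<^sup>2\<close> and letting \<open>\<eta>\<close> tend to zero last.
\<close>

lemma integral_square_tendsto:
  fixes f :: "'a \<Rightarrow> real" and g :: "nat \<Rightarrow> 'a \<Rightarrow> real"
  assumes [measurable]: "f \<in> borel_measurable M" "\<And>n. g n \<in> borel_measurable M"
    and g: "\<And>n. integrable M (\<lambda>x. (g n x)\<^sup>2)"
    and lim: "(\<lambda>n. \<integral>\<^sup>+x. ennreal ((f x - g n x)\<^sup>2) \<partial>M) \<longlonglongrightarrow> 0"
  shows "integrable M (\<lambda>x. (f x)\<^sup>2)" (is ?int)
    and "(\<lambda>n. \<integral>x. (g n x)\<^sup>2 \<partial>M) \<longlonglongrightarrow> (\<integral>x. (f x)\<^sup>2 \<partial>M)" (is ?lim)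
proof -
  define d where "d n = (\<integral>\<^sup>+x. ennreal ((f x - g n x)\<^sup>2) \<partial>M)" for n
  have d: "d \<longlonglongrightarrow> 0" using lim by (simp add: d_def[abs_def])
  then have "\<forall>\<^sub>F n in sequentially. d n < 1" by (rule order_tendstoD) simp
  then obtain n0 where n0: "\<And>n. n \<ge> n0 \<Longrightarrow> d n < 1" by (auto simp: eventually_sequentially)
  have di: "integrable M (\<lambda>x. (f x - g n x)\<^sup>2)" if "n \<ge> n0" for n
    using n0[OF that] by (intro integrableI_nonneg) (auto simp: d_def elim: order.strict_trans)
  show f: ?int
  proof (rule Bochner_Integration.integrable_bound)
    show "integrable M (\<lambda>x. 2 * (f x - g n0 x)\<^sup>2 + 2 * (g n0 x)\<^sup>2)" using g di by simp
    have "a\<^sup>2 \<le> 2 * (a - b)\<^sup>2 + 2 * b\<^sup>2" for a b :: real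
      using zero_le_power2[of "a - 2 * b"] by (simp add: power2_eq_square algebra_simps)
    then show "AE x in M. norm ((f x)\<^sup>2) \<le> norm (2 * (f x - g n0 x)\<^sup>2 + 2 * (g n0 x)\<^sup>2)" by simp
  qed simp
  define A where "A = (\<integral>x. (f x)\<^sup>2 \<partial>M)"
  have A0: "A \<ge> 0" by (simp add: A_def)
  define D where "D n = (\<integral>x. (f x - g n x)\<^sup>2 \<partial>M)" for n
  have "enn2real (d n) = D n" for n
    unfolding d_def D_def by (rule integral_eq_nn_integral[symmetric]) auto
  moreover have "(\<lambda>n. enn2real (d n)) \<longlonglongrightarrow> enn2real 0"
    using d by (intro tendsto_enn2real) auto
  ultimately have D: "D \<longlonglongrightarrow> 0" by simp
  have key: "\<bar>(\<integral>x. (g n x)\<^sup>2 \<partial>M) - A\<bar> \<le> \<eta> * A + (1 + 1 / \<eta>) * D n" if n: "n \<ge> n0" and \<eta>: "\<eta> > 0" for n \<eta>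
  proof -
    have pw: "\<bar>b\<^sup>2 - a\<^sup>2\<bar> \<le> \<eta> * a\<^sup>2 + (1 + 1 / \<eta>) * (a - b)\<^sup>2" for a b :: real
    proof -
      have "2 * \<bar>a\<bar> * \<bar>a - b\<bar> = 2 * (sqrt \<eta> * \<bar>a\<bar>) * (\<bar>a - b\<bar> / sqrt \<eta>)" using \<eta> by simp
      also have "\<dots> \<le> (sqrt \<eta> * \<bar>a\<bar>)\<^sup>2 + (\<bar>a - b\<bar> / sqrt \<eta>)\<^sup>2" by (rule sum_squares_bound)
      also have "\<dots> = \<eta> * a\<^sup>2 + 1 / \<eta> * (a - b)\<^sup>2"
        using \<eta> by (simp add: power_mult_distrib power_divide)
      finally have 1: "2 * \<bar>a\<bar> * \<bar>a - b\<bar> \<le> \<eta> * a\<^sup>2 + 1 / \<eta> * (a - b)\<^sup>2" .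
      have "b\<^sup>2 - a\<^sup>2 = (a - b)\<^sup>2 - 2 * (a * (a - b))" by (simp add: power2_eq_square algebra_simps)
      then have "\<bar>b\<^sup>2 - a\<^sup>2\<bar> \<le> (a - b)\<^sup>2 + \<bar>2 * (a * (a - b))\<bar>"
        using zero_le_power2[of "a - b"] by linarith
      also have "\<bar>2 * (a * (a - b))\<bar> = 2 * \<bar>a\<bar> * \<bar>a - b\<bar>" by (simp add: abs_mult)
      finally show ?thesis using 1 unfolding distrib_right mult_1_left by linarith
    qed
    have "\<bar>(\<integral>x. (g n x)\<^sup>2 \<partial>M) - A\<bar> = \<bar>\<integral>x. (g n x)\<^sup>2 - (f x)\<^sup>2 \<partial>M\<bar>"
      using f g by (simp add: A_def)
    also have "\<dots> \<le> (\<integral>x. \<bar>(g n x)\<^sup>2 - (f x)\<^sup>2\<bar> \<partial>M)" by (rule integral_abs_bound)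
    also have "\<dots> \<le> (\<integral>x. \<eta> * (f x)\<^sup>2 + (1 + 1 / \<eta>) * (f x - g n x)\<^sup>2 \<partial>M)"
      using f g[of n] di[OF n] by (intro integral_mono pw) auto
    also have "\<dots> = \<eta> * A + (1 + 1 / \<eta>) * D n"
      using f di[OF n] by (simp add: A_def D_def)
    finally show ?thesis .
  qed
  show ?lim
  proof (rule LIMSEQ_I)
    fix r :: real assume r: "r > 0"
    define \<eta> where "\<eta> = r / (2 * (A + 1))"
    have \<eta>: "\<eta> > 0" "\<eta> * A < r / 2"
    proof -
      show "\<eta> > 0" using r A0 by (simp add: \<eta>_def)
      have "\<eta> * A < \<eta> * (A + 1)" using \<open>\<eta> > 0\<close> by simp
      also have "\<dots> = r / 2" using A0 by (simp add: \<eta>_def field_simps)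
      finally show "\<eta> * A < r / 2" .
    qed
    have "(\<lambda>n. (1 + 1 / \<eta>) * D n) \<longlonglongrightarrow> (1 + 1 / \<eta>) * 0" by (intro tendsto_intros D)
    then have "\<forall>\<^sub>F n in sequentially. (1 + 1 / \<eta>) * D n < r / 2"
      using r by (intro order_tendstoD) auto
    then obtain n1 where n1: "\<And>n. n \<ge> n1 \<Longrightarrow> (1 + 1 / \<eta>) * D n < r / 2"
      by (auto simp: eventually_sequentially)
    show "\<exists>no. \<forall>n\<ge>no. norm ((\<integral>x. (g n x)\<^sup>2 \<partial>M) - (\<integral>x. (f x)\<^sup>2 \<partial>M)) < r"
    proof (intro exI[of _ "max n0 n1"] allI impI)
      fix n assume "max n0 n1 \<le> n"
      then have n: "n \<ge> n0" "n \<ge> n1" by auto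
      show "norm ((\<integral>x. (g n x)\<^sup>2 \<partial>M) - (\<integral>x. (f x)\<^sup>2 \<partial>M)) < r"
        unfolding real_norm_def A_def[symmetric] using key[OF n(1) \<eta>(1)] n1[OF n(2)] \<eta>(2) by linarith
    qed
  qed
qed

lemma integral_sum_square:
  fixes f :: "'i \<Rightarrow> 'a \<Rightarrow> real"
  assumes "finite I" "\<And>i j. i \<in> I \<Longrightarrow> j \<in> I \<Longrightarrow> integrable M (\<lambda>x. f i x * f j x)"
  shows "integrable M (\<lambda>x. (\<Sum>i\<in>I. f i x)\<^sup>2)"
    and "(\<integral>x. (\<Sum>i\<in>I. f i x)\<^sup>2 \<partial>M) = (\<Sum>i\<in>I. \<Sum>j\<in>I. \<integral>x. f i x * f j x \<partial>M)"
  using assms by (simp_all add: power2_eq_square sum_product)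

context walsh_noise
begin

abbreviation domain :: "(real \<times> real) set" where
  "domain \<equiv> {0<..} \<times> {0<..<L}"

lemma domain_sets [measurable]: "domain \<in> sets borel"
  by (intro borel_open open_Times) auto

lemma elementary_product_integrable:
  assumes e: "elementary e" and e': "elementary e'"
  shows "integrable M (\<lambda>\<omega>. (amplitude e \<omega> * W (rect e) \<omega>) * (amplitude e' \<omega> * W (rect e') \<omega>))"
  by (rule integrable_mult_of_squares) (fact elementary_integral_measurable[OF e] elementary_integral_measurable[OF e']
     elementary_square_integrable[OF e] elementary_square_integrable[OF e'])+

lemma
  assumes S: "simple_field M F L S"
  shows simple_integral_measurable: "simple_integral W S \<in> borel_measurable M"
    and simple_integral_square_integrable: "integrable M (\<lambda>\<omega>. (simple_integral W S \<omega>)\<^sup>2)"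
    and simple_integral_expectation: "expectation (simple_integral W S) = 0"
    and simple_integral_variance: "expectation (\<lambda>\<omega>. (simple_integral W S \<omega>)\<^sup>2) =
      (\<Sum>i<length S. \<Sum>j<length S. expectation (\<lambda>\<omega>. amplitude (S ! i) \<omega> * amplitude (S ! j) \<omega>) *
         measure lborel (rect (S ! i) \<inter> rect (S ! j)))"
proof -
  have el: "elementary (S ! i)" if "i < length S" for i
    using S that by (auto simp: simple_field_iff)
  show "simple_integral W S \<in> borel_measurable M"
    unfolding simple_integral_eq_sum[abs_def]
    by (intro borel_measurable_sum elementary_integral_measurable el) simp
  show "expectation (simple_integral W S) = 0"
  proof -
    have "integrable M (\<lambda>\<omega>. amplitude (S ! i) \<omega> * W (rect (S ! i)) \<omega>)" if "i < length S" for i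
      by (rule integrable_of_square[OF elementary_integral_measurable[OF el[OF that]]
            elementary_square_integrable[OF el[OF that]]])
    then show ?thesis
      unfolding simple_integral_eq_sum[abs_def]
      by (subst Bochner_Integration.integral_sum) (auto simp: elementary_expectation el)
  qed
  have int: "integrable M (\<lambda>\<omega>. (amplitude (S ! i) \<omega> * W (rect (S ! i)) \<omega>) * (amplitude (S ! j) \<omega> * W (rect (S ! j)) \<omega>))"
    if "i \<in> {..<length S}" "j \<in> {..<length S}" for i j
    using that by (intro elementary_product_integrable el) auto
  show "integrable M (\<lambda>\<omega>. (simple_integral W S \<omega>)\<^sup>2)"
    unfolding simple_integral_eq_sum[abs_def] by (rule integral_sum_square[OF _ int]) auto
  have "expectation (\<lambda>\<omega>. (simple_integral W S \<omega>)\<^sup>2) =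
     (\<Sum>i<length S. \<Sum>j<length S. expectation (\<lambda>\<omega>. (amplitude (S ! i) \<omega> * W (rect (S ! i)) \<omega>) *
        (amplitude (S ! j) \<omega> * W (rect (S ! j)) \<omega>)))"
    unfolding simple_integral_eq_sum[abs_def] by (rule integral_sum_square[OF _ int]) auto
  also have "\<dots> = (\<Sum>i<length S. \<Sum>j<length S. expectation (\<lambda>\<omega>. amplitude (S ! i) \<omega> * amplitude (S ! j) \<omega>) *
         measure lborel (rect (S ! i) \<inter> rect (S ! j)))"
    by (intro sum.cong refl elementary_covariance el) auto
  finally show "expectation (\<lambda>\<omega>. (simple_integral W S \<omega>)\<^sup>2) = \<dots>" .
qed

lemma elementary_rect_props:
  assumes "elementary e"
  shows "rect e \<in> sets borel" "rect e \<subseteq> domain" "emeasure lborel (rect e) < \<infinity>"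
  using elementary_rect[OF assms] by (auto simp: noise_sets_def)

lemma
  assumes e: "elementary e" and e': "elementary e'"
  shows elementary_value_integrable: "integrable (M \<Otimes>\<^sub>M lborel)
      (\<lambda>(\<omega>, z). (amplitude e \<omega> * indicator (rect e) z) * (amplitude e' \<omega> * indicator (rect e') z))" (is ?int)
    and elementary_value_integral: "(\<integral>(\<omega>, z). (amplitude e \<omega> * indicator (rect e) z) * (amplitude e' \<omega> * indicator (rect e') z)
       \<partial>(M \<Otimes>\<^sub>M lborel)) =
      expectation (\<lambda>\<omega>. amplitude e \<omega> * amplitude e' \<omega>) * measure lborel (rect e \<inter> rect e')" (is ?eq)
proof -
  interpret P: pair_sigma_finite M "lborel :: (real \<times> real) measure" ..
  have [measurable]: "amplitude e \<in> borel_measurable M" "amplitude e' \<in> borel_measurable M"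
     "rect e \<in> sets borel" "rect e' \<in> sets borel"
    using elementary_rect_props[OF e] elementary_rect_props[OF e'] elementary_amplitude[OF e] elementary_amplitude[OF e'] by auto
  have "integrable M (\<lambda>\<omega>. (amplitude d \<omega> * 1)\<^sup>2)" if d: "elementary d" for d
    by (rule integrable_square_bounded_mult[OF elementary_amplitude(1)[OF d] _ elementary_amplitude(2)[OF d]]) auto
  then have iC: "integrable M (\<lambda>\<omega>. amplitude e \<omega> * amplitude e' \<omega>)"
    using e e' by (intro integrable_mult_of_squares) auto
  have "emeasure lborel (rect e \<inter> rect e') \<le> emeasure lborel (rect e)"
    by (intro emeasure_mono) auto
  then have fin: "emeasure lborel (rect e \<inter> rect e') < \<infinity>"
    using elementary_rect_props(3)[OF e] by (rule order_le_less_trans)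
  then have iR: "integrable lborel (indicator (rect e \<inter> rect e') :: _ \<Rightarrow> real)"
    by (intro integrable_real_indicator) auto
  have eq: "(\<lambda>(\<omega>, z). (amplitude e \<omega> * indicator (rect e) z) * (amplitude e' \<omega> * indicator (rect e') z)) =
     (\<lambda>(\<omega>, z). (amplitude e \<omega> * amplitude e' \<omega>) * indicator (rect e \<inter> rect e') z)"
    by (auto simp: fun_eq_iff indicator_inter_arith)
  show int: ?int
    unfolding eq
  proof (rule P.Fubini_integrable)
    show "integrable M (\<lambda>\<omega>. \<integral>z. norm (case (\<omega>, z) of (\<omega>, z) \<Rightarrow>
        amplitude e \<omega> * amplitude e' \<omega> * indicator (rect e \<inter> rect e') z) \<partial>lborel)"
      using integrable_abs[OF iC] by (simp add: abs_mult)
    show "AE \<omega> in M. integrable lborel (\<lambda>z. case (\<omega>, z) of (\<omega>, z) \<Rightarrow>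
        amplitude e \<omega> * amplitude e' \<omega> * indicator (rect e \<inter> rect e') z)"
      using iR by simp
  qed measurable
  have "(\<integral>(\<omega>, z). (amplitude e \<omega> * indicator (rect e) z) * (amplitude e' \<omega> * indicator (rect e') z)
       \<partial>(M \<Otimes>\<^sub>M lborel)) = (\<integral>\<omega>. \<integral>z. (amplitude e \<omega> * amplitude e' \<omega>) * indicator (rect e \<inter> rect e') z \<partial>lborel \<partial>M)"
    using P.integral_fst'[OF int] unfolding eq by simp
  also have "\<dots> = expectation (\<lambda>\<omega>. amplitude e \<omega> * amplitude e' \<omega>) * measure lborel (rect e \<inter> rect e')"
    by simp
  finally show ?eq .
qed

lemma
  assumes S: "simple_field M F L S"
  shows simple_value_measurable:
      "(\<lambda>(\<omega>, z). simple_value S (fst z) (snd z) \<omega> * indicator domain z) \<in> borel_measurable (M \<Otimes>\<^sub>M lborel)" (is ?meas)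
    and simple_value_square_integrable:
      "integrable (M \<Otimes>\<^sub>M lborel) (\<lambda>(\<omega>, z). (simple_value S (fst z) (snd z) \<omega> * indicator domain z)\<^sup>2)" (is ?int)
    and simple_isometry: "(\<integral>(\<omega>, z). (simple_value S (fst z) (snd z) \<omega> * indicator domain z)\<^sup>2 \<partial>(M \<Otimes>\<^sub>M lborel)) =
      expectation (\<lambda>\<omega>. (simple_integral W S \<omega>)\<^sup>2)" (is ?eq)
proof -
  have el: "elementary (S ! i)" if "i < length S" for i
    using S that by (auto simp: simple_field_iff)
  define f where "f i = (\<lambda>(\<omega>, z). amplitude (S ! i) \<omega> * (indicator (rect (S ! i)) z :: real))" for i
  have "simple_value S (fst z) (snd z) \<omega> * indicator domain z = (\<Sum>i<length S. f i (\<omega>, z))" for \<omega> z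
  proof -
    have "indicator (rect (S ! i)) z * (indicator domain z :: real) = indicator (rect (S ! i)) z" if "i < length S" for i
      using elementary_rect_props(2)[OF el[OF that]] by (auto simp: indicator_def)
    then show ?thesis
      unfolding simple_value_eq_sum f_def sum_distrib_right
      by (intro sum.cong) (auto simp: mult.assoc)
  qed
  then have eq: "(\<lambda>(\<omega>, z). simple_value S (fst z) (snd z) \<omega> * indicator domain z) = (\<lambda>p. \<Sum>i<length S. f i p)"
     and eq2: "(\<lambda>(\<omega>, z). (simple_value S (fst z) (snd z) \<omega> * indicator domain z)\<^sup>2) = (\<lambda>p. (\<Sum>i<length S. f i p)\<^sup>2)"
    by (auto simp: fun_eq_iff)
  have fm: "f i \<in> borel_measurable (M \<Otimes>\<^sub>M lborel)" if "i < length S" for i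
  proof -
    have [measurable]: "amplitude (S ! i) \<in> borel_measurable M" "rect (S ! i) \<in> sets borel"
      using elementary_rect_props[OF el[OF that]] elementary_amplitude[OF el[OF that]] by auto
    show ?thesis unfolding f_def by measurable
  qed
  show ?meas unfolding eq by (intro borel_measurable_sum fm) simp
  have ff: "(\<lambda>p. f i p * f j p) = (\<lambda>(\<omega>, z). (amplitude (S ! i) \<omega> * indicator (rect (S ! i)) z) *
      (amplitude (S ! j) \<omega> * indicator (rect (S ! j)) z))" for i j
    by (auto simp: fun_eq_iff f_def)
  have int: "integrable (M \<Otimes>\<^sub>M lborel) (\<lambda>p. f i p * f j p)" if "i \<in> {..<length S}" "j \<in> {..<length S}" for i j
    unfolding ff using that by (intro elementary_value_integrable el) auto
  show ?int unfolding eq2 by (rule integral_sum_square[OF _ int]) auto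
  have "(\<integral>p. (\<Sum>i<length S. f i p)\<^sup>2 \<partial>(M \<Otimes>\<^sub>M lborel)) =
     (\<Sum>i<length S. \<Sum>j<length S. \<integral>p. f i p * f j p \<partial>(M \<Otimes>\<^sub>M lborel))"
    by (rule integral_sum_square[OF _ int]) auto
  also have "\<dots> = (\<Sum>i<length S. \<Sum>j<length S. expectation (\<lambda>\<omega>. amplitude (S ! i) \<omega> * amplitude (S ! j) \<omega>) *
         measure lborel (rect (S ! i) \<inter> rect (S ! j)))"
    unfolding ff by (intro sum.cong refl elementary_value_integral el) auto
  finally show ?eq unfolding eq2 simple_integral_variance[OF S] .
qed

text \<open>
  Fields are handled on the product of the probability space with the time-space domain, where
  Tonelli's theorem applies. A predictable field is jointly measurable there because the preimages
  of the generating rectangles are product sets; the cut-off to the open domain makes the statement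
  independent of values elsewhere.
\<close>

lemma predictable_measurable:
  assumes P: "predictable M F L \<Phi>"
  shows "(\<lambda>(\<omega>, z). \<Phi> (fst z) (snd z) \<omega> * indicator domain z) \<in> borel_measurable (M \<Otimes>\<^sub>M borel)"
proof -
  let ?\<Omega> = "{0<..} \<times> {0..L} \<times> space M"
  let ?G = "{{a<..b} \<times> A \<times> G | a b A G.
          0 \<le> a \<and> a \<le> b \<and> A \<in> sets borel \<and> A \<subseteq> {0..L} \<and> G \<in> sets (F a)}"
  let ?\<iota> = "\<lambda>(\<omega>, z). (fst z, snd z, \<omega>)"
  let ?N = "restrict_space (M \<Otimes>\<^sub>M (borel :: (real \<times> real) measure)) (space M \<times> domain)"
  have spN: "space ?N = space M \<times> domain"
    by (auto simp: space_restrict_space space_pair_measure)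
  have dom: "space M \<times> domain \<inter> space (M \<Otimes>\<^sub>M (borel :: (real \<times> real) measure)) \<in> sets (M \<Otimes>\<^sub>M borel)"
  proof -
    have "space M \<times> domain \<in> sets (M \<Otimes>\<^sub>M (borel :: (real \<times> real) measure))"
      by (rule pair_measureI[OF sets.top domain_sets])
    then show ?thesis by (rule sets.Int) (rule sets.top)
  qed
  have "?\<iota> \<in> ?N \<rightarrow>\<^sub>M predictable_algebra M F L"
    unfolding predictable_algebra_def
  proof (rule measurable_measure_of)
    show "?G \<subseteq> Pow ?\<Omega>"
      by (auto dest!: sets.sets_into_space simp: space_F)
    show "?\<iota> \<in> space ?N \<rightarrow> ?\<Omega>" unfolding spN by auto
    fix R assume "R \<in> ?G"
    then obtain a b A G where R: "R = {a<..b} \<times> A \<times> G" and A: "A \<in> sets borel" and G: "G \<in> sets M"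
      using sets_F_subset by blast
    have AB: "{a<..b} \<times> A \<in> sets borel" using A by (intro borel_Times) auto
    have "?\<iota> -` R \<inter> space ?N = (G \<times> ({a<..b} \<times> A)) \<inter> (space M \<times> domain)"
      unfolding spN R by auto
    moreover have "G \<times> ({a<..b} \<times> A) \<in> sets (M \<Otimes>\<^sub>M borel)"
      using G AB by auto
    ultimately show "?\<iota> -` R \<inter> space ?N \<in> sets ?N"
      by (auto simp: sets_restrict_space)
  qed
  then have "(\<lambda>p. (\<lambda>(s, y, \<omega>). \<Phi> s y \<omega>) (?\<iota> p)) \<in> borel_measurable ?N"
    using P unfolding predictable_def by (rule measurable_compose)
  then have "(\<lambda>p. indicator (space M \<times> domain) p *\<^sub>R (\<lambda>(s, y, \<omega>). \<Phi> s y \<omega>) (?\<iota> p)) \<in>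
      borel_measurable (M \<Otimes>\<^sub>M borel)"
    by (subst (asm) borel_measurable_restrict_space_iff[OF dom])
  then show ?thesis
    by (rule measurable_cong[THEN iffD1, rotated])
      (auto simp: space_pair_measure indicator_times split: prod.splits)
qed

text \<open>
  Both sides are limits of the corresponding quantities for the approximating simple fields, for which
  they agree by \<open>simple_isometry\<close>. The expectation is continuous in \<open>L\<^sup>2\<close> because
  \<open>(expectation X)\<^sup>2 \<le> expectation (X\<^sup>2)\<close>.
\<close>

theorem walsh_isometry:
  assumes J: "has_walsh_integral M F W L \<Phi> J"
  shows "integrable M (\<lambda>\<omega>. (J \<omega>)\<^sup>2)" "expectation J = 0"
    and "(\<integral>\<^sup>+\<omega>. ennreal ((J \<omega>)\<^sup>2) \<partial>M) =
      (\<integral>\<^sup>+\<omega>. (\<integral>\<^sup>+z\<in>domain. ennreal ((\<Phi> (fst z) (snd z) \<omega>)\<^sup>2) \<partial>lborel) \<partial>M)"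
proof -
  from J obtain S where pred: "predictable M F L \<Phi>" and [measurable]: "J \<in> borel_measurable M"
    and S: "\<And>n. simple_field M F L (S n)"
    and lim1: "(\<lambda>n. \<integral>\<^sup>+\<omega>. (\<integral>\<^sup>+z\<in>domain.
               ennreal ((\<Phi> (fst z) (snd z) \<omega> - simple_value (S n) (fst z) (snd z) \<omega>)\<^sup>2) \<partial>lborel) \<partial>M)
          \<longlonglongrightarrow> 0"
    and lim2: "(\<lambda>n. \<integral>\<^sup>+\<omega>. ennreal ((J \<omega> - simple_integral W (S n) \<omega>)\<^sup>2) \<partial>M) \<longlonglongrightarrow> 0"
    unfolding has_walsh_integral_def by blast
  define \<phi> where "\<phi> = (\<lambda>(\<omega>, z). \<Phi> (fst z) (snd z) \<omega> * indicator domain z)"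
  define \<psi> where "\<psi> n = (\<lambda>(\<omega>, z). simple_value (S n) (fst z) (snd z) \<omega> * indicator domain z)" for n
  have m\<phi> [measurable]: "\<phi> \<in> borel_measurable (M \<Otimes>\<^sub>M lborel)"
    using predictable_measurable[OF pred] unfolding \<phi>_def
    by (simp add: measurable_def sets_pair_measure_cong[of M M lborel borel] space_pair_measure)
  have m\<psi> [measurable]: "\<psi> n \<in> borel_measurable (M \<Otimes>\<^sub>M lborel)" for n
    unfolding \<psi>_def by (rule simple_value_measurable[OF S])
  have mI [measurable]: "simple_integral W (S n) \<in> borel_measurable M" for n
    by (rule simple_integral_measurable[OF S])
  have \<psi>2: "(\<lambda>p. (\<psi> n p)\<^sup>2) = (\<lambda>(\<omega>, z). (simple_value (S n) (fst z) (snd z) \<omega> * indicator domain z)\<^sup>2)" for n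
    by (auto simp: \<psi>_def fun_eq_iff)
  have "(\<integral>\<^sup>+\<omega>. (\<integral>\<^sup>+z\<in>domain.
               ennreal ((\<Phi> (fst z) (snd z) \<omega> - simple_value (S n) (fst z) (snd z) \<omega>)\<^sup>2) \<partial>lborel) \<partial>M) =
     (\<integral>\<^sup>+\<omega>. \<integral>\<^sup>+z. ennreal ((\<phi> (\<omega>, z) - \<psi> n (\<omega>, z))\<^sup>2) \<partial>lborel \<partial>M)" for n
    by (intro nn_integral_cong) (auto simp: \<phi>_def \<psi>_def indicator_def)
  also have "\<dots> n = (\<integral>\<^sup>+p. ennreal ((\<phi> p - \<psi> n p)\<^sup>2) \<partial>(M \<Otimes>\<^sub>M lborel))" for n
    by (rule lborel.nn_integral_fst) measurable
  finally have lim1': "(\<lambda>n. \<integral>\<^sup>+p. ennreal ((\<phi> p - \<psi> n p)\<^sup>2) \<partial>(M \<Otimes>\<^sub>M lborel)) \<longlonglongrightarrow> 0"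
    using lim1 by simp
  have i\<psi>: "integrable (M \<Otimes>\<^sub>M lborel) (\<lambda>p. (\<psi> n p)\<^sup>2)" for n
    unfolding \<psi>2 by (rule simple_value_square_integrable[OF S])
  note A = integral_square_tendsto[OF m\<phi> m\<psi> i\<psi> lim1']
  note B = integral_square_tendsto[OF _ mI simple_integral_square_integrable[OF S] lim2]
  show iJ: "integrable M (\<lambda>\<omega>. (J \<omega>)\<^sup>2)" by (rule B) simp
  have "(\<lambda>n. expectation (\<lambda>\<omega>. (simple_integral W (S n) \<omega>)\<^sup>2)) \<longlonglongrightarrow> expectation (\<lambda>\<omega>. (J \<omega>)\<^sup>2)"
    by (rule B) simp
  moreover have "(\<lambda>n. expectation (\<lambda>\<omega>. (simple_integral W (S n) \<omega>)\<^sup>2)) \<longlonglongrightarrow> (\<integral>p. (\<phi> p)\<^sup>2 \<partial>(M \<Otimes>\<^sub>M lborel))"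
    using A(2) unfolding \<psi>2 simple_isometry[OF S] .
  ultimately have eq: "expectation (\<lambda>\<omega>. (J \<omega>)\<^sup>2) = (\<integral>p. (\<phi> p)\<^sup>2 \<partial>(M \<Otimes>\<^sub>M lborel))"
    by (rule LIMSEQ_unique)
  have "(\<integral>\<^sup>+\<omega>. ennreal ((J \<omega>)\<^sup>2) \<partial>M) = ennreal (expectation (\<lambda>\<omega>. (J \<omega>)\<^sup>2))"
    using iJ by (rule nn_integral_eq_integral) simp
  also have "\<dots> = (\<integral>\<^sup>+p. ennreal ((\<phi> p)\<^sup>2) \<partial>(M \<Otimes>\<^sub>M lborel))"
    unfolding eq using A(1) by (rule nn_integral_eq_integral[symmetric]) simp
  also have "\<dots> = (\<integral>\<^sup>+\<omega>. \<integral>\<^sup>+z. ennreal ((\<phi> (\<omega>, z))\<^sup>2) \<partial>lborel \<partial>M)"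
    by (rule lborel.nn_integral_fst[symmetric]) measurable
  also have "\<dots> = (\<integral>\<^sup>+\<omega>. (\<integral>\<^sup>+z\<in>domain. ennreal ((\<Phi> (fst z) (snd z) \<omega>)\<^sup>2) \<partial>lborel) \<partial>M)"
    by (intro nn_integral_cong) (auto simp: \<phi>_def indicator_def)
  finally show "(\<integral>\<^sup>+\<omega>. ennreal ((J \<omega>)\<^sup>2) \<partial>M) = \<dots>" .
  show "expectation J = 0"
  proof -
    have iJ1: "integrable M J" by (rule integrable_of_square[OF _ iJ]) simp
    have iI1: "integrable M (simple_integral W (S n))" for n
      by (rule integrable_of_square[OF mI simple_integral_square_integrable[OF S]])
    have "ennreal ((expectation J)\<^sup>2) \<le> (\<integral>\<^sup>+\<omega>. ennreal ((J \<omega> - simple_integral W (S n) \<omega>)\<^sup>2) \<partial>M)" for n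
    proof -
      have i2: "integrable M (\<lambda>\<omega>. (J \<omega> - simple_integral W (S n) \<omega>)\<^sup>2)"
      proof -
        have "integrable M (\<lambda>\<omega>. J \<omega> * simple_integral W (S n) \<omega>)"
          by (rule integrable_mult_of_squares[OF _ mI iJ simple_integral_square_integrable[OF S]]) simp
        then show ?thesis
          using iJ simple_integral_square_integrable[OF S] by (simp add: power2_diff mult.assoc)
      qed
      have "(expectation J)\<^sup>2 = (expectation (\<lambda>\<omega>. J \<omega> - simple_integral W (S n) \<omega>))\<^sup>2"
        using iJ1 iI1 simple_integral_expectation[OF S] by simp
      also have "\<dots> \<le> expectation (\<lambda>\<omega>. (J \<omega> - simple_integral W (S n) \<omega>)\<^sup>2)"
        using variance_eq[of "\<lambda>\<omega>. J \<omega> - simple_integral W (S n) \<omega>"] iJ1 iI1 i2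
          variance_positive[of "\<lambda>\<omega>. J \<omega> - simple_integral W (S n) \<omega>"] by simp
      finally have "ennreal ((expectation J)\<^sup>2) \<le> ennreal (expectation (\<lambda>\<omega>. (J \<omega> - simple_integral W (S n) \<omega>)\<^sup>2))"
        by (rule ennreal_leI)
      also have "\<dots> = (\<integral>\<^sup>+\<omega>. ennreal ((J \<omega> - simple_integral W (S n) \<omega>)\<^sup>2) \<partial>M)"
        using i2 by (rule nn_integral_eq_integral[symmetric]) simp
      finally show ?thesis .
    qed
    then have "ennreal ((expectation J)\<^sup>2) \<le> 0"
      by (intro LIMSEQ_le_const[OF lim2]) auto
    then show ?thesis by (simp add: ennreal_eq_0_iff)
  qed
qed

end

section \<open>Second moments of the mild solution\<close>

text \<open>
  The mild solution for one fixed noise level \<open>lam\<close>. The linear bound on \<open>\<sigma>\<close> forces \<open>\<sigma> 0 = 0\<close> and turns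
  the noise term into a linear feedback of the second moment.
\<close>

locale heat_spde = walsh_noise M L W F
  for M :: "'w measure" and L :: real and W :: "(real \<times> real) set \<Rightarrow> 'w \<Rightarrow> real"
    and F :: "real \<Rightarrow> 'w measure" +
  fixes \<sigma> u0 :: "real \<Rightarrow> real" and lam L\<^sub>\<sigma> :: real and u :: "real \<Rightarrow> real \<Rightarrow> 'w \<Rightarrow> real"
  assumes L_pos: "L > 0"
    and \<sigma>_lipschitz: "\<exists>C. C-lipschitz_on UNIV \<sigma>"
    and L\<^sub>\<sigma>_pos: "L\<^sub>\<sigma> > 0"
    and \<sigma>_growth: "\<And>v. \<bar>\<sigma> v\<bar> \<le> L\<^sub>\<sigma> * \<bar>v\<bar>"
    and u0_measurable: "u0 \<in> borel_measurable (lebesgue_on {0..L})"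
    and u0_nonneg: "\<And>x. x \<in> {0..L} \<Longrightarrow> 0 \<le> u0 x"
    and u0_bounded: "bounded (u0 ` {0..L})"
    and u0_support: "emeasure lebesgue {x \<in> {0..L}. u0 x > 0} > 0"
    and lam_pos: "lam > 0"
    and mild: "mild_solution M F W L \<sigma> u0 lam u"
    and moments: "bounded_second_moments M L u"
begin

definition mean :: "real \<Rightarrow> real \<Rightarrow> real" where
  "mean t x = (LINT y:{0..L}|lebesgue. u0 y * dirichlet_heat_kernel L t x y)"

definition second_moment :: "real \<Rightarrow> real \<Rightarrow> ennreal" where
  "second_moment t x = (\<integral>\<^sup>+\<omega>. ennreal ((u t x \<omega>)\<^sup>2) \<partial>M)"

definition initial_mass :: real where
  "initial_mass = (\<integral>y. u0 y * ground_state L y \<partial>lebesgue_on {0..L})"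

text \<open>
  The cut-off to the open domain makes this measurable on the whole plane; on the domain it is the
  second moment of \<open>\<sigma> (u s y)\<close>.
\<close>

definition intensity :: "real \<times> real \<Rightarrow> ennreal" where
  "intensity z = (\<integral>\<^sup>+\<omega>. ennreal ((\<sigma> (u (fst z) (snd z) \<omega> * indicator domain z))\<^sup>2) \<partial>M)"

lemma mean_eq: "mean t x = (\<integral>y. u0 y * dirichlet_heat_kernel L t x y \<partial>lebesgue_on {0..L})"
  unfolding mean_def set_lebesgue_integral_def by (simp add: integral_restrict_space)

lemma ident_measurable_lebesgue_on: "(\<lambda>y. y) \<in> borel_measurable (lebesgue_on {0..L})"
  by (intro measurable_restrict_space1) (simp add: measurable_completion)

lemma integrable_u0_mult:
  assumes g [measurable]: "g \<in> borel_measurable borel" and C: "\<And>y. y \<in> {0..L} \<Longrightarrow> \<bar>g y\<bar> \<le> C"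
  shows "integrable (lebesgue_on {0..L}) (\<lambda>y. u0 y * g y)"
proof -
  interpret finite_measure "lebesgue_on {0..L}"
    by (rule finite_measure_lebesgue_on) (simp add: lmeasurable_interval)
  obtain B where B: "\<And>y. y \<in> {0..L} \<Longrightarrow> \<bar>u0 y\<bar> \<le> B"
    using u0_bounded unfolding bounded_iff ball_simps real_norm_def by blast
  have m: "g \<in> borel_measurable (lebesgue_on {0..L})"
    using measurable_compose[OF ident_measurable_lebesgue_on g] by simp
  show ?thesis
  proof (rule integrable_const_bound)
    have "\<bar>u0 y * g y\<bar> \<le> B * C" if "y \<in> {0..L}" for y
      using B[OF that] C[OF that] unfolding abs_mult by (intro mult_mono) linarith+
    then show "AE y in lebesgue_on {0..L}. norm (u0 y * g y) \<le> B * C"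
      by (intro AE_I2) (simp add: space_restrict_space)
  qed (intro borel_measurable_times u0_measurable m)
qed

lemma integrable_u0_kernel:
  assumes "t > 0" "x \<in> {0..L}"
  shows "integrable (lebesgue_on {0..L}) (\<lambda>y. u0 y * dirichlet_heat_kernel L t x y)"
proof -
  obtain C where C: "C > 0" "\<And>y. y \<in> {0..L} \<Longrightarrow> \<bar>dirichlet_heat_kernel L t x y\<bar>
     \<le> C * (ground_state L x * ground_state L y * exp (- decay_rate L * t))"
    using heat_kernel_upper[OF L_pos assms(1)] assms by blast
  show ?thesis
  proof (rule integrable_u0_mult)
    fix y assume y: "y \<in> {0..L}"
    have "ground_state L x * ground_state L y * exp (- decay_rate L * t) \<le> 1 * 1 * exp (- decay_rate L * t)"
      using ground_state_nonneg[OF L_pos] ground_state_le_1 y assms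
      by (intro mult_right_mono mult_mono) auto
    then have "C * (ground_state L x * ground_state L y * exp (- decay_rate L * t)) \<le> C * (1 * 1 * exp (- decay_rate L * t))"
      using C(1) by (intro mult_left_mono) auto
    with C(2)[OF y] show "\<bar>dirichlet_heat_kernel L t x y\<bar> \<le> C * (1 * 1 * exp (- decay_rate L * t))"
      by linarith
  qed measurable
qed

lemma integrable_u0_ground_state: "integrable (lebesgue_on {0..L}) (\<lambda>y. u0 y * ground_state L y)"
  by (rule integrable_u0_mult[where C=1]) (simp_all add: ground_state_def)

lemma integral_u0_mono:
  assumes "integrable (lebesgue_on {0..L}) (\<lambda>y. u0 y * f y)" "integrable (lebesgue_on {0..L}) (\<lambda>y. u0 y * g y)"
    and "\<And>y. y \<in> {0..L} \<Longrightarrow> f y \<le> g y"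
  shows "(\<integral>y. u0 y * f y \<partial>lebesgue_on {0..L}) \<le> (\<integral>y. u0 y * g y \<partial>lebesgue_on {0..L})"
  using assms u0_nonneg by (intro integral_mono) (auto simp: space_restrict_space intro!: mult_left_mono)

text \<open>
  This is where the positive support of the initial condition enters: the ground state is positive in
  the open interval, so a vanishing integral would force \<open>u0\<close> to vanish almost everywhere.
\<close>

lemma initial_mass_pos: "initial_mass > 0"
proof -
  have nn: "AE y in lebesgue_on {0..L}. 0 \<le> u0 y * ground_state L y"
    using u0_nonneg ground_state_nonneg[OF L_pos] by (intro AE_I2) (auto simp: space_restrict_space)
  have "initial_mass \<noteq> 0"
  proof
    assume "initial_mass = 0"
    then have "AE y in lebesgue_on {0..L}. u0 y * ground_state L y = 0"
      using integral_nonneg_eq_0_iff_AE[OF integrable_u0_ground_state nn] by (simp add: initial_mass_def)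
    then have "AE y in lebesgue. y \<in> {0..L} \<longrightarrow> u0 y * ground_state L y = 0"
      by (subst (asm) AE_restrict_space_iff) auto
    moreover have "AE y in lebesgue. y \<noteq> c" for c :: real
      by (rule AE_completion[OF AE_lborel_singleton])
    ultimately have "AE y in lebesgue. \<not> (y \<in> {0..L} \<and> u0 y > 0)"
    proof -
      assume 1: "AE y in lebesgue. y \<in> {0..L} \<longrightarrow> u0 y * ground_state L y = 0"
        and 2: "\<And>c::real. AE y in lebesgue. y \<noteq> c"
      from 1 2[of 0] 2[of L] show ?thesis
      proof eventually_elim
        case (elim y)
        then show ?case using ground_state_pos[OF L_pos, of y] by auto
      qed
    qed
    then have "emeasure lebesgue {y \<in> space lebesgue. y \<in> {0..L} \<and> u0 y > 0} = 0"
      by (rule emeasure_eq_0_AE)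
    then show False using u0_support by simp
  qed
  moreover have "initial_mass \<ge> 0"
    unfolding initial_mass_def using nn by (rule integral_nonneg_AE)
  ultimately show ?thesis by simp
qed

lemma abs_mean_le:
  assumes t: "t > 0" and x: "x \<in> {0..L}" and g: "integrable (lebesgue_on {0..L}) (\<lambda>y. u0 y * g y)"
    and le: "\<And>y. y \<in> {0..L} \<Longrightarrow> \<bar>dirichlet_heat_kernel L t x y\<bar> \<le> g y"
  shows "\<bar>mean t x\<bar> \<le> (\<integral>y. u0 y * g y \<partial>lebesgue_on {0..L})"
proof -
  note i = integrable_u0_kernel[OF t x]
  have ni: "integrable (lebesgue_on {0..L}) (\<lambda>y. u0 y * - dirichlet_heat_kernel L t x y)"
    using i by simp
  have "mean t x \<le> (\<integral>y. u0 y * g y \<partial>lebesgue_on {0..L})"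
    unfolding mean_eq using le by (intro integral_u0_mono i g) (auto simp: abs_le_iff)
  moreover have "- mean t x \<le> (\<integral>y. u0 y * g y \<partial>lebesgue_on {0..L})"
    using integral_u0_mono[OF ni g] le by (auto simp: mean_eq abs_le_iff)
  ultimately show ?thesis by (simp add: abs_le_iff)
qed

lemma mean_comparison:
  assumes t: "t > 0" "T0 > 0" and x: "x \<in> {0..L}"
    and K: "\<And>y. y \<in> {0..L} \<Longrightarrow> \<bar>dirichlet_heat_kernel L t x y\<bar> \<le> K * dirichlet_heat_kernel L (t + T0) (L / 2) y"
  shows "\<bar>mean t x\<bar> \<le> K * mean (t + T0) (L / 2)"
proof -
  have "integrable (lebesgue_on {0..L}) (\<lambda>y. u0 y * dirichlet_heat_kernel L (t + T0) (L / 2) y)"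
    using t L_pos by (intro integrable_u0_kernel) auto
  then have "integrable (lebesgue_on {0..L}) (\<lambda>y. u0 y * (K * dirichlet_heat_kernel L (t + T0) (L / 2) y))"
    using integrable_mult_right[of K] by (simp add: mult.left_commute)
  from abs_mean_le[OF t(1) x this K] show ?thesis
    by (simp add: mean_eq mult.left_commute)
qed

lemma mean_upper:
  assumes t: "t > 0" and x: "x \<in> {0..L}"
    and c: "\<And>y. y \<in> {0..L} \<Longrightarrow> \<bar>dirichlet_heat_kernel L t x y\<bar> \<le> c * ground_state L y"
  shows "\<bar>mean t x\<bar> \<le> c * initial_mass"
proof -
  have "integrable (lebesgue_on {0..L}) (\<lambda>y. u0 y * (c * ground_state L y))"
    using integrable_mult_right[OF integrable_u0_ground_state, of c] by (simp add: mult.left_commute)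
  from abs_mean_le[OF t x this c] show ?thesis
    by (simp add: initial_mass_def mult.left_commute)
qed

lemma mean_lower:
  assumes t: "t > 0" and x: "x \<in> {0..L}"
    and c: "\<And>y. y \<in> {0..L} \<Longrightarrow> c * ground_state L y \<le> dirichlet_heat_kernel L t x y"
  shows "c * initial_mass \<le> mean t x"
proof -
  have "integrable (lebesgue_on {0..L}) (\<lambda>y. u0 y * (c * ground_state L y))"
    using integrable_mult_right[OF integrable_u0_ground_state, of c] by (simp add: mult.left_commute)
  from integral_u0_mono[OF this integrable_u0_kernel[OF t x] c]
  show ?thesis by (simp add: mean_eq initial_mass_def mult.left_commute)
qed

lemma \<sigma>_measurable [measurable]: "\<sigma> \<in> borel_measurable borel"
  using \<sigma>_lipschitz by (auto intro!: borel_measurable_continuous_onI dest: lipschitz_on_continuous_on)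

lemma u_jointly_measurable:
  "(\<lambda>(\<omega>, z). u (fst z) (snd z) \<omega> * indicator domain z) \<in> borel_measurable (M \<Otimes>\<^sub>M borel)"
  using mild unfolding mild_solution_def by (intro predictable_measurable) simp

lemma u_measurable_space:
  assumes t: "t > 0"
  shows "(\<lambda>(\<omega>, x). u t x \<omega> * indicator {0<..<L} x) \<in> borel_measurable (M \<Otimes>\<^sub>M lborel)"
proof -
  have "(\<lambda>p. (fst p, (t, snd p))) \<in> M \<Otimes>\<^sub>M lborel \<rightarrow>\<^sub>M M \<Otimes>\<^sub>M (borel :: (real \<times> real) measure)"
    unfolding borel_prod[symmetric] by measurable
  from measurable_compose[OF this u_jointly_measurable] show ?thesis
    using t by (simp add: split_beta' indicator_times)
qed

lemma u_measurable:
  assumes "t > 0" "x \<in> {0<..<L}"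
  shows "u t x \<in> borel_measurable M"
proof -
  have "(\<lambda>\<omega>. (\<omega>, x)) \<in> M \<rightarrow>\<^sub>M M \<Otimes>\<^sub>M lborel" by measurable
  from measurable_compose[OF this u_measurable_space[OF assms(1)]] show ?thesis
    using assms(2) by simp
qed

lemma u_section_measurable:
  assumes "t > 0" "\<omega> \<in> space M"
  shows "(\<lambda>x. u t x \<omega> * indicator {0<..<L} x) \<in> borel_measurable borel"
proof -
  have "(\<lambda>x. (\<omega>, x)) \<in> borel \<rightarrow>\<^sub>M M \<Otimes>\<^sub>M lborel" using assms(2) by measurable
  from measurable_compose[OF this u_measurable_space[OF assms(1)]] show ?thesis by simp
qed

lemma second_moment_finite:
  assumes "t \<ge> 0" "x \<in> {0..L}"
  shows "second_moment t x < \<infinity>"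
proof -
  have "second_moment t x \<le> (SUP s\<in>{0..t + 1}. SUP y\<in>{0..L}. \<integral>\<^sup>+\<omega>. ennreal ((u s y \<omega>)\<^sup>2) \<partial>M)"
    unfolding second_moment_def using assms by (intro SUP_upper2[of t] SUP_upper2[of x]) auto
  also have "\<dots> < \<infinity>"
    using moments assms(1) unfolding bounded_second_moments_def by (metis add_nonneg_pos zero_less_one)
  finally show ?thesis .
qed

lemma expectation_eq_second_moment:
  assumes "t > 0" "x \<in> {0<..<L}"
  shows "expectation (\<lambda>\<omega>. \<bar>u t x \<omega>\<bar>\<^sup>2) = enn2real (second_moment t x)"
  using u_measurable[OF assms] unfolding second_moment_def
  by (subst integral_eq_nn_integral) auto

lemma second_moment_measurable:
  assumes t: "t > 0"
  shows "(\<lambda>x. second_moment t x * indicator {0<..<L} x) \<in> borel_measurable borel"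
proof -
  note [measurable] = u_measurable_space[OF t]
  have "(\<lambda>p. ennreal (((\<lambda>(\<omega>, x). u t x \<omega> * indicator {0<..<L} x) p)\<^sup>2)) \<in> borel_measurable (M \<Otimes>\<^sub>M lborel)"
    by measurable
  from borel_measurable_nn_integral[OF measurable_pair_swap[OF this]]
  have "(\<lambda>x. \<integral>\<^sup>+\<omega>. ennreal ((u t x \<omega> * indicator {0<..<L} x)\<^sup>2) \<partial>M) \<in> borel_measurable borel"
    by simp
  moreover have "(\<integral>\<^sup>+\<omega>. ennreal ((u t x \<omega> * indicator {0<..<L} x)\<^sup>2) \<partial>M) = second_moment t x * indicator {0<..<L} x" for x
    by (simp add: second_moment_def indicator_def)
  ultimately show ?thesis by simp
qed

text \<open>
  The energy is defined by Bochner integrals, which vanish on functions that are not integrable.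
  Finiteness of the double integral excludes this for almost every \<open>\<omega>\<close>.
\<close>

lemma energy_eq:
  assumes t: "t > 0" and fin: "(\<integral>\<^sup>+x\<in>{0<..<L}. second_moment t x \<partial>lborel) < \<infinity>"
  shows "energy M L u t = sqrt (enn2real (\<integral>\<^sup>+x\<in>{0<..<L}. second_moment t x \<partial>lborel))"
proof -
  interpret P: pair_sigma_finite M "lborel :: real measure" ..
  define f where "f = (\<lambda>(\<omega>, x). u t x \<omega> * indicator {0<..<L} x)"
  have f [measurable]: "f \<in> borel_measurable (M \<Otimes>\<^sub>M lborel)"
    unfolding f_def by (rule u_measurable_space[OF t])
  define I where "I \<omega> = (\<integral>\<^sup>+x. ennreal ((f (\<omega>, x))\<^sup>2) \<partial>lborel)" for \<omega>
  have I_meas [measurable]: "I \<in> borel_measurable M" unfolding I_def by measurable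
  have "(\<integral>\<^sup>+\<omega>. I \<omega> \<partial>M) = (\<integral>\<^sup>+x. \<integral>\<^sup>+\<omega>. ennreal ((f (\<omega>, x))\<^sup>2) \<partial>M \<partial>lborel)"
    unfolding I_def using P.Fubini[of "\<lambda>p. ennreal ((f p)\<^sup>2)"] by simp
  also have "\<dots> = (\<integral>\<^sup>+x\<in>{0<..<L}. second_moment t x \<partial>lborel)"
    by (intro nn_integral_cong) (simp add: f_def second_moment_def indicator_def)
  finally have eqI: "(\<integral>\<^sup>+\<omega>. I \<omega> \<partial>M) = (\<integral>\<^sup>+x\<in>{0<..<L}. second_moment t x \<partial>lborel)" .
  have l2: "(l2_norm L (\<lambda>x. u t x \<omega>))\<^sup>2 = enn2real (I \<omega>)" if \<omega>: "\<omega> \<in> space M" for \<omega>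
  proof -
    have "(LINT x:{0<..<L}|lborel. (u t x \<omega>)\<^sup>2) = (\<integral>x. (u t x \<omega> * indicator {0<..<L} x)\<^sup>2 \<partial>lborel)"
      unfolding set_lebesgue_integral_def by (intro Bochner_Integration.integral_cong) (auto simp: indicator_def)
    also have "\<dots> = enn2real (I \<omega>)"
      using u_section_measurable[OF t \<omega>] unfolding I_def f_def
      by (subst integral_eq_nn_integral) auto
    finally show ?thesis by (simp add: l2_norm_def)
  qed
  have "expectation (\<lambda>\<omega>. (l2_norm L (\<lambda>x. u t x \<omega>))\<^sup>2) = expectation (\<lambda>\<omega>. enn2real (I \<omega>))"
    by (intro Bochner_Integration.integral_cong refl l2)
  also have "\<dots> = enn2real (\<integral>\<^sup>+\<omega>. ennreal (enn2real (I \<omega>)) \<partial>M)"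
    by (rule integral_eq_nn_integral) auto
  also have "(\<integral>\<^sup>+\<omega>. ennreal (enn2real (I \<omega>)) \<partial>M) = (\<integral>\<^sup>+\<omega>. I \<omega> \<partial>M)"
  proof (rule nn_integral_cong_AE)
    have "AE \<omega> in M. I \<omega> \<noteq> \<infinity>"
      using fin unfolding eqI[symmetric] by (intro nn_integral_PInf_AE) auto
    then show "AE \<omega> in M. ennreal (enn2real (I \<omega>)) = I \<omega>"
      by eventually_elim (simp add: less_top)
  qed
  finally show ?thesis unfolding energy_def eqI by simp
qed

lemma intensity_measurable [measurable]: "intensity \<in> borel_measurable borel"
proof -
  have "(\<lambda>(\<omega>, z). u (fst z) (snd z) \<omega> * indicator domain z) \<in> borel_measurable (M \<Otimes>\<^sub>M lborel)"
    using u_jointly_measurable measurable_cong_sets[OF sets_pair_measure_cong[OF refl sets_lborel] refl] by blast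
  then have "(\<lambda>p. ennreal ((\<sigma> ((\<lambda>(\<omega>, z). u (fst z) (snd z) \<omega> * indicator domain z) p))\<^sup>2)) \<in> borel_measurable (M \<Otimes>\<^sub>M lborel)"
    by measurable
  from borel_measurable_nn_integral[OF measurable_pair_swap[OF this]] show ?thesis
    by (simp add: intensity_def[abs_def])
qed

lemma intensity_le:
  assumes "z \<in> domain"
  shows "intensity z \<le> ennreal (L\<^sub>\<sigma>\<^sup>2) * second_moment (fst z) (snd z)"
proof -
  have u: "u (fst z) (snd z) \<in> borel_measurable M"
    using assms by (intro u_measurable) auto
  have "intensity z \<le> (\<integral>\<^sup>+\<omega>. ennreal (L\<^sub>\<sigma>\<^sup>2) * ennreal ((u (fst z) (snd z) \<omega>)\<^sup>2) \<partial>M)"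
    unfolding intensity_def
  proof (rule nn_integral_mono)
    fix \<omega>
    have "(\<sigma> (u (fst z) (snd z) \<omega>))\<^sup>2 \<le> L\<^sub>\<sigma>\<^sup>2 * (u (fst z) (snd z) \<omega>)\<^sup>2"
      using power_mono[OF \<sigma>_growth[of "u (fst z) (snd z) \<omega>"] abs_ge_zero, of 2]
      by (simp add: power_mult_distrib)
    then show "ennreal ((\<sigma> (u (fst z) (snd z) \<omega> * indicator domain z))\<^sup>2) \<le> ennreal (L\<^sub>\<sigma>\<^sup>2) * ennreal ((u (fst z) (snd z) \<omega>)\<^sup>2)"
      using assms by (simp add: ennreal_mult'[symmetric] ennreal_leI)
  qed
  also have "\<dots> = ennreal (L\<^sub>\<sigma>\<^sup>2) * second_moment (fst z) (snd z)"
    using u unfolding second_moment_def by (intro nn_integral_cmult) measurable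
  finally show ?thesis .
qed

text \<open>
  The cross term between the deterministic and the stochastic part vanishes because Walsh integrals
  have mean zero; the square of the stochastic part is computed by the isometry and Tonelli's theorem.
\<close>

theorem second_moment_identity:
  assumes t: "t > 0" and x: "x \<in> {0..L}"
  shows "second_moment t x = ennreal ((mean t x)\<^sup>2) + ennreal (lam\<^sup>2) *
    (\<integral>\<^sup>+z\<in>{0<..<t}\<times>{0<..<L}. ennreal ((dirichlet_heat_kernel L (t - fst z) x (snd z))\<^sup>2) * intensity z \<partial>lborel)"
proof -
  interpret P: pair_sigma_finite M "lborel :: (real \<times> real) measure" ..
  let ?p = "\<lambda>s y. dirichlet_heat_kernel L (t - s) x y"
  let ?\<Phi> = "\<lambda>s y \<omega>. if 0 < s \<and> s < t then ?p s y * \<sigma> (u s y \<omega>) else 0"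
  let ?A = "{0<..<t}\<times>{0<..<L}"
  obtain J where J: "has_walsh_integral M F W L ?\<Phi> J"
    and u: "AE \<omega> in M. u t x \<omega> = mean t x + lam * J \<omega>"
    using mild t x unfolding mild_solution_def mean_def by blast
  have [measurable]: "J \<in> borel_measurable M" using J by (simp add: has_walsh_integral_def)
  note iso = walsh_isometry[OF J]
  have iJ: "integrable M J" by (rule integrable_of_square[OF _ iso(1)]) simp
  have i2: "integrable M (\<lambda>\<omega>. (mean t x + lam * J \<omega>)\<^sup>2)"
    using iJ iso(1) by (simp add: power2_sum power_mult_distrib mult.assoc)
  have "second_moment t x = (\<integral>\<^sup>+\<omega>. ennreal ((mean t x + lam * J \<omega>)\<^sup>2) \<partial>M)"
    unfolding second_moment_def by (rule nn_integral_cong_AE) (use u in eventually_elim, simp)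
  also have "\<dots> = ennreal (expectation (\<lambda>\<omega>. (mean t x + lam * J \<omega>)\<^sup>2))"
    by (rule nn_integral_eq_integral[OF i2]) simp
  also have "expectation (\<lambda>\<omega>. (mean t x + lam * J \<omega>)\<^sup>2) = (mean t x)\<^sup>2 + lam\<^sup>2 * expectation (\<lambda>\<omega>. (J \<omega>)\<^sup>2)"
    using iJ iso(1,2) by (simp add: power2_sum power_mult_distrib mult.assoc prob_space)
  also have "ennreal \<dots> = ennreal ((mean t x)\<^sup>2) + ennreal (lam\<^sup>2) * ennreal (expectation (\<lambda>\<omega>. (J \<omega>)\<^sup>2))"
    by (simp add: ennreal_plus ennreal_mult)
  also have "ennreal (expectation (\<lambda>\<omega>. (J \<omega>)\<^sup>2)) = (\<integral>\<^sup>+\<omega>. ennreal ((J \<omega>)\<^sup>2) \<partial>M)"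
    by (rule nn_integral_eq_integral[OF iso(1), symmetric]) simp
  also have "\<dots> = (\<integral>\<^sup>+\<omega>. (\<integral>\<^sup>+z\<in>domain. ennreal ((?\<Phi> (fst z) (snd z) \<omega>)\<^sup>2) \<partial>lborel) \<partial>M)"
    by (rule iso(3))
  also have "\<dots> = (\<integral>\<^sup>+z\<in>?A. ennreal ((?p (fst z) (snd z))\<^sup>2) * intensity z \<partial>lborel)"
  proof -
    define U where "U = (\<lambda>(\<omega>, z). u (fst z) (snd z) \<omega> * indicator domain z)"
    have U [measurable]: "U \<in> borel_measurable (M \<Otimes>\<^sub>M lborel)"
      using u_jointly_measurable measurable_cong_sets[OF sets_pair_measure_cong[OF refl sets_lborel] refl]
      unfolding U_def by blast
    have A [measurable]: "?A \<in> sets borel" by (intro borel_open open_Times) auto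
    define k where "k z = ennreal ((?p (fst z) (snd z))\<^sup>2) * indicator ?A z" for z
    have [measurable]: "fst \<in> borel_measurable (borel :: (real \<times> real) measure)"
      "snd \<in> borel_measurable (borel :: (real \<times> real) measure)"
      by (auto intro!: borel_measurable_continuous_onI continuous_intros)
    have k [measurable]: "k \<in> borel_measurable lborel" unfolding k_def by measurable
    have \<sigma>0: "\<sigma> 0 = 0" using \<sigma>_growth[of 0] by simp
    have "(\<integral>\<^sup>+\<omega>. (\<integral>\<^sup>+z\<in>domain. ennreal ((?\<Phi> (fst z) (snd z) \<omega>)\<^sup>2) \<partial>lborel) \<partial>M)
        = (\<integral>\<^sup>+\<omega>. \<integral>\<^sup>+z. k z * ennreal ((\<sigma> (U (\<omega>, z)))\<^sup>2) \<partial>lborel \<partial>M)"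
      by (intro nn_integral_cong)
        (auto simp: k_def U_def indicator_def power_mult_distrib ennreal_mult \<sigma>0)
    also have "\<dots> = (\<integral>\<^sup>+z. \<integral>\<^sup>+\<omega>. k z * ennreal ((\<sigma> (U (\<omega>, z)))\<^sup>2) \<partial>M \<partial>lborel)"
      using P.Fubini[of "\<lambda>p. k (snd p) * ennreal ((\<sigma> (U p))\<^sup>2)"] by simp
    also have "\<dots> = (\<integral>\<^sup>+z. k z * intensity z \<partial>lborel)"
    proof (rule nn_integral_cong)
      fix z :: "real \<times> real"
      have "(\<lambda>\<omega>. (\<omega>, z)) \<in> M \<rightarrow>\<^sub>M M \<Otimes>\<^sub>M lborel" by measurable
      from measurable_compose[OF this U] have "(\<lambda>\<omega>. U (\<omega>, z)) \<in> borel_measurable M" .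
      then have "(\<integral>\<^sup>+\<omega>. k z * ennreal ((\<sigma> (U (\<omega>, z)))\<^sup>2) \<partial>M) = k z * (\<integral>\<^sup>+\<omega>. ennreal ((\<sigma> (U (\<omega>, z)))\<^sup>2) \<partial>M)"
        by (intro nn_integral_cmult) measurable
      then show "(\<integral>\<^sup>+\<omega>. k z * ennreal ((\<sigma> (U (\<omega>, z)))\<^sup>2) \<partial>M) = k z * intensity z"
        by (simp add: intensity_def U_def)
    qed
    finally show ?thesis by (simp add: k_def mult_ac)
  qed
  finally show ?thesis .
qed

end

section \<open>Absorption and exponential rates\<close>

text \<open>
  If the running supremum \<open>S\<close> satisfies \<open>S T \<le> S \<tau> + C + S T / 2\<close>, then \<open>S T \<le> 2 * (S \<tau> + C)\<close>. A priori
  finiteness of \<open>S T\<close> is what allows the subtraction.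
\<close>

lemma absorb_small_feedback:
  fixes w :: "real \<Rightarrow> 'x \<Rightarrow> ennreal"
  assumes fin: "\<And>T. 0 \<le> T \<Longrightarrow> (SUP t\<in>{0..T}. SUP x\<in>X. w t x) < \<infinity>"
    and \<tau>: "0 \<le> \<tau>"
    and step: "\<And>t x. \<tau> \<le> t \<Longrightarrow> x \<in> X \<Longrightarrow>
       w t x \<le> C + ennreal (1 / 2) * (SUP s\<in>{0..t}. SUP y\<in>X. w s y)"
    and C: "C < \<infinity>"
  shows "\<exists>B<\<infinity>. \<forall>t\<ge>0. \<forall>x\<in>X. w t x \<le> B"
proof -
  define S where "S T = (SUP t\<in>{0..T}. SUP x\<in>X. w t x)" for T
  have S_mono: "S a \<le> S b" if "a \<le> b" for a b
    unfolding S_def using that by (intro SUP_subset_mono) auto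
  have w_le: "w t x \<le> S T" if "0 \<le> t" "t \<le> T" "x \<in> X" for t x T
    unfolding S_def using that by (intro SUP_upper2[of t] SUP_upper2[of x]) auto
  have S_bound: "S T \<le> 2 * (S \<tau> + C)" if T: "0 \<le> T" for T
  proof -
    have "S T \<le> (S \<tau> + C) + ennreal (1 / 2) * S T"
      unfolding S_def[of T]
    proof (intro SUP_least)
      fix t x assume t: "t \<in> {0..T}" and x: "x \<in> X"
      show "w t x \<le> (S \<tau> + C) + ennreal (1 / 2) * (SUP t\<in>{0..T}. SUP x\<in>X. w t x)"
      proof (cases "\<tau> \<le> t")
        case True
        have "w t x \<le> C + ennreal (1 / 2) * S t" using step[OF True x] by (simp add: S_def)
        also have "\<dots> \<le> (S \<tau> + C) + ennreal (1 / 2) * S T"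
          using S_mono[of t T] t by (intro add_mono mult_left_mono) auto
        finally show ?thesis by (simp add: S_def)
      next
        case False
        then have "w t x \<le> S \<tau>" using t x by (intro w_le) auto
        then show ?thesis by (simp add: add_increasing2 add.assoc)
      qed
    qed
    moreover have "S T < \<infinity>" "S \<tau> + C < \<infinity>"
      using fin[OF T] fin[OF \<tau>] C unfolding S_def[symmetric] by (auto simp: less_top[symmetric])
    then obtain s c where s: "S T = ennreal s" "s \<ge> 0" and c: "S \<tau> + C = ennreal c" "c \<ge> 0"
      by (cases "S T"; cases "S \<tau> + C") auto
    moreover have "ennreal (c + 1 / 2 * s) = ennreal c + ennreal (1 / 2) * ennreal s"
    proof -
      have "ennreal (c + 1 / 2 * s) = ennreal c + ennreal (1 / 2 * s)"
        using s(2) c(2) by (intro ennreal_plus) auto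
      also have "ennreal (1 / 2 * s) = ennreal (1 / 2) * ennreal s"
        using s(2) by (intro ennreal_mult) auto
      finally show ?thesis .
    qed
    ultimately have "ennreal s \<le> ennreal (c + 1 / 2 * s)"
      by (simp only: s c)
    then have "s \<le> c + 1 / 2 * s" using s c by (subst (asm) ennreal_le_iff) auto
    then have "ennreal s \<le> ennreal (2 * c)" by (intro ennreal_leI) simp
    then show ?thesis using s c by (simp add: ennreal_mult)
  qed
  show ?thesis
  proof (intro exI[of _ "2 * (S \<tau> + C)"] conjI allI impI ballI)
    show "2 * (S \<tau> + C) < \<infinity>"
      using fin[OF \<tau>] C by (simp add: S_def ennreal_mult_less_top)
    fix t :: real and x assume "0 \<le> t" "x \<in> X"
    then show "w t x \<le> 2 * (S \<tau> + C)"
      using w_le[of t t x] S_bound[of t] by (auto intro: order_trans)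
  qed
qed

text \<open>
  Positivity of \<open>f\<close> matters because of the convention \<open>ln 0 = 0\<close>.
\<close>

lemma upper_rate_le:
  assumes c: "c > 0" and f: "\<forall>\<^sub>F t in at_top. 0 < f t \<and> f t \<le> c * exp (r * t)"
  shows "upper_rate f \<le> ereal r"
proof -
  have lim: "((\<lambda>t. ereal (ln c / t + r)) \<longlongrightarrow> ereal r) at_top"
    by (intro tendsto_ereal) real_asymp
  have "upper_rate f \<le> Limsup at_top (\<lambda>t. ereal (ln c / t + r))"
    unfolding upper_rate_def
  proof (rule Limsup_mono)
    show "\<forall>\<^sub>F t in at_top. ereal (1 / t * ln (f t)) \<le> ereal (ln c / t + r)"
      using f eventually_gt_at_top[of 0]
    proof eventually_elim
      case (elim t)
      then have "ln (f t) \<le> ln (c * exp (r * t))" using c by (subst ln_le_cancel_iff) auto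
      also have "\<dots> = ln c + r * t" using c by (simp add: ln_mult)
      finally have "1 / t * ln (f t) \<le> 1 / t * (ln c + r * t)" using elim by (intro mult_left_mono) auto
      also have "\<dots> = ln c / t + r" using elim by (simp add: field_simps)
      finally show ?case by simp
    qed
  qed
  also have "\<dots> = ereal r" using lim by (intro lim_imp_Limsup) auto
  finally show ?thesis .
qed

lemma lower_rate_ge:
  assumes c: "c > 0" and f: "\<forall>\<^sub>F t in at_top. c * exp (r * t) \<le> f t"
  shows "ereal r \<le> lower_rate f"
proof -
  have lim: "((\<lambda>t. ereal (ln c / t + r)) \<longlongrightarrow> ereal r) at_top"
    by (intro tendsto_ereal) real_asymp
  have "ereal r = Liminf at_top (\<lambda>t. ereal (ln c / t + r))"
    using lim by (intro lim_imp_Liminf[symmetric]) auto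
  also have "\<dots> \<le> lower_rate f"
    unfolding lower_rate_def
  proof (rule Liminf_mono)
    show "\<forall>\<^sub>F t in at_top. ereal (ln c / t + r) \<le> ereal (1 / t * ln (f t))"
      using f eventually_gt_at_top[of 0]
    proof eventually_elim
      case (elim t)
      have pos: "0 < c * exp (r * t)" using c by simp
      have "ln c / t + r = 1 / t * (ln c + r * t)" using elim by (simp add: field_simps)
      also have "ln c + r * t = ln (c * exp (r * t))" using c by (simp add: ln_mult)
      also have "1 / t * \<dots> \<le> 1 / t * ln (f t)"
        using elim pos by (intro mult_left_mono) (auto intro: ln_mono)
      finally show ?case by simp
    qed
  qed
  finally show ?thesis .
qed

lemma lower_rate_le_upper_rate: "lower_rate f \<le> upper_rate f"
  unfolding lower_rate_def upper_rate_def by (rule Liminf_le_Limsup) simp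

lemma upper_rate_negD:
  assumes "upper_rate f < 0" "\<And>t. f t \<ge> 0"
  shows "\<exists>a>0. \<forall>\<^sub>F t in at_top. f t \<le> exp (- a * t)"
proof -
  obtain r where r: "upper_rate f < ereal r" "ereal r < 0"
    using ereal_dense2[OF assms(1)] by blast
  from r(1) have "\<forall>\<^sub>F t in at_top. ereal (1 / t * ln (f t)) < ereal r"
    unfolding upper_rate_def by (rule Limsup_lessD)
  then have "\<forall>\<^sub>F t in at_top. f t \<le> exp (- (- r) * t)"
    using eventually_gt_at_top[of 0]
  proof eventually_elim
    case (elim t)
    then have "ln (f t) < r * t" by (simp add: field_simps)
    then show ?case
    proof (cases "f t = 0")
      case False
      with assms(2)[of t] have "f t = exp (ln (f t))" by simp
      also have "\<dots> \<le> exp (- (- r) * t)" using \<open>ln (f t) < r * t\<close> by simp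
      finally show ?thesis .
    qed simp
  qed
  then show ?thesis using r(2) by (intro exI[of _ "- r"]) simp
qed

lemma lower_rate_posD:
  assumes "0 < lower_rate f" "\<And>t. f t \<ge> 0"
  shows "\<exists>a>0. \<forall>\<^sub>F t in at_top. exp (a * t) \<le> f t"
proof -
  obtain r where r: "ereal r < lower_rate f" "0 < ereal r"
    using ereal_dense2[OF assms(1)] by blast
  from r(1) have "\<forall>\<^sub>F t in at_top. ereal r < ereal (1 / t * ln (f t))"
    unfolding lower_rate_def by (rule less_LiminfD)
  then have "\<forall>\<^sub>F t in at_top. exp (r * t) \<le> f t"
    using eventually_gt_at_top[of 0]
  proof eventually_elim
    case (elim t)
    then have ln: "r * t < ln (f t)" by (simp add: field_simps)
    moreover have "0 < r * t" using r(2) elim by simp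
    ultimately have "f t \<noteq> 0" by auto
    with assms(2)[of t] have "f t = exp (ln (f t))" by simp
    moreover have "exp (r * t) \<le> exp (ln (f t))" using ln by simp
    ultimately show ?case by simp
  qed
  then show ?thesis using r(2) by (intro exI[of _ r]) simp
qed

context heat_spde
begin

abbreviation cylinder :: "real \<Rightarrow> (real \<times> real) set" where
  "cylinder t \<equiv> {0<..<t} \<times> {0<..<L}"

abbreviation noise_density :: "real \<Rightarrow> real \<Rightarrow> real \<times> real \<Rightarrow> ennreal" where
  "noise_density t x z \<equiv> ennreal ((dirichlet_heat_kernel L (t - fst z) x (snd z))\<^sup>2) * intensity z"

lemma fst_snd_measurable [measurable]:
  "fst \<in> borel_measurable (borel :: (real \<times> real) measure)"
  "snd \<in> borel_measurable (borel :: (real \<times> real) measure)"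
  by (auto intro!: borel_measurable_continuous_onI continuous_intros)

lemma cylinder_sets [measurable]: "cylinder t \<in> sets borel"
  by (intro borel_open open_Times) auto

text \<open>
  The running supremum over time and space of the second moment, weighted by an exponential in time
  whose sign depends on whether decay or growth is to be shown.
\<close>

definition sup_moment :: "real \<Rightarrow> real \<Rightarrow> ennreal" where
  "sup_moment \<gamma> T = (SUP t\<in>{0..T}. SUP x\<in>{0..L}. ennreal (exp (\<gamma> * t)) * second_moment t x)"

lemma sup_moment_upper:
  assumes "0 \<le> t" "t \<le> T" "x \<in> {0..L}"
  shows "ennreal (exp (\<gamma> * t)) * second_moment t x \<le> sup_moment \<gamma> T"
  unfolding sup_moment_def using assms by (intro SUP_upper2[of t] SUP_upper2[of x]) auto

lemma sup_moment_finite: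
  assumes T: "0 \<le> T"
  shows "sup_moment \<gamma> T < \<infinity>"
proof -
  define B where "B = (SUP t\<in>{0..T + 1}. SUP x\<in>{0..L}. second_moment t x)"
  have B: "B < \<infinity>"
    using moments T unfolding bounded_second_moments_def B_def second_moment_def
    by (metis add_nonneg_pos zero_less_one)
  have "sup_moment \<gamma> T \<le> ennreal (exp (\<bar>\<gamma>\<bar> * T)) * B"
    unfolding sup_moment_def
  proof (intro SUP_least)
    fix t x assume t: "t \<in> {0..T}" and x: "x \<in> {0..L}"
    have "\<gamma> * t \<le> \<bar>\<gamma>\<bar> * T" using t by (intro mult_mono) auto
    moreover have "second_moment t x \<le> B"
      unfolding B_def using t x by (intro SUP_upper2[of t] SUP_upper2[of x]) auto
    ultimately show "ennreal (exp (\<gamma> * t)) * second_moment t x \<le> ennreal (exp (\<bar>\<gamma>\<bar> * T)) * B"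
      by (intro mult_mono ennreal_leI) auto
  qed
  also have "\<dots> < \<infinity>" using B by (simp add: ennreal_mult_less_top)
  finally show ?thesis .
qed

text \<open>
  The weight \<open>exp (\<gamma> * t)\<close> is split into \<open>exp (\<gamma> * (t - s))\<close>, which goes to the kernel, and
  \<open>exp (\<gamma> * s)\<close>, which goes to the second moment. The region \<open>A\<close> is the recent past for the decay
  estimate and the entire past for the growth estimate.
\<close>

lemma weighted_noise_bound:
  assumes t: "t > 0" and x: "x \<in> {0..L}" and c: "c \<ge> 0" and \<eta>: "\<eta> \<ge> 0"
    and A: "A \<subseteq> cylinder t" and A_sets [measurable]: "A \<in> sets borel"
    and \<beta>: "(\<integral>\<^sup>+z\<in>domain. ennreal (exp (- \<beta> * fst z) * (dirichlet_heat_kernel L (fst z) x (snd z))\<^sup>2) \<partial>lborel) \<le> ennreal \<eta>"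
    and weight: "\<And>z. z \<in> A \<Longrightarrow> exp (\<gamma> * (t - fst z)) \<le> c * exp (- \<beta> * (t - fst z))"
  shows "ennreal (exp (\<gamma> * t)) * (\<integral>\<^sup>+z\<in>A. noise_density t x z \<partial>lborel)
     \<le> ennreal (c * L\<^sub>\<sigma>\<^sup>2 * \<eta>) * sup_moment \<gamma> t"
proof -
  let ?S = "sup_moment \<gamma> t"
  let ?k = "\<lambda>z. exp (- \<beta> * fst z) * (dirichlet_heat_kernel L (fst z) x (snd z))\<^sup>2"
  have "ennreal (exp (\<gamma> * t)) * (\<integral>\<^sup>+z\<in>A. noise_density t x z \<partial>lborel)
      = (\<integral>\<^sup>+z. ennreal (exp (\<gamma> * t)) * (noise_density t x z * indicator A z) \<partial>lborel)"
    by (rule nn_integral_cmult[symmetric]) measurable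
  also have "\<dots> \<le> (\<integral>\<^sup>+z. (ennreal (c * L\<^sub>\<sigma>\<^sup>2) * ?S) * (ennreal (?k (t - fst z, snd z)) * indicator (cylinder t) z) \<partial>lborel)"
  proof (rule nn_integral_mono)
    fix z :: "real \<times> real"
    show "ennreal (exp (\<gamma> * t)) * (noise_density t x z * indicator A z)
       \<le> (ennreal (c * L\<^sub>\<sigma>\<^sup>2) * ?S) * (ennreal (?k (t - fst z, snd z)) * indicator (cylinder t) z)"
    proof (cases "z \<in> A")
      case True
      then have z: "z \<in> cylinder t" using A by blast
      let ?p = "(dirichlet_heat_kernel L (t - fst z) x (snd z))\<^sup>2"
      let ?s = "fst z"
      have "exp (\<gamma> * t) = exp (\<gamma> * (t - ?s)) * exp (\<gamma> * ?s)"
        unfolding exp_add[symmetric] by (simp add: algebra_simps)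
      then have "ennreal (exp (\<gamma> * t)) * noise_density t x z =
          ennreal (exp (\<gamma> * (t - ?s))) * ennreal ?p * (ennreal (exp (\<gamma> * ?s)) * intensity z)"
        by (simp add: ennreal_mult mult_ac)
      also have "\<dots> \<le> ennreal (c * exp (- \<beta> * (t - ?s))) * ennreal ?p * (ennreal (L\<^sub>\<sigma>\<^sup>2) * ?S)"
      proof -
        have "ennreal (exp (\<gamma> * ?s)) * intensity z \<le> ennreal (exp (\<gamma> * ?s)) * (ennreal (L\<^sub>\<sigma>\<^sup>2) * second_moment ?s (snd z))"
          using z by (intro mult_left_mono intensity_le) auto
        also have "\<dots> = ennreal (L\<^sub>\<sigma>\<^sup>2) * (ennreal (exp (\<gamma> * ?s)) * second_moment ?s (snd z))"
          by (simp add: mult_ac)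
        also have "\<dots> \<le> ennreal (L\<^sub>\<sigma>\<^sup>2) * ?S"
          using z by (intro mult_left_mono sup_moment_upper) auto
        finally have 1: "ennreal (exp (\<gamma> * ?s)) * intensity z \<le> ennreal (L\<^sub>\<sigma>\<^sup>2) * ?S" .
        have 2: "ennreal (exp (\<gamma> * (t - ?s))) * ennreal ?p \<le> ennreal (c * exp (- \<beta> * (t - ?s))) * ennreal ?p"
          by (intro mult_right_mono ennreal_leI weight True) simp
        show ?thesis by (rule mult_mono[OF 2 1]) simp_all
      qed
      also have "\<dots> = (ennreal (c * L\<^sub>\<sigma>\<^sup>2) * ?S) * ennreal (?k (t - fst z, snd z))"
        using c by (simp add: ennreal_mult mult_ac)
      finally show ?thesis using z True by simp
    qed simp
  qed
  also have "\<dots> = (ennreal (c * L\<^sub>\<sigma>\<^sup>2) * ?S) * (\<integral>\<^sup>+z\<in>cylinder t. ennreal (?k (t - fst z, snd z)) \<partial>lborel)"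
    by (rule nn_integral_cmult) measurable
  also have "(\<integral>\<^sup>+z\<in>cylinder t. ennreal (?k (t - fst z, snd z)) \<partial>lborel) = (\<integral>\<^sup>+z\<in>cylinder t. ennreal (?k z) \<partial>lborel)"
    by (rule nn_integral_time_reversal) measurable
  also have "\<dots> \<le> (\<integral>\<^sup>+z\<in>domain. ennreal (?k z) \<partial>lborel)"
    by (intro nn_integral_mono) (auto simp: indicator_def)
  also have "\<dots> \<le> ennreal \<eta>" by (rule \<beta>)
  finally have "ennreal (exp (\<gamma> * t)) * (\<integral>\<^sup>+z\<in>A. noise_density t x z \<partial>lborel)
     \<le> (ennreal (c * L\<^sub>\<sigma>\<^sup>2) * ?S) * ennreal \<eta>"
    by (simp add: mult_left_mono)
  also have "\<dots> = ennreal (c * L\<^sub>\<sigma>\<^sup>2 * \<eta>) * ?S"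
    using c \<eta> by (simp add: ennreal_mult mult_ac)
  finally show ?thesis .
qed

end

section \<open>Decay and growth of the energy\<close>

context heat_spde
begin

text \<open>
  The past up to time \<open>t - \<delta>\<close> is also part of the past of \<open>t + T0\<close>, with a kernel at the midpoint that
  dominates the one at \<open>x\<close>. So everything that happened before \<open>t - \<delta>\<close>, the initial condition included, is
  bounded by the second moment at a single space point at a later time.
\<close>

lemma far_past_bound:
  assumes \<delta>: "\<delta> > 0" and T0: "T0 > 0" and t: "\<delta> \<le> t" and x: "x \<in> {0..L}" and K: "K > 0"
    and cmp: "\<And>s y. \<delta> \<le> s \<Longrightarrow> y \<in> {0..L} \<Longrightarrow>
       \<bar>dirichlet_heat_kernel L s x y\<bar> \<le> K * dirichlet_heat_kernel L (s + T0) (L / 2) y"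
  shows "ennreal ((mean t x)\<^sup>2) + ennreal (lam\<^sup>2) *
       (\<integral>\<^sup>+z\<in>{z \<in> cylinder t. \<delta> \<le> t - fst z}. noise_density t x z \<partial>lborel)
     \<le> ennreal (K\<^sup>2) * second_moment (t + T0) (L / 2)"
proof -
  let ?x0 = "L / 2"
  have "\<bar>mean t x\<bar> \<le> K * mean (t + T0) ?x0"
    using t \<delta> by (intro mean_comparison T0 x cmp) auto
  then have "\<bar>mean t x\<bar>\<^sup>2 \<le> (K * mean (t + T0) ?x0)\<^sup>2" by (rule power_mono) simp
  then have m: "ennreal ((mean t x)\<^sup>2) \<le> ennreal (K\<^sup>2) * ennreal ((mean (t + T0) ?x0)\<^sup>2)"
    by (simp add: power_mult_distrib ennreal_mult[symmetric] ennreal_leI)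
  have "(\<integral>\<^sup>+z\<in>{z \<in> cylinder t. \<delta> \<le> t - fst z}. noise_density t x z \<partial>lborel)
      \<le> (\<integral>\<^sup>+z. ennreal (K\<^sup>2) * (noise_density (t + T0) ?x0 z * indicator (cylinder (t + T0)) z) \<partial>lborel)"
  proof (rule nn_integral_mono)
    fix z :: "real \<times> real"
    show "noise_density t x z * indicator {z \<in> cylinder t. \<delta> \<le> t - fst z} z
      \<le> ennreal (K\<^sup>2) * (noise_density (t + T0) ?x0 z * indicator (cylinder (t + T0)) z)"
    proof (cases "z \<in> cylinder t \<and> \<delta> \<le> t - fst z")
      case True
      then have "\<bar>dirichlet_heat_kernel L (t - fst z) x (snd z)\<bar>
          \<le> K * dirichlet_heat_kernel L (t + T0 - fst z) ?x0 (snd z)"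
        using cmp[of "t - fst z" "snd z"] by (auto simp: algebra_simps)
      from power_mono[OF this abs_ge_zero, of 2]
      have "ennreal ((dirichlet_heat_kernel L (t - fst z) x (snd z))\<^sup>2)
         \<le> ennreal (K\<^sup>2) * ennreal ((dirichlet_heat_kernel L (t + T0 - fst z) ?x0 (snd z))\<^sup>2)"
        by (simp add: power_mult_distrib ennreal_mult[symmetric] ennreal_leI)
      from mult_right_mono[OF this, of "intensity z"] show ?thesis
        using True T0 by (auto simp: indicator_def mult.assoc)
    next
      case False
      then show ?thesis by (auto simp: indicator_def)
    qed
  qed
  also have "\<dots> = ennreal (K\<^sup>2) * (\<integral>\<^sup>+z\<in>cylinder (t + T0). noise_density (t + T0) ?x0 z \<partial>lborel)"
    by (rule nn_integral_cmult) measurable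
  finally have "ennreal (lam\<^sup>2) * (\<integral>\<^sup>+z\<in>{z \<in> cylinder t. \<delta> \<le> t - fst z}. noise_density t x z \<partial>lborel)
      \<le> ennreal (lam\<^sup>2) * (ennreal (K\<^sup>2) * (\<integral>\<^sup>+z\<in>cylinder (t + T0). noise_density (t + T0) ?x0 z \<partial>lborel))"
    by (rule mult_left_mono) simp
  with m have "ennreal ((mean t x)\<^sup>2) + ennreal (lam\<^sup>2) *
       (\<integral>\<^sup>+z\<in>{z \<in> cylinder t. \<delta> \<le> t - fst z}. noise_density t x z \<partial>lborel) \<le>
     ennreal (K\<^sup>2) * ennreal ((mean (t + T0) ?x0)\<^sup>2) +
     ennreal (lam\<^sup>2) * (ennreal (K\<^sup>2) * (\<integral>\<^sup>+z\<in>cylinder (t + T0). noise_density (t + T0) ?x0 z \<partial>lborel))"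
    by (rule add_mono)
  also have "\<dots> = ennreal (K\<^sup>2) * second_moment (t + T0) ?x0"
    using t \<delta> T0 L_pos by (subst second_moment_identity) (auto simp: distrib_left mult_ac)
  finally show ?thesis .
qed

text \<open>
  Decay at the midpoint spreads to all points: the distant past is bounded by the midpoint, and the
  recent past is a feedback with coefficient one half.
\<close>

lemma uniform_decay:
  assumes a: "a > 0" and decay: "\<And>t. t1 \<le> t \<Longrightarrow> second_moment t (L / 2) \<le> ennreal (exp (- a * t))"
  shows "\<exists>B<\<infinity>. \<forall>t\<ge>0. \<forall>x\<in>{0..L}. ennreal (exp (a * t)) * second_moment t x \<le> B"
proof -
  \<comment> \<open>Chosen so that the feedback coefficient becomes one half; the factor exp 1 is the loss from
  replacing the weight on the window of length \<open>\<delta>\<close> below.\<close>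
  define \<eta> where "\<eta> = 1 / (2 * lam\<^sup>2 * (exp 1 * L\<^sub>\<sigma>\<^sup>2))"
  have \<eta>: "\<eta> > 0" using lam_pos L\<^sub>\<sigma>_pos by (simp add: \<eta>_def)
  obtain \<beta> where \<beta>: "\<beta> > 0" "\<And>x. x \<in> {0..L} \<Longrightarrow> (\<integral>\<^sup>+z\<in>domain.
      ennreal (exp (- \<beta> * fst z) * (dirichlet_heat_kernel L (fst z) x (snd z))\<^sup>2) \<partial>lborel) \<le> ennreal \<eta>"
    using heat_kernel_laplace_small[OF L_pos \<eta>] by blast
  \<comment> \<open>On a window of this length \<open>exp (a * r) \<le> exp 1 * exp (- \<beta> * r)\<close>.\<close>
  define \<delta> where "\<delta> = 1 / (a + \<beta>)"
  have \<delta>: "\<delta> > 0" using a \<beta> by (simp add: \<delta>_def)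
  obtain T0 where T0: "T0 > 0" and "\<exists>K>0. \<forall>t\<ge>\<delta>. \<forall>x\<in>{0..L}. \<forall>y\<in>{0..L}.
     \<bar>dirichlet_heat_kernel L t x y\<bar> \<le> K * dirichlet_heat_kernel L (t + T0) (L / 2) y"
    using heat_kernel_comparison[OF L_pos] \<delta> by blast
  then obtain K where K: "K > 0" "\<And>t x y. t \<ge> \<delta> \<Longrightarrow> x \<in> {0..L} \<Longrightarrow> y \<in> {0..L} \<Longrightarrow>
     \<bar>dirichlet_heat_kernel L t x y\<bar> \<le> K * dirichlet_heat_kernel L (t + T0) (L / 2) y"
    by blast
  show ?thesis
  proof (rule absorb_small_feedback[where \<tau>="max \<delta> t1" and C="ennreal (K\<^sup>2)"])
    show "(SUP t\<in>{0..T}. SUP x\<in>{0..L}. ennreal (exp (a * t)) * second_moment t x) < \<infinity>" if "0 \<le> T" for T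
      using sup_moment_finite[OF that, of a] by (simp add: sup_moment_def)
    show "0 \<le> max \<delta> t1" using \<delta> by simp
    show "ennreal (K\<^sup>2) < \<infinity>" by simp
    fix t x assume t: "max \<delta> t1 \<le> t" and x: "x \<in> {0..L}"
    then have t': "t > 0" "\<delta> \<le> t" "t1 \<le> t" using \<delta> by auto
    let ?far = "{z \<in> cylinder t. \<delta> \<le> t - fst z}"
    let ?near = "{z \<in> cylinder t. t - fst z < \<delta>}"
    let ?e = "ennreal (exp (a * t))"
    let ?N = "\<lambda>A. \<integral>\<^sup>+z\<in>A. noise_density t x z \<partial>lborel"
    have sets [measurable]: "?far \<in> sets borel" "?near \<in> sets borel"
    proof -
      have "{z \<in> space borel. \<delta> \<le> t - fst (z :: real \<times> real)} \<in> sets borel"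
        "{z \<in> space borel. t - fst (z :: real \<times> real) < \<delta>} \<in> sets borel" by measurable
      moreover have "?far = cylinder t \<inter> {z \<in> space borel. \<delta> \<le> t - fst z}"
        "?near = cylinder t \<inter> {z \<in> space borel. t - fst z < \<delta>}" by auto
      ultimately show "?far \<in> sets borel" "?near \<in> sets borel"
        using cylinder_sets[of t] by (simp_all only: sets.Int)
    qed
    have "?N (cylinder t) = (\<integral>\<^sup>+z. noise_density t x z * indicator ?far z + noise_density t x z * indicator ?near z \<partial>lborel)"
      by (intro nn_integral_cong) (auto simp: indicator_def)
    also have "\<dots> = ?N ?far + ?N ?near"
      by (rule nn_integral_add) measurable
    finally have split: "?N (cylinder t) = ?N ?far + ?N ?near" .
    have far: "?e * (ennreal ((mean t x)\<^sup>2) + ennreal (lam\<^sup>2) * ?N ?far) \<le> ennreal (K\<^sup>2)"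
    proof -
      have "ennreal ((mean t x)\<^sup>2) + ennreal (lam\<^sup>2) * ?N ?far \<le> ennreal (K\<^sup>2) * second_moment (t + T0) (L / 2)"
        by (rule far_past_bound[OF \<delta> T0 t'(2) x K(1) K(2)[OF _ x]])
      also have "\<dots> \<le> ennreal (K\<^sup>2) * ennreal (exp (- a * (t + T0)))"
        using t' T0 by (intro mult_left_mono decay) auto
      finally have "?e * (ennreal ((mean t x)\<^sup>2) + ennreal (lam\<^sup>2) * ?N ?far)
          \<le> ?e * (ennreal (K\<^sup>2) * ennreal (exp (- a * (t + T0))))"
        by (rule mult_left_mono) simp
      also have "\<dots> = ennreal (K\<^sup>2 * (exp (a * t) * exp (- a * (t + T0))))"
        by (simp add: ennreal_mult mult_ac)
      also have "exp (a * t) * exp (- a * (t + T0)) = exp (- a * T0)"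
        unfolding exp_add[symmetric] by (simp add: algebra_simps)
      also have "ennreal (K\<^sup>2 * exp (- a * T0)) \<le> ennreal (K\<^sup>2)"
        using a T0 by (intro ennreal_leI mult_left_le) auto
      finally show ?thesis .
    qed
    have "?e * ?N ?near \<le> ennreal (exp 1 * L\<^sub>\<sigma>\<^sup>2 * \<eta>) * sup_moment a t"
    proof (rule weighted_noise_bound[OF t'(1) x _ _ _ _ \<beta>(2)[OF x]])
      fix z assume z: "z \<in> ?near"
      then have "(a + \<beta>) * (t - fst z) \<le> (a + \<beta>) * \<delta>" using a \<beta>(1) by (intro mult_left_mono) auto
      also have "\<dots> = 1" using a \<beta>(1) by (simp add: \<delta>_def)
      finally have "a * (t - fst z) \<le> 1 + - \<beta> * (t - fst z)" by (simp add: algebra_simps)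
      then show "exp (a * (t - fst z)) \<le> exp 1 * exp (- \<beta> * (t - fst z))"
        unfolding exp_add[symmetric] by simp
    qed (use \<eta> sets in auto)
    then have "ennreal (lam\<^sup>2) * (?e * ?N ?near) \<le> ennreal (lam\<^sup>2) * (ennreal (exp 1 * L\<^sub>\<sigma>\<^sup>2 * \<eta>) * sup_moment a t)"
      by (rule mult_left_mono) simp
    also have "\<dots> = ennreal (lam\<^sup>2 * (exp 1 * L\<^sub>\<sigma>\<^sup>2 * \<eta>)) * sup_moment a t"
      using \<eta> by (simp add: ennreal_mult mult_ac)
    also have "lam\<^sup>2 * (exp 1 * L\<^sub>\<sigma>\<^sup>2 * \<eta>) = 1 / 2"
      using lam_pos L\<^sub>\<sigma>_pos by (simp add: \<eta>_def)
    finally have near: "ennreal (lam\<^sup>2) * (?e * ?N ?near) \<le> ennreal (1 / 2) * sup_moment a t" .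
    have "?e * second_moment t x = ?e * (ennreal ((mean t x)\<^sup>2) + ennreal (lam\<^sup>2) * ?N ?far) + ennreal (lam\<^sup>2) * (?e * ?N ?near)"
      unfolding second_moment_identity[OF t'(1) x] split by (simp add: distrib_left mult_ac add_ac)
    also have "\<dots> \<le> ennreal (K\<^sup>2) + ennreal (1 / 2) * sup_moment a t"
      by (rule add_mono[OF far near])
    finally show "?e * second_moment t x \<le> ennreal (K\<^sup>2) + ennreal (1 / 2) *
        (SUP s\<in>{0..t}. SUP y\<in>{0..L}. ennreal (exp (a * s)) * second_moment s y)"
      by (simp only: sup_moment_def)
  qed
qed

text \<open>
  With the weight \<open>exp (- \<beta> * t)\<close> the Laplace transform of the squared kernel is the feedback coefficient
  of the whole noise term, and it is small for large \<open>\<beta>\<close>. The deterministic part is bounded from time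
  \<open>1\<close> on.
\<close>

lemma exponential_growth_bound:
  "\<exists>\<beta>>0. \<exists>B<\<infinity>. \<forall>t\<ge>0. \<forall>x\<in>{0..L}. ennreal (exp (- \<beta> * t)) * second_moment t x \<le> B"
proof -
  define \<eta> where "\<eta> = 1 / (2 * lam\<^sup>2 * L\<^sub>\<sigma>\<^sup>2)"
  have \<eta>: "\<eta> > 0" using lam_pos L\<^sub>\<sigma>_pos by (simp add: \<eta>_def)
  obtain \<beta> where \<beta>: "\<beta> > 0" "\<And>x. x \<in> {0..L} \<Longrightarrow> (\<integral>\<^sup>+z\<in>domain.
      ennreal (exp (- \<beta> * fst z) * (dirichlet_heat_kernel L (fst z) x (snd z))\<^sup>2) \<partial>lborel) \<le> ennreal \<eta>"
    using heat_kernel_laplace_small[OF L_pos \<eta>] by blast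
  obtain C where C: "C > 0" "\<And>t x y. t \<ge> 1 \<Longrightarrow> x \<in> {0..L} \<Longrightarrow> y \<in> {0..L} \<Longrightarrow> \<bar>dirichlet_heat_kernel L t x y\<bar>
     \<le> C * (ground_state L x * ground_state L y * exp (- decay_rate L * t))"
    using heat_kernel_upper[OF L_pos zero_less_one] by blast
  have "\<exists>B<\<infinity>. \<forall>t\<ge>0. \<forall>x\<in>{0..L}. ennreal (exp (- \<beta> * t)) * second_moment t x \<le> B"
  proof (rule absorb_small_feedback[where \<tau>=1 and C="ennreal ((C * initial_mass)\<^sup>2)"])
    show "(SUP t\<in>{0..T}. SUP x\<in>{0..L}. ennreal (exp (- \<beta> * t)) * second_moment t x) < \<infinity>" if "0 \<le> T" for T
      using sup_moment_finite[OF that, of "- \<beta>"] by (simp add: sup_moment_def)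
    fix t x assume t: "(1::real) \<le> t" and x: "x \<in> {0..L}"
    then have t': "t > 0" by simp
    let ?e = "ennreal (exp (- \<beta> * t))"
    let ?N = "\<integral>\<^sup>+z\<in>cylinder t. noise_density t x z \<partial>lborel"
    have mean: "?e * ennreal ((mean t x)\<^sup>2) \<le> ennreal ((C * initial_mass)\<^sup>2)"
    proof -
      have "\<bar>mean t x\<bar> \<le> C * initial_mass"
      proof (rule mean_upper[OF t' x])
        fix y assume y: "y \<in> {0..L}"
        have "ground_state L x * ground_state L y * exp (- decay_rate L * t) \<le> 1 * ground_state L y * 1"
          using ground_state_nonneg[OF L_pos] ground_state_le_1 x y t decay_rate_pos[OF L_pos]
          by (intro mult_mono) auto
        then have "C * (ground_state L x * ground_state L y * exp (- decay_rate L * t)) \<le> C * ground_state L y"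
          using C(1) by simp
        with C(2)[OF t x y] show "\<bar>dirichlet_heat_kernel L t x y\<bar> \<le> C * ground_state L y" by linarith
      qed
      from power_mono[OF this abs_ge_zero, of 2] have "(mean t x)\<^sup>2 \<le> (C * initial_mass)\<^sup>2" by simp
      moreover have "exp (- \<beta> * t) \<le> 1" using \<beta>(1) t by simp
      ultimately have "exp (- \<beta> * t) * (mean t x)\<^sup>2 \<le> 1 * (C * initial_mass)\<^sup>2"
        by (intro mult_mono) auto
      then show ?thesis by (simp add: ennreal_mult[symmetric] ennreal_leI)
    qed
    have "?e * ?N \<le> ennreal (1 * L\<^sub>\<sigma>\<^sup>2 * \<eta>) * sup_moment (- \<beta>) t"
      by (rule weighted_noise_bound[OF t' x _ _ _ _ \<beta>(2)[OF x]]) (use \<eta> in auto)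
    then have "ennreal (lam\<^sup>2) * (?e * ?N) \<le> ennreal (lam\<^sup>2) * (ennreal (1 * L\<^sub>\<sigma>\<^sup>2 * \<eta>) * sup_moment (- \<beta>) t)"
      by (rule mult_left_mono) simp
    also have "\<dots> = ennreal (lam\<^sup>2 * (L\<^sub>\<sigma>\<^sup>2 * \<eta>)) * sup_moment (- \<beta>) t"
      using \<eta> by (simp add: ennreal_mult mult_ac)
    also have "lam\<^sup>2 * (L\<^sub>\<sigma>\<^sup>2 * \<eta>) = 1 / 2"
      using lam_pos L\<^sub>\<sigma>_pos by (simp add: \<eta>_def)
    finally have noise: "ennreal (lam\<^sup>2) * (?e * ?N) \<le> ennreal (1 / 2) * sup_moment (- \<beta>) t" .
    have "?e * second_moment t x = ?e * ennreal ((mean t x)\<^sup>2) + ennreal (lam\<^sup>2) * (?e * ?N)"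
      unfolding second_moment_identity[OF t' x] by (simp add: distrib_left mult_ac)
    also have "\<dots> \<le> ennreal ((C * initial_mass)\<^sup>2) + ennreal (1 / 2) * sup_moment (- \<beta>) t"
      by (rule add_mono[OF mean noise])
    finally show "?e * second_moment t x \<le> ennreal ((C * initial_mass)\<^sup>2) + ennreal (1 / 2) *
        (SUP s\<in>{0..t}. SUP y\<in>{0..L}. ennreal (exp (- \<beta> * s)) * second_moment s y)"
      by (simp only: sup_moment_def)
  qed auto
  then show ?thesis using \<beta>(1) by blast
qed

definition energy_square :: "real \<Rightarrow> ennreal" where
  "energy_square t = (\<integral>\<^sup>+x\<in>{0<..<L}. second_moment t x \<partial>lborel)"

lemma energy_square_le:
  assumes t: "t \<ge> 0" and b: "b \<ge> 0" and le: "\<And>x. x \<in> {0..L} \<Longrightarrow> ennreal (exp (\<gamma> * t)) * second_moment t x \<le> ennreal b"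
  shows "energy_square t \<le> ennreal (b * L * exp (- \<gamma> * t))"
proof -
  have "energy_square t \<le> (\<integral>\<^sup>+x. ennreal (b * exp (- \<gamma> * t)) * indicator {0<..<L} x \<partial>lborel)"
    unfolding energy_square_def
  proof (rule nn_integral_mono)
    fix x :: real
    show "second_moment t x * indicator {0<..<L} x \<le> ennreal (b * exp (- \<gamma> * t)) * indicator {0<..<L} x"
    proof (cases "x \<in> {0<..<L}")
      case True
      have "exp (- \<gamma> * t) * exp (\<gamma> * t) = 1" unfolding exp_add[symmetric] by simp
      then have "second_moment t x = ennreal (exp (- \<gamma> * t)) * (ennreal (exp (\<gamma> * t)) * second_moment t x)"
        by (simp add: mult.assoc[symmetric] ennreal_mult[symmetric])
      also have "\<dots> \<le> ennreal (exp (- \<gamma> * t)) * ennreal b"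
        using True by (intro mult_left_mono le) auto
      finally show ?thesis using True b by (simp add: ennreal_mult mult.commute)
    qed simp
  qed
  also have "\<dots> = ennreal (b * exp (- \<gamma> * t)) * ennreal L"
    using L_pos by (subst nn_integral_cmult_indicator) auto
  also have "\<dots> = ennreal (b * L * exp (- \<gamma> * t))"
    using b L_pos by (simp add: ennreal_mult[symmetric] mult_ac)
  finally show ?thesis .
qed

lemma energy_square_finite:
  assumes t: "t > 0"
  shows "energy_square t < \<infinity>"
proof -
  obtain \<beta> B where B: "B < \<infinity>" "\<And>t x. t \<ge> 0 \<Longrightarrow> x \<in> {0..L} \<Longrightarrow> ennreal (exp (- \<beta> * t)) * second_moment t x \<le> B"
    using exponential_growth_bound by blast
  obtain b where b: "B = ennreal b" "b \<ge> 0" using B(1) by (cases B) auto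
  have "energy_square t \<le> ennreal (b * L * exp (- (- \<beta>) * t))"
    using B(2) t b by (intro energy_square_le) auto
  also have "\<dots> < \<infinity>" by simp
  finally show ?thesis .
qed

lemma energy_eq_sqrt:
  assumes "t > 0"
  shows "energy M L u t = sqrt (enn2real (energy_square t))"
  using energy_eq[OF assms] energy_square_finite[OF assms] by (simp add: energy_square_def)

lemma energy_upper:
  assumes B: "B < \<infinity>" "\<And>t x. t \<ge> 0 \<Longrightarrow> x \<in> {0..L} \<Longrightarrow> ennreal (exp (\<gamma> * t)) * second_moment t x \<le> B"
  shows "\<exists>c>0. \<forall>t>0. energy M L u t \<le> c * exp (- \<gamma> / 2 * t)"
proof -
  obtain b where b: "B = ennreal b" "b \<ge> 0" using B(1) by (cases B) auto
  show ?thesis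
  proof (intro exI[of _ "sqrt (b * L) + 1"] conjI allI impI)
    show "sqrt (b * L) + 1 > 0" using b L_pos by (simp add: add_nonneg_pos)
    fix t :: real assume t: "t > 0"
    have "energy_square t \<le> ennreal (b * L * exp (- \<gamma> * t))"
      using B(2) t b by (intro energy_square_le) auto
    then have "enn2real (energy_square t) \<le> b * L * exp (- \<gamma> * t)"
      using b L_pos by (intro enn2real_leI) auto
    then have "energy M L u t \<le> sqrt (b * L * exp (- \<gamma> * t))"
      unfolding energy_eq_sqrt[OF t] by (rule real_sqrt_le_mono)
    also have "\<dots> = sqrt (b * L) * exp (- \<gamma> / 2 * t)"
    proof -
      have "exp (- \<gamma> * t) = (exp (- \<gamma> / 2 * t))\<^sup>2"
        by (simp add: power2_eq_square exp_add[symmetric])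
      then show ?thesis by (simp add: real_sqrt_mult)
    qed
    also have "\<dots> \<le> (sqrt (b * L) + 1) * exp (- \<gamma> / 2 * t)" by (intro mult_right_mono) auto
    finally show "energy M L u t \<le> (sqrt (b * L) + 1) * exp (- \<gamma> / 2 * t)" .
  qed
qed

text \<open>
  The second moment dominates the square of the mean, and for large times the mean dominates the
  ground state mode with amplitude proportional to \<open>initial_mass\<close>. It also shows that the energy is positive, which is
  needed for its logarithm to be meaningful.
\<close>

lemma energy_lower:
  "\<exists>c>0. \<forall>\<^sub>F t in at_top. c * exp (- decay_rate L * t) \<le> energy M L u t"
proof -
  obtain T0 where T0: "T0 > 0" "\<And>t x y. t \<ge> T0 \<Longrightarrow> x \<in> {0..L} \<Longrightarrow> y \<in> {0..L} \<Longrightarrow>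
     1 / L * (ground_state L x * ground_state L y * exp (- decay_rate L * t)) \<le> dirichlet_heat_kernel L t x y"
    using heat_kernel_lower[OF L_pos] by blast
  define c where "c = initial_mass / L * sqrt (L / 2)"
  have c: "c > 0" using initial_mass_pos L_pos by (simp add: c_def)
  have ground: "(\<integral>\<^sup>+x\<in>{0<..<L}. ennreal ((ground_state L x)\<^sup>2) \<partial>lborel) = ennreal (L / 2)"
  proof -
    have "(\<integral>\<^sup>+x\<in>{0<..<L}. ennreal ((ground_state L x)\<^sup>2) \<partial>lborel) = (\<integral>\<^sup>+x\<in>{0..L}. ennreal ((ground_state L x)\<^sup>2) \<partial>lborel)"
      by (intro nn_integral_cong) (use L_pos in \<open>auto simp: indicator_def ground_state_def less_le\<close>)
    then show ?thesis
      using integral_sine_polynomial_square[OF L_pos, of "\<lambda>_. 1" 1] by (simp add: ground_state_def)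
  qed
  have "c * exp (- decay_rate L * t) \<le> energy M L u t" if t: "t \<ge> T0" for t
  proof -
    have t': "t > 0" using t T0 by simp
    define q where "q = initial_mass / L * exp (- decay_rate L * t)"
    have q: "q > 0" using initial_mass_pos L_pos by (simp add: q_def)
    have "ennreal (q\<^sup>2 * (L / 2)) = ennreal (q\<^sup>2) * (\<integral>\<^sup>+x\<in>{0<..<L}. ennreal ((ground_state L x)\<^sup>2) \<partial>lborel)"
      unfolding ground by (rule ennreal_mult') simp
    also have "\<dots> = (\<integral>\<^sup>+x. ennreal (q\<^sup>2) * (ennreal ((ground_state L x)\<^sup>2) * indicator {0<..<L} x) \<partial>lborel)"
      by (rule nn_integral_cmult[symmetric]) measurable
    also have "\<dots> \<le> energy_square t"
      unfolding energy_square_def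
    proof (rule nn_integral_mono)
      fix x :: real
      show "ennreal (q\<^sup>2) * (ennreal ((ground_state L x)\<^sup>2) * indicator {0<..<L} x) \<le> second_moment t x * indicator {0<..<L} x"
      proof (cases "x \<in> {0<..<L}")
        case True
        then have x: "x \<in> {0..L}" by simp
        have "1 / L * ground_state L x * exp (- decay_rate L * t) * initial_mass \<le> mean t x"
          using T0(2)[OF t x] by (intro mean_lower t' x) (simp add: mult_ac)
        then have "q * ground_state L x \<le> mean t x" by (simp add: q_def mult_ac)
        moreover have "0 \<le> q * ground_state L x" using q ground_state_nonneg[OF L_pos x] by simp
        ultimately have "(q * ground_state L x)\<^sup>2 \<le> (mean t x)\<^sup>2" by (rule power_mono)
        then have "ennreal (q\<^sup>2) * ennreal ((ground_state L x)\<^sup>2) \<le> ennreal ((mean t x)\<^sup>2)"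
          by (simp add: power_mult_distrib ennreal_mult[symmetric] ennreal_leI)
        also have "\<dots> \<le> second_moment t x"
          unfolding second_moment_identity[OF t' x] by simp
        finally show ?thesis using True by simp
      qed simp
    qed
    finally have "q\<^sup>2 * (L / 2) \<le> enn2real (energy_square t)"
      using energy_square_finite[OF t'] by (cases "energy_square t") auto
    then have "sqrt (q\<^sup>2 * (L / 2)) \<le> energy M L u t"
      unfolding energy_eq_sqrt[OF t'] by (rule real_sqrt_le_mono)
    moreover have "sqrt (q\<^sup>2 * (L / 2)) = q * sqrt (L / 2)"
      using q by (simp only: real_sqrt_mult real_sqrt_abs abs_of_pos)
    moreover have "q * sqrt (L / 2) = c * exp (- decay_rate L * t)"
      by (simp add: q_def c_def)
    ultimately show ?thesis by simp
  qed
  then show ?thesis using c by (intro exI[of _ c]) (auto simp: eventually_at_top_linorder)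
qed

text \<open>
  The pointwise rate and the time from which it is effective may depend on \<open>x\<close> in an uncontrolled way,
  so Fatou's lemma is used along a sequence of bad times. Dividing by \<open>exp (t n / Suc n)\<close> keeps the
  integrals below \<open>1\<close>, while the integrands tend to infinity on an interval of positive length.
\<close>

lemma energy_growth:
  assumes \<epsilon>: "0 < \<epsilon>" "\<epsilon> < L / 2"
    and growth: "\<And>x. x \<in> {\<epsilon>..L - \<epsilon>} \<Longrightarrow> \<exists>a>0. \<forall>\<^sub>F t in at_top. ennreal (exp (a * t)) \<le> second_moment t x"
  shows "\<exists>b>0. \<forall>\<^sub>F t in at_top. ennreal (exp (b * t)) \<le> energy_square t"
proof (rule ccontr)
  assume no: "\<not> ?thesis"
  have "\<exists>t\<ge>real (Suc n). energy_square t < ennreal (exp (t / real (Suc n)))" for n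
  proof (rule ccontr)
    assume "\<not> ?thesis"
    then have "\<forall>\<^sub>F t in at_top. ennreal (exp (1 / real (Suc n) * t)) \<le> energy_square t"
      by (intro eventually_at_top_linorderI[of "real (Suc n)"]) (auto simp: not_less)
    with no show False by (metis of_nat_0_less_iff zero_less_Suc zero_less_divide_1_iff)
  qed
  then obtain t where t: "\<And>n. t n \<ge> real (Suc n)" "\<And>n. energy_square (t n) < ennreal (exp (t n / real (Suc n)))"
    by metis
  have tpos: "t n > 0" for n using t(1)[of n] by simp
  have t_lim: "filterlim t at_top sequentially"
    by (rule filterlim_at_top_mono[OF filterlim_real_sequentially]) (intro always_eventually allI order_trans[OF _ t(1)], simp)
  define g where "g n x = ennreal (exp (- t n / real (Suc n))) * (second_moment (t n) x * indicator {0<..<L} x)" for n x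
  have g_meas [measurable]: "g n \<in> borel_measurable lborel" for n
    unfolding g_def using second_moment_measurable[OF tpos[of n]]
    by (intro borel_measurable_times_ennreal[OF borel_measurable_const]) simp
  have g_le: "(\<integral>\<^sup>+x. g n x \<partial>lborel) \<le> 1" for n
  proof -
    have "(\<integral>\<^sup>+x. g n x \<partial>lborel) = ennreal (exp (- t n / real (Suc n))) * energy_square (t n)"
      unfolding g_def energy_square_def using second_moment_measurable[OF tpos[of n]]
      by (intro nn_integral_cmult) simp
    also have "\<dots> \<le> ennreal (exp (- t n / real (Suc n))) * ennreal (exp (t n / real (Suc n)))"
      using t(2)[of n] by (intro mult_left_mono) auto
    also have "\<dots> = 1"
      by (simp add: ennreal_mult[symmetric] exp_add[symmetric])
    finally show ?thesis .
  qed
  have g_inf: "liminf (\<lambda>n. g n x) = \<infinity>" if x: "x \<in> {\<epsilon>..L - \<epsilon>}" for x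
  proof -
    have xin: "x \<in> {0<..<L}" using x \<epsilon> by auto
    obtain a where a: "a > 0" "\<forall>\<^sub>F t in at_top. ennreal (exp (a * t)) \<le> second_moment t x"
      using growth[OF x] by blast
    from a(2) t_lim have ev: "\<forall>\<^sub>F n in sequentially. ennreal (exp (a * t n)) \<le> second_moment (t n) x"
      by (rule eventually_compose_filterlim)
    have "\<forall>\<^sub>F n in sequentially. 1 / real (Suc n) < a / 2"
      using a(1) by (intro order_tendstoD(2)[OF LIMSEQ_Suc[OF lim_1_over_n]]) auto
    with ev have "\<forall>\<^sub>F n in sequentially. ennreal (exp (a / 2 * real n)) \<le> g n x"
    proof eventually_elim
      case (elim n)
      have "a / 2 * real n \<le> (a - 1 / real (Suc n)) * t n"
        using elim(2) a(1) t(1)[of n] by (intro mult_mono) auto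
      then have "ennreal (exp (a / 2 * real n)) \<le> ennreal (exp (- t n / real (Suc n)) * exp (a * t n))"
        unfolding exp_add[symmetric] by (intro ennreal_leI) (simp add: algebra_simps)
      also have "\<dots> = ennreal (exp (- t n / real (Suc n))) * ennreal (exp (a * t n))"
        by (simp add: ennreal_mult)
      also have "\<dots> \<le> g n x"
        unfolding g_def using xin elim(1) by (simp add: mult_left_mono)
      finally show ?case .
    qed
    then have "liminf (\<lambda>n. ennreal (exp (a / 2 * real n))) \<le> liminf (\<lambda>n. g n x)"
      by (rule Liminf_mono)
    moreover have "liminf (\<lambda>n. ennreal (exp (a / 2 * real n))) = \<infinity>"
    proof (rule lim_imp_Liminf)
      have "filterlim (\<lambda>n. exp (a / 2 * real n)) at_top sequentially"
        using a(1) by real_asymp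
      then show "(\<lambda>n. ennreal (exp (a / 2 * real n))) \<longlonglongrightarrow> \<infinity>"
        by (simp add: ennreal_tendsto_top_eq_at_top)
    qed simp
    ultimately show ?thesis by (simp add: top_unique)
  qed
  have "\<infinity> = \<infinity> * emeasure lborel {\<epsilon>..L - \<epsilon>}"
    using \<epsilon> by (simp add: ennreal_top_mult)
  also have "\<dots> = (\<integral>\<^sup>+x. \<infinity> * indicator {\<epsilon>..L - \<epsilon>} x \<partial>lborel)"
    by (rule nn_integral_cmult_indicator[symmetric]) simp
  also have "\<dots> \<le> (\<integral>\<^sup>+x. liminf (\<lambda>n. g n x) \<partial>lborel)"
    by (intro nn_integral_mono) (auto simp: indicator_def g_inf)
  also have "\<dots> \<le> liminf (\<lambda>n. \<integral>\<^sup>+x. g n x \<partial>lborel)"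
    by (rule nn_integral_liminf) simp
  also have "\<dots> \<le> 1"
    by (rule Liminf_le) (use g_le in auto)
  finally have "(\<infinity> :: ennreal) \<le> 1" .
  then show False by (simp add: top_unique)
qed

text \<open>
  Decay at the midpoint gives the negative upper rate through \<open>uniform_decay\<close>; that the rate is not
  \<open>- \<infinity>\<close> comes from \<open>energy_lower\<close>, since a lower rate is at most the upper rate.
\<close>

theorem energy_decays:
  assumes "upper_rate (\<lambda>t. expectation (\<lambda>\<omega>. \<bar>u t (L / 2) \<omega>\<bar>\<^sup>2)) < 0"
  shows "- \<infinity> < upper_rate (energy M L u)" "upper_rate (energy M L u) < 0"
proof -
  obtain c where c: "c > 0" "\<forall>\<^sub>F t in at_top. c * exp (- decay_rate L * t) \<le> energy M L u t"
    using energy_lower by blast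
  have "ereal (- decay_rate L) \<le> lower_rate (energy M L u)"
    by (rule lower_rate_ge[OF c])
  also note lower_rate_le_upper_rate
  finally show "- \<infinity> < upper_rate (energy M L u)" by (rule less_le_trans[rotated]) simp
  obtain a where a: "a > 0" "\<forall>\<^sub>F t in at_top. expectation (\<lambda>\<omega>. \<bar>u t (L / 2) \<omega>\<bar>\<^sup>2) \<le> exp (- a * t)"
    using upper_rate_negD[OF assms] by auto
  have "\<forall>\<^sub>F t in at_top. second_moment t (L / 2) \<le> ennreal (exp (- a * t))"
    using a(2) eventually_gt_at_top[of 0]
  proof eventually_elim
    case (elim t)
    have "second_moment t (L / 2) < \<infinity>" using elim L_pos by (intro second_moment_finite) auto
    then have "second_moment t (L / 2) = ennreal (enn2real (second_moment t (L / 2)))" by (simp add: less_top)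
    also have "\<dots> \<le> ennreal (exp (- a * t))"
      using elim L_pos expectation_eq_second_moment[of t "L / 2"] by (intro ennreal_leI) auto
    finally show ?case .
  qed
  then obtain t1 where "\<And>t. t \<ge> t1 \<Longrightarrow> second_moment t (L / 2) \<le> ennreal (exp (- a * t))"
    by (auto simp: eventually_at_top_linorder)
  then obtain B where "B < \<infinity>" "\<And>t x. t \<ge> 0 \<Longrightarrow> x \<in> {0..L} \<Longrightarrow> ennreal (exp (a * t)) * second_moment t x \<le> B"
    using uniform_decay[OF a(1), of t1] by blast
  from energy_upper[OF this] obtain d where d: "d > 0" "\<And>t. t > 0 \<Longrightarrow> energy M L u t \<le> d * exp (- a / 2 * t)"
    by blast
  have "\<forall>\<^sub>F t in at_top. 0 < energy M L u t \<and> energy M L u t \<le> d * exp (- a / 2 * t)"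
    using c(2) eventually_gt_at_top[of 0]
  proof eventually_elim
    case (elim t)
    have "0 < c * exp (- decay_rate L * t)" using c(1) by simp
    then show ?case using elim d(2)[of t] by linarith
  qed
  from upper_rate_le[OF d(1) this] have "upper_rate (energy M L u) \<le> ereal (- a / 2)" .
  also have "\<dots> < 0" using a(1) by simp
  finally show "upper_rate (energy M L u) < 0" .
qed

theorem energy_grows:
  assumes \<epsilon>: "0 < \<epsilon>" "\<epsilon> < L / 2"
    and rate: "\<And>x. x \<in> {\<epsilon>..L - \<epsilon>} \<Longrightarrow> 0 < lower_rate (\<lambda>t. expectation (\<lambda>\<omega>. \<bar>u t x \<omega>\<bar>\<^sup>2))"
  shows "0 < lower_rate (energy M L u)" "lower_rate (energy M L u) < \<infinity>"
proof -
  have "\<exists>a>0. \<forall>\<^sub>F t in at_top. ennreal (exp (a * t)) \<le> second_moment t x" if x: "x \<in> {\<epsilon>..L - \<epsilon>}" for x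
  proof -
    obtain a where a: "a > 0" "\<forall>\<^sub>F t in at_top. exp (a * t) \<le> expectation (\<lambda>\<omega>. \<bar>u t x \<omega>\<bar>\<^sup>2)"
      using lower_rate_posD[OF rate[OF x]] by auto
    have "\<forall>\<^sub>F t in at_top. ennreal (exp (a * t)) \<le> second_moment t x"
      using a(2) eventually_gt_at_top[of 0]
    proof eventually_elim
      case (elim t)
      have xin: "x \<in> {0<..<L}" using x \<epsilon> by auto
      have "ennreal (exp (a * t)) \<le> ennreal (enn2real (second_moment t x))"
        using elim expectation_eq_second_moment[OF _ xin, of t] by (intro ennreal_leI) auto
      also have "\<dots> = second_moment t x"
        using second_moment_finite[of t x] elim xin by (auto simp: less_top)
      finally show ?case .
    qed
    then show ?thesis using a(1) by blast
  qed
  then obtain b where b: "b > 0" "\<forall>\<^sub>F t in at_top. ennreal (exp (b * t)) \<le> energy_square t"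
    using energy_growth[OF \<epsilon>] by blast
  have low: "\<forall>\<^sub>F t in at_top. 1 * exp (b / 2 * t) \<le> energy M L u t"
    using b(2) eventually_gt_at_top[of 0]
  proof eventually_elim
    case (elim t)
    have "exp (b * t) \<le> enn2real (energy_square t)"
      using elim energy_square_finite[of t] by (cases "energy_square t") auto
    then have "sqrt (exp (b * t)) \<le> energy M L u t"
      unfolding energy_eq_sqrt[OF elim(2)] by (rule real_sqrt_le_mono)
    moreover have "exp (b * t) = (exp (b / 2 * t))\<^sup>2" by (simp add: power2_eq_square exp_add[symmetric])
    ultimately show ?case by simp
  qed
  have "0 < ereal (b / 2)" using b(1) by simp
  also have "\<dots> \<le> lower_rate (energy M L u)" by (rule lower_rate_ge[OF _ low]) simp
  finally show "0 < lower_rate (energy M L u)" .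
  obtain \<beta> B where "B < \<infinity>" "\<And>t x. t \<ge> 0 \<Longrightarrow> x \<in> {0..L} \<Longrightarrow> ennreal (exp (- \<beta> * t)) * second_moment t x \<le> B"
    using exponential_growth_bound by blast
  from energy_upper[OF this] obtain d where d: "d > 0" "\<And>t. t > 0 \<Longrightarrow> energy M L u t \<le> d * exp (- (- \<beta>) / 2 * t)"
    by blast
  have "\<forall>\<^sub>F t in at_top. 0 < energy M L u t \<and> energy M L u t \<le> d * exp (- (- \<beta>) / 2 * t)"
    using low eventually_gt_at_top[of 0]
  proof eventually_elim
    case (elim t)
    have "0 < 1 * exp (b / 2 * t)" by simp
    then show ?case using elim d(2)[of t] by linarith
  qed
  from upper_rate_le[OF d(1) this] have "upper_rate (energy M L u) \<le> ereal (- (- \<beta>) / 2)" .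
  then have "lower_rate (energy M L u) \<le> ereal (- (- \<beta>) / 2)"
    using lower_rate_le_upper_rate order_trans by blast
  then show "lower_rate (energy M L u) < \<infinity>" by (rule le_less_trans) simp
qed

end

theorem corollary1p3:
  fixes M :: "'w measure"
    and F :: "real \<Rightarrow> 'w measure"
    and W :: "(real \<times> real) set \<Rightarrow> 'w \<Rightarrow> real"
    and \<sigma> u0 :: "real \<Rightarrow> real"
    and u :: "real \<Rightarrow> real \<Rightarrow> real \<Rightarrow> 'w \<Rightarrow> real"
    and L l\<^sub>\<sigma> L\<^sub>\<sigma> \<epsilon> lam0 lam1 :: real
  assumes "prob_space M"
    and "L > 0"
    and "white_noise M L W"
    and "noise_filtration M L W F"
    and "\<exists>C. C-lipschitz_on UNIV \<sigma>"
    and "l\<^sub>\<sigma> > 0" and "L\<^sub>\<sigma> > 0"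
    and "\<And>x. l\<^sub>\<sigma> * \<bar>x\<bar> \<le> \<bar>\<sigma> x\<bar> \<and> \<bar>\<sigma> x\<bar> \<le> L\<^sub>\<sigma> * \<bar>x\<bar>"
    and "u0 \<in> borel_measurable (lebesgue_on {0..L})"
    and "\<And>x. x \<in> {0..L} \<Longrightarrow> 0 \<le> u0 x"
    and "bounded (u0 ` {0..L})"
    and "emeasure lebesgue {x \<in> {0..L}. u0 x > 0} > 0"
    and "\<And>lam. lam > 0 \<Longrightarrow> mild_solution M F W L \<sigma> u0 lam (u lam)"
    and "\<And>lam. lam > 0 \<Longrightarrow> bounded_second_moments M L (u lam)"
    and "0 < \<epsilon>" and "\<epsilon> < L / 2"
    and "lam0 > 0" and "lam1 > 0"
    and "\<And>lam x. lam \<in> {0<..<lam0} \<Longrightarrow> x \<in> {0<..<L} \<Longrightarrow>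
           - \<infinity> < upper_rate (\<lambda>t. prob_space.expectation M (\<lambda>\<omega>. \<bar>u lam t x \<omega>\<bar>\<^sup>2)) \<and>
           upper_rate (\<lambda>t. prob_space.expectation M (\<lambda>\<omega>. \<bar>u lam t x \<omega>\<bar>\<^sup>2)) < 0"
    and "\<And>lam x. lam > lam1 \<Longrightarrow> x \<in> {\<epsilon>..L - \<epsilon>} \<Longrightarrow>
           0 < lower_rate (\<lambda>t. prob_space.expectation M (\<lambda>\<omega>. \<bar>u lam t x \<omega>\<bar>\<^sup>2)) \<and>
           lower_rate (\<lambda>t. prob_space.expectation M (\<lambda>\<omega>. \<bar>u lam t x \<omega>\<bar>\<^sup>2)) < \<infinity>"
  shows "(\<forall>lam\<in>{0<..<lam0}.
            - \<infinity> < upper_rate (energy M L (u lam)) \<and> upper_rate (energy M L (u lam)) < 0) \<and>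
         (\<forall>lam>lam1.
            0 < lower_rate (energy M L (u lam)) \<and> lower_rate (energy M L (u lam)) < \<infinity>)"
proof -
  interpret prob_space M by fact
  have noise: "walsh_noise M L W F"
    by unfold_locales fact+
  have spde: "heat_spde M L W F \<sigma> u0 lam L\<^sub>\<sigma> (u lam)" if "lam > 0" for lam
  proof (intro heat_spde.intro[OF noise] heat_spde_axioms.intro)
    show "\<bar>\<sigma> v\<bar> \<le> L\<^sub>\<sigma> * \<bar>v\<bar>" for v using assms(8) by blast
  qed (fact assms(2,5,7,9-12) that assms(13)[OF that] assms(14)[OF that])+
  have small: "- \<infinity> < upper_rate (energy M L (u lam)) \<and> upper_rate (energy M L (u lam)) < 0"
    if lam: "lam \<in> {0<..<lam0}" for lam
  proof -
    interpret heat_spde M L W F \<sigma> u0 lam L\<^sub>\<sigma> "u lam" using lam by (intro spde) simp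
    have "upper_rate (\<lambda>t. expectation (\<lambda>\<omega>. \<bar>u lam t (L / 2) \<omega>\<bar>\<^sup>2)) < 0"
      using assms(19)[OF lam, of "L / 2"] L_pos by simp
    from energy_decays[OF this] show ?thesis by simp
  qed
  have large: "0 < lower_rate (energy M L (u lam)) \<and> lower_rate (energy M L (u lam)) < \<infinity>"
    if lam: "lam > lam1" for lam
  proof -
    interpret heat_spde M L W F \<sigma> u0 lam L\<^sub>\<sigma> "u lam" using lam \<open>lam1 > 0\<close> by (intro spde) simp
    show ?thesis
      using energy_grows[OF \<open>0 < \<epsilon>\<close> \<open>\<epsilon> < L / 2\<close>] assms(20)[OF lam] by blast
  qed
  show ?thesis using small large by blast
qed

end
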